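(* We have $\|R(is,A)\|=O(|s|^{1/2})$ as $|s|\to\infty$ ($s\in\mathbb{R}$); that is, there exist constants $C,N>0$ such that $\|R(is,A)\|\le C|s|^{1/2}$ for all $s\in\mathbb{R}$ with $|s|\ge N$.
   Context: All function spaces are complex-valued. Let $X$ be the Hilbert space of all $(u,v,w,\tilde u,\tilde v)\in H^1(0,1)\times L^2(0,1)\times L^2(1,2)\times H^1(2,3)\times L^2(2,3)$ with $u(0)=\tilde u(3)=0$, with norm $\|(u,v,w,\tilde u,\tilde v)\|_X^2=\|u'\|_{L^2}^2+\|v\|_{L^2}^2+\|w\|_{L^2}^2+\|\tilde u'\|_{L^2}^2+\|\tilde v\|_{L^2}^2$ and the corresponding inner product. Let $X_1=X\cap[H^2(0,1)\times H^1(0,1)\times H^2(1,2)\times H^2(2,3)\times H^1(2,3)]$, and let $A$ be the operator on $X$ given by $A(u,v,w,\tilde u,\tilde v)=(v,u'',w'',\tilde v,\tilde u'')$ with domain $$D(A)=\{(u,v,w,\tilde u,\tilde v)\in X_1: v(0)=\tilde v(3)=0,\ u'(1)=w'(1),\ v(1)=w(1),\ \tilde u'(2)=w'(2),\ \tilde v(2)=w(2)\}.$$ For $\lambda$ in the resolvent set $\rho(A)$, $R(\lambda,A)=(\lambda-A)^{-1}$, and $\|\cdot\|$ denotes the operator norm on $X$. The spectrum of $A$ does not meet $i\mathbb{R}$, so $R(is,A)$ is defined for all $s\in\mathbb{R}$. *)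

theory Defs
  imports "HOL-Analysis.Analysis"
begin

section \<open>Sobolev spaces on a bounded interval\<close>

text \<open>Elements of the Lebesgue and Sobolev spaces on \<open>(a,b)\<close> are handled here through
  representatives, i.e. functions on the real line of which only the values on \<open>(a,b)\<close> matter;
  the identification of functions that agree almost everywhere is carried out by the quotient
  type \<open>state\<close> below.\<close>

abbreviation int_meas :: "real \<Rightarrow> real \<Rightarrow> real measure" where
  "int_meas a b \<equiv> lebesgue_on {a<..<b}"

definition L2 :: "real \<Rightarrow> real \<Rightarrow> (real \<Rightarrow> complex) set" where
  "L2 a b = {f. f \<in> borel_measurable (int_meas a b) \<and>
                integrable (int_meas a b) (\<lambda>x. (cmod (f x))\<^sup>2)}"

definition ae_eq :: "real \<Rightarrow> real \<Rightarrow> (real \<Rightarrow> complex) \<Rightarrow> (real \<Rightarrow> complex) \<Rightarrow> bool" where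
  "ae_eq a b f g \<longleftrightarrow> (AE x in int_meas a b. f x = g x)"

definition l2_inner :: "real \<Rightarrow> real \<Rightarrow> (real \<Rightarrow> complex) \<Rightarrow> (real \<Rightarrow> complex) \<Rightarrow> complex" where
  "l2_inner a b f g = (LINT x|int_meas a b. f x * cnj (g x))"

definition l2_norm :: "real \<Rightarrow> real \<Rightarrow> (real \<Rightarrow> complex) \<Rightarrow> real" where
  "l2_norm a b f = sqrt (LINT x|int_meas a b. (cmod (f x))\<^sup>2)"

text \<open>Weak derivatives are tested against \<open>C\<^sup>1\<close> functions with compact support in \<open>(a,b)\<close>, as
  is common in dimension one; by mollification, smooth test functions give the same notion.\<close>

definition test_fun :: "real \<Rightarrow> real \<Rightarrow> (real \<Rightarrow> real) \<Rightarrow> bool" where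
  "test_fun a b \<phi> \<longleftrightarrow> \<phi> C1_differentiable_on UNIV \<and>
     (\<exists>K. compact K \<and> K \<subseteq> {a<..<b} \<and> (\<forall>x. x \<notin> K \<longrightarrow> \<phi> x = 0))"

definition has_weak_deriv ::
    "real \<Rightarrow> real \<Rightarrow> (real \<Rightarrow> complex) \<Rightarrow> (real \<Rightarrow> complex) \<Rightarrow> bool" where
  "has_weak_deriv a b f g \<longleftrightarrow> f \<in> L2 a b \<and> g \<in> L2 a b \<and>
     (\<forall>\<phi>. test_fun a b \<phi> \<longrightarrow>
        (LINT x|int_meas a b. vector_derivative \<phi> (at x) *\<^sub>R f x) =
        - (LINT x|int_meas a b. \<phi> x *\<^sub>R g x))"

definition weak_deriv :: "real \<Rightarrow> real \<Rightarrow> (real \<Rightarrow> complex) \<Rightarrow> (real \<Rightarrow> complex)" where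
  "weak_deriv a b f = (SOME g. has_weak_deriv a b f g)"

definition H1 :: "real \<Rightarrow> real \<Rightarrow> (real \<Rightarrow> complex) set" where
  "H1 a b = {f. \<exists>g. has_weak_deriv a b f g}"

definition H2 :: "real \<Rightarrow> real \<Rightarrow> (real \<Rightarrow> complex) set" where
  "H2 a b = {f \<in> H1 a b. weak_deriv a b f \<in> H1 a b}"

text \<open>\<open>has_value a b f p c\<close>: the continuous representative of \<open>f\<close> on \<open>[a,b]\<close> takes the value
  \<open>c\<close> at \<open>p\<close>.  For \<open>a < b\<close> there is at most one such representative, and every function in
  \<open>H1 a b\<close> has one.\<close>

definition has_value :: "real \<Rightarrow> real \<Rightarrow> (real \<Rightarrow> complex) \<Rightarrow> real \<Rightarrow> complex \<Rightarrow> bool" where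
  "has_value a b f p c \<longleftrightarrow>
     (\<exists>g. continuous_on {a..b} g \<and> ae_eq a b f g \<and> g p = c)"


subsection \<open>Facts needed for the state space to be well defined\<close>

lemma ae_eq_refl [simp]: "ae_eq a b f f"
  by (simp add: ae_eq_def)

lemma ae_eq_sym: "ae_eq a b f g \<Longrightarrow> ae_eq a b g f"
  unfolding ae_eq_def by (auto elim: eventually_mono)

lemma ae_eq_trans: "ae_eq a b f g \<Longrightarrow> ae_eq a b g h \<Longrightarrow> ae_eq a b f h"
  unfolding ae_eq_def by (auto elim: eventually_elim2)

lemma ae_eq_add:
  "ae_eq a b f f' \<Longrightarrow> ae_eq a b g g' \<Longrightarrow> ae_eq a b (\<lambda>x. f x + g x) (\<lambda>x. f' x + g' x)"
  unfolding ae_eq_def by (auto elim: eventually_elim2)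

lemma ae_eq_scale: "ae_eq a b f f' \<Longrightarrow> ae_eq a b (\<lambda>x. c * f x) (\<lambda>x. c * f' x)"
  unfolding ae_eq_def by (auto elim: eventually_mono)

lemma finite_measure_int_meas: "finite_measure (int_meas a b)"
  by (rule finite_measure_lebesgue_on) simp

lemma L2_measurable: "f \<in> L2 a b \<Longrightarrow> f \<in> borel_measurable (int_meas a b)"
  by (simp add: L2_def)

lemma L2_zero [simp]: "(\<lambda>x. 0) \<in> L2 a b"
  by (simp add: L2_def)

lemma L2_scale: "f \<in> L2 a b \<Longrightarrow> (\<lambda>x. c * f x) \<in> L2 a b"
  by (auto simp: L2_def norm_mult power_mult_distrib)

lemma L2_add:
  assumes "f \<in> L2 a b" "g \<in> L2 a b"
  shows "(\<lambda>x. f x + g x) \<in> L2 a b"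
proof -
  have m[measurable]: "f \<in> borel_measurable (int_meas a b)" "g \<in> borel_measurable (int_meas a b)"
    using assms by (auto simp: L2_def)
  have "integrable (int_meas a b) (\<lambda>x. (cmod (f x + g x))\<^sup>2)"
  proof (rule Bochner_Integration.integrable_bound)
    show "integrable (int_meas a b) (\<lambda>x. 2 * (cmod (f x))\<^sup>2 + 2 * (cmod (g x))\<^sup>2)"
      using assms by (auto simp: L2_def)
    show "AE x in int_meas a b. norm ((cmod (f x + g x))\<^sup>2)
            \<le> norm (2 * (cmod (f x))\<^sup>2 + 2 * (cmod (g x))\<^sup>2)"
    proof (rule AE_I2)
      fix x
      have "(cmod (f x + g x))\<^sup>2 \<le> (cmod (f x) + cmod (g x))\<^sup>2"
        by (intro power_mono norm_triangle_ineq) auto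
      also have "\<dots> \<le> 2 * (cmod (f x))\<^sup>2 + 2 * (cmod (g x))\<^sup>2"
        using sum_squares_bound[of "cmod (f x)" "cmod (g x)"] by (simp add: power2_sum)
      finally show "norm ((cmod (f x + g x))\<^sup>2)
            \<le> norm (2 * (cmod (f x))\<^sup>2 + 2 * (cmod (g x))\<^sup>2)" by simp
    qed
  qed simp
  then show ?thesis by (simp add: L2_def)
qed

lemma L2_cong:
  assumes "f \<in> L2 a b" "ae_eq a b f g" "g \<in> borel_measurable (int_meas a b)"
  shows "g \<in> L2 a b"
proof -
  have [measurable]: "f \<in> borel_measurable (int_meas a b)" "g \<in> borel_measurable (int_meas a b)"
    using assms by (auto simp: L2_def)
  have "integrable (int_meas a b) (\<lambda>x. (cmod (g x))\<^sup>2)"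
  proof (rule integrable_cong_AE_imp)
    show "integrable (int_meas a b) (\<lambda>x. (cmod (f x))\<^sup>2)" using assms by (simp add: L2_def)
    show "AE x in int_meas a b. (cmod (f x))\<^sup>2 = (cmod (g x))\<^sup>2"
      using assms(2) unfolding ae_eq_def by (auto elim: eventually_mono)
  qed simp
  then show ?thesis by (simp add: L2_def)
qed

lemma L2_integrable_mult:
  assumes "f \<in> L2 a b" "g \<in> L2 a b"
  shows "integrable (int_meas a b) (\<lambda>x. f x * cnj (g x))"
proof (rule Bochner_Integration.integrable_bound)
  have [measurable]: "f \<in> borel_measurable (int_meas a b)" "g \<in> borel_measurable (int_meas a b)"
    using assms by (auto simp: L2_def)
  have [measurable]: "cnj \<in> borel_measurable borel"
    by (intro borel_measurable_continuous_onI continuous_intros)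
  show "(\<lambda>x. f x * cnj (g x)) \<in> borel_measurable (int_meas a b)" by measurable
  show "integrable (int_meas a b) (\<lambda>x. (cmod (f x))\<^sup>2 + (cmod (g x))\<^sup>2)"
    using assms by (auto simp: L2_def)
  show "AE x in int_meas a b. norm (f x * cnj (g x)) \<le> norm ((cmod (f x))\<^sup>2 + (cmod (g x))\<^sup>2)"
  proof (rule AE_I2)
    fix x
    have "2 * (cmod (f x) * cmod (g x)) \<le> (cmod (f x))\<^sup>2 + (cmod (g x))\<^sup>2"
      using sum_squares_bound[of "cmod (f x)" "cmod (g x)"] by simp
    moreover have "0 \<le> cmod (f x) * cmod (g x)" by simp
    ultimately have "cmod (f x) * cmod (g x) \<le> (cmod (f x))\<^sup>2 + (cmod (g x))\<^sup>2" by linarith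
    then show "norm (f x * cnj (g x)) \<le> norm ((cmod (f x))\<^sup>2 + (cmod (g x))\<^sup>2)"
      by (simp add: norm_mult)
  qed
qed

lemma L2_one: "(\<lambda>x. c) \<in> L2 a b"
  using finite_measure.integrable_const[OF finite_measure_int_meas] by (simp add: L2_def)

lemma L2_integrable: "f \<in> L2 a b \<Longrightarrow> integrable (int_meas a b) f"
  using L2_integrable_mult[OF _ L2_one[of 1]] by simp

lemma bounded_continuous_mult_integrable:
  fixes w :: "real \<Rightarrow> real" and f :: "real \<Rightarrow> 'a::{banach, second_countable_topology}"
  assumes "integrable (int_meas a b) f" "continuous_on UNIV w" "\<And>x. \<bar>w x\<bar> \<le> B"
  shows "integrable (int_meas a b) (\<lambda>x. w x *\<^sub>R f x)"
proof (rule Bochner_Integration.integrable_bound)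
  have [measurable]: "w \<in> borel_measurable borel"
    using assms(2) by (rule borel_measurable_continuous_onI)
  have [measurable]: "w \<in> borel_measurable (int_meas a b)"
    using \<open>w \<in> borel_measurable borel\<close>
    by (intro measurable_restrict_space1 measurable_completion) (simp add: borel_measurable_continuous_onI)
  have [measurable]: "f \<in> borel_measurable (int_meas a b)" using assms(1) by auto
  show "(\<lambda>x. w x *\<^sub>R f x) \<in> borel_measurable (int_meas a b)" by measurable
  show "integrable (int_meas a b) (\<lambda>x. B * norm (f x))" using assms(1) by auto
  show "AE x in int_meas a b. norm (w x *\<^sub>R f x) \<le> norm (B * norm (f x))"
  proof (rule AE_I2)
    fix x
    have "0 \<le> B" using assms(3)[of x] by linarith
    then show "norm (w x *\<^sub>R f x) \<le> norm (B * norm (f x))"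
      using assms(3)[of x] by (simp add: abs_mult mult_right_mono)
  qed
qed

text \<open>Continuous real functions with compact support in \<open>(a,b)\<close>.\<close>

definition supp_fun :: "real \<Rightarrow> real \<Rightarrow> (real \<Rightarrow> real) \<Rightarrow> bool" where
  "supp_fun a b w \<longleftrightarrow> continuous_on UNIV w \<and>
     (\<exists>p q. a < p \<and> p < q \<and> q < b \<and> (\<forall>x. x \<notin> {p..q} \<longrightarrow> w x = 0))"

lemma supp_funI:
  assumes "continuous_on UNIV w" "a < p" "p < q" "q < b" "\<And>x. x \<notin> {p..q} \<Longrightarrow> w x = 0"
  shows "supp_fun a b w"
  using assms unfolding supp_fun_def by blast

lemma supp_fun_bounded:
  assumes "supp_fun a b w" shows "\<exists>B. \<forall>x. \<bar>w x\<bar> \<le> B"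
proof -
  obtain p q where pq: "a < p" "p < q" "q < b" "\<forall>x. x \<notin> {p..q} \<longrightarrow> w x = 0"
    and c: "continuous_on UNIV w"
    using assms by (auto simp: supp_fun_def)
  have "bounded (w ` {p..q})"
    by (intro compact_imp_bounded compact_continuous_image continuous_on_subset[OF c]) auto
  then obtain B where B: "\<forall>x\<in>{p..q}. \<bar>w x\<bar> \<le> B" by (auto simp: bounded_iff)
  have "\<bar>w x\<bar> \<le> max B 0" for x using B pq(4) by (cases "x \<in> {p..q}") fastforce+
  then show ?thesis by blast
qed

lemma supp_fun_mult_integrable:
  fixes f :: "real \<Rightarrow> 'a::{banach, second_countable_topology}"
  assumes "integrable (int_meas a b) f" "supp_fun a b w"
  shows "integrable (int_meas a b) (\<lambda>x. w x *\<^sub>R f x)"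
  using supp_fun_bounded[OF assms(2)] assms bounded_continuous_mult_integrable
  by (metis supp_fun_def)

text \<open>The fundamental lemma of the calculus of variations.\<close>

lemma fundamental_lemma_real:
  fixes f :: "real \<Rightarrow> real"
  assumes f: "integrable (int_meas a b) f"
    and 0: "\<And>w. supp_fun a b w \<Longrightarrow> (LINT x|int_meas a b. w x * f x) = 0"
    and ab: "a < b"
  shows "AE x in int_meas a b. f x = 0"
proof -
  let ?M = "int_meas a b"
  have fm[measurable]: "f \<in> borel_measurable ?M" using f by auto
  have "(\<lambda>x. sgn (f x)) \<in> borel_measurable ?M" by measurable
  then have "(\<lambda>x. sgn (f x)) measurable_on {a<..<b}"
    by (subst measurable_on_iff_borel_measurable) auto
  then obtain N g where N: "negligible N" and g: "\<And>n. continuous_on UNIV (g n)"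
    and lim: "\<And>x. x \<notin> N \<Longrightarrow>
        (\<lambda>n. g n x) \<longlonglongrightarrow> (if x \<in> {a<..<b} then sgn (f x) else 0)"
    unfolding measurable_on_def by auto
  define e where "e n = (b - a) / (real n + 3)" for n
  define c where "c n x = max 0 (min 1 (real (Suc n) * min (x - (a + e n)) (b - e n - x)))"
    for n and x :: real
  define w where "w n x = c n x * (max (-1) (min 1 (g n x)))" for n x
  have e0: "0 < e n" "2 * e n < b - a" for n
  proof -
    have "(b - a) * 2 < (b - a) * (real n + 3)" using ab by (intro mult_strict_left_mono) auto
    then show "0 < e n" "2 * e n < b - a" using ab by (auto simp: e_def field_simps)
  qed
  have e_lim: "e \<longlonglongrightarrow> 0"
    unfolding e_def
    by (intro tendsto_divide_0[OF tendsto_const] filterlim_at_top_imp_at_infinity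
        filterlim_at_top_mono[OF filterlim_real_sequentially]) simp
  have c01: "0 \<le> c n x" "c n x \<le> 1" for n x by (auto simp: c_def)
  have wb: "\<bar>w n x\<bar> \<le> 1" for n x
  proof -
    have "\<bar>max (-1) (min 1 (g n x))\<bar> \<le> (1::real)" by auto
    then show ?thesis unfolding w_def abs_mult using c01[of n x] by (simp add: mult_le_one)
  qed
  have supp: "supp_fun a b (w n)" for n
  proof (rule supp_funI[of _ a "a + e n" "b - e n" b])
    show "continuous_on UNIV (w n)" unfolding w_def c_def by (intro continuous_intros g)
    fix x assume "x \<notin> {a + e n..b - e n}"
    then have "min (x - (a + e n)) (b - e n - x) \<le> 0" by auto
    then have "real (Suc n) * min (x - (a + e n)) (b - e n - x) \<le> 0"
      by (simp add: mult_nonneg_nonpos)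
    then have "c n x = 0" unfolding c_def by auto
    then show "w n x = 0" by (simp add: w_def)
  qed (use e0[of n] in auto)
  have c_lim: "(\<lambda>n. c n x) \<longlonglongrightarrow> 1" if x: "x \<in> {a<..<b}" for x
  proof -
    define d where "d = min (x - a) (b - x)"
    have d: "d > 0" using x by (auto simp: d_def)
    have "eventually (\<lambda>n. e n < d / 2) sequentially"
      using e_lim d by (intro order_tendstoD) auto
    moreover have "eventually (\<lambda>n. real (Suc n) * (d / 2) > 1) sequentially"
    proof -
      obtain m where m: "2 / d < real m" using reals_Archimedean2 by blast
      have "real (Suc n) * (d / 2) > 1" if "n \<ge> m" for n
      proof -
        have "2 / d < real (Suc n)" using m that by linarith
        then show ?thesis using d by (simp add: field_simps)
      qed
      then show ?thesis by (auto simp: eventually_sequentially)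
    qed
    ultimately have "eventually (\<lambda>n. c n x = 1) sequentially"
    proof eventually_elim
      case (elim n)
      have "min (x - (a + e n)) (b - e n - x) \<ge> d / 2" using elim(1) by (auto simp: d_def min_def split: if_splits)
      then have "real (Suc n) * min (x - (a + e n)) (b - e n - x) \<ge> real (Suc n) * (d / 2)"
        by (intro mult_left_mono) auto
      then show ?case using elim(2) unfolding c_def by linarith
    qed
    then show ?thesis by (rule tendsto_eventually)
  qed
  have AEN: "AE x in ?M. x \<notin> N"
    using N by (auto simp: AE_restrict_space_iff negligible_iff_null_sets intro!: AE_not_in[THEN eventually_mono])
  have "(\<lambda>n. LINT x|?M. w n x * f x) \<longlonglongrightarrow> (LINT x|?M. \<bar>f x\<bar>)"
  proof (rule integral_dominated_convergence[where w = "\<lambda>x. \<bar>f x\<bar>"])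
    show "(\<lambda>x. w n x * f x) \<in> borel_measurable ?M" for n
      using supp_fun_mult_integrable[OF f supp] by auto
    show "AE x in ?M. norm (w n x * f x) \<le> \<bar>f x\<bar>" for n
      using wb by (auto simp: abs_mult intro!: AE_I2 mult_left_le_one_le)
    show "AE x in ?M. (\<lambda>n. w n x * f x) \<longlonglongrightarrow> \<bar>f x\<bar>"
      using AEN
    proof (rule AE_mp, intro AE_I2 impI)
      fix x assume x: "x \<in> space ?M" "x \<notin> N"
      then have xab: "x \<in> {a<..<b}" by simp
      have "(\<lambda>n. g n x) \<longlonglongrightarrow> sgn (f x)" using lim[OF x(2)] xab by auto
      then have "(\<lambda>n. w n x * f x) \<longlonglongrightarrow> 1 * (max (-1) (min 1 (sgn (f x)))) * f x"
        unfolding w_def by (intro tendsto_intros c_lim xab)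
      moreover have "1 * (max (-1) (min 1 (sgn (f x)))) * f x = \<bar>f x\<bar>"
        by (auto simp: sgn_if)
      ultimately show "(\<lambda>n. w n x * f x) \<longlonglongrightarrow> \<bar>f x\<bar>" by metis
    qed
  qed (use f in auto)
  then have "(LINT x|?M. \<bar>f x\<bar>) = 0" using 0[OF supp] by (simp add: LIMSEQ_const_iff)
  then have "AE x in ?M. \<bar>f x\<bar> = 0"
    using f by (subst (asm) integral_nonneg_eq_0_iff_AE) auto
  then show ?thesis by auto
qed

lemma fundamental_lemma:
  fixes f :: "real \<Rightarrow> complex"
  assumes f: "integrable (int_meas a b) f"
    and 0: "\<And>w. supp_fun a b w \<Longrightarrow> (LINT x|int_meas a b. w x *\<^sub>R f x) = 0"
    and ab: "a < b"
  shows "AE x in int_meas a b. f x = 0"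
proof -
  have "AE x in int_meas a b. Re (f x) = 0"
  proof (rule fundamental_lemma_real)
    fix w assume w: "supp_fun a b w"
    have "(LINT x|int_meas a b. w x * Re (f x)) = Re (LINT x|int_meas a b. w x *\<^sub>R f x)"
      using integral_Re[OF supp_fun_mult_integrable[OF f w]] by simp
    then show "(LINT x|int_meas a b. w x * Re (f x)) = 0" using 0[OF w] by simp
  qed (use f ab in auto)
  moreover have "AE x in int_meas a b. Im (f x) = 0"
  proof (rule fundamental_lemma_real)
    fix w assume w: "supp_fun a b w"
    have "(LINT x|int_meas a b. w x * Im (f x)) = Im (LINT x|int_meas a b. w x *\<^sub>R f x)"
      using integral_Im[OF supp_fun_mult_integrable[OF f w]] by simp
    then show "(LINT x|int_meas a b. w x * Im (f x)) = 0" using 0[OF w] by simp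
  qed (use f ab in auto)
  ultimately show ?thesis by eventually_elim (simp add: complex_eq_iff)
qed

lemma test_fun_supp:
  assumes "test_fun a b \<phi>" "a < b"
  shows "supp_fun a b \<phi>" "supp_fun a b (\<lambda>x. vector_derivative \<phi> (at x))"
proof -
  obtain K where K: "compact K" "K \<subseteq> {a<..<b}" "\<And>x. x \<notin> K \<Longrightarrow> \<phi> x = 0"
    and C1: "\<phi> C1_differentiable_on UNIV"
    using assms by (auto simp: test_fun_def)
  have d: "\<And>x. \<phi> differentiable at x" and c: "continuous_on UNIV (\<lambda>x. vector_derivative \<phi> (at x))"
    using C1 by (auto simp: C1_differentiable_on_eq)
  obtain p q where pq: "a < p" "p < q" "q < b" "K \<subseteq> {p..q}"
  proof (cases "K = {}")
    case True
    then show ?thesis using assms(2) by (intro that[of "(2*a + b)/3" "(a + 2*b)/3"]) (auto simp: field_simps)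
  next
    case False
    obtain l where l: "l \<in> K" "\<And>x. x \<in> K \<Longrightarrow> l \<le> x"
      using compact_attains_inf[OF K(1) False] by blast
    obtain u where u: "u \<in> K" "\<And>x. x \<in> K \<Longrightarrow> x \<le> u"
      using compact_attains_sup[OF K(1) False] by blast
    have "a < l" "l \<le> u" "u < b" using l u K(2) by auto
    moreover have "(a + l)/2 < l" "a < (a + l)/2" using \<open>a < l\<close> by auto
    moreover have "K \<subseteq> {(a + l)/2..u}"
    proof
      fix x assume "x \<in> K"
      then have "l \<le> x" "x \<le> u" using l u by auto
      then show "x \<in> {(a + l)/2..u}" using \<open>a < l\<close> by simp
    qed
    ultimately show ?thesis by (intro that[of "(a + l)/2" u]) linarith+
  qed
  have z: "\<phi> x = 0" if "x \<notin> {p..q}" for x using K(3) pq(4) that by blast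
  have cp: "continuous_on UNIV \<phi>"
    using d by (simp add: continuous_at_imp_continuous_on differentiable_imp_continuous_within)
  show "supp_fun a b \<phi>" unfolding supp_fun_def using pq z cp by blast
  have "vector_derivative \<phi> (at x) = 0" if "x \<notin> {p..q}" for x
  proof (rule vector_derivative_at)
    have "((\<lambda>x. 0) has_vector_derivative 0) (at x)" by simp
    moreover have "open (- {p..q})" by auto
    ultimately show "(\<phi> has_vector_derivative 0) (at x)"
      by (rule has_vector_derivative_transform_within_open[where S = "- {p..q}"])
         (use that z in auto)
  qed
  then show "supp_fun a b (\<lambda>x. vector_derivative \<phi> (at x))" unfolding supp_fun_def using pq c by blast
qed

lemma supp_fun_integrable: "supp_fun a b w \<Longrightarrow> integrable (int_meas a b) w"
  using supp_fun_mult_integrable[of a b "\<lambda>x. 1::real" w]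
    finite_measure.integrable_const[OF finite_measure_int_meas, of a b "1::real"] by simp

lemma supp_fun_antideriv:
  assumes w: "supp_fun a b w" and 0: "(LINT x|int_meas a b. w x) = 0"
  shows "\<exists>\<phi>. test_fun a b \<phi> \<and> (\<forall>x. vector_derivative \<phi> (at x) = w x)"
proof -
  obtain p q where pq: "a < p" "p < q" "q < b" "\<And>x. x \<notin> {p..q} \<Longrightarrow> w x = 0"
    and c: "continuous_on UNIV w"
    using w by (auto simp: supp_fun_def)
  have "\<exists>F. \<forall>x::real. -\<infinity> < ereal x \<longrightarrow> ereal x < \<infinity> \<longrightarrow> (F has_vector_derivative w x) (at x)"
    using c by (intro einterval_antiderivative) (auto simp: continuous_on_eq_continuous_at)
  then obtain F where F: "\<And>x. (F has_vector_derivative w x) (at x)" by auto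
  have int: "(w has_integral (F y - F x)) {x..y}" if "x \<le> y" for x y
    using that F by (intro fundamental_theorem_of_calculus) (auto intro: has_vector_derivative_at_within)
  have const: "F x = F y" if xy: "x \<le> y" "{x<..<y} \<inter> {p..q} = {}" for x y
  proof -
    have "((\<lambda>x. 0) has_integral (F y - F x)) {x..y}"
    proof (rule has_integral_spike_finite[of "{x,y}" _ _ w])
      fix z assume "z \<in> {x..y} - {x,y}"
      then have "z \<in> {x<..<y}" by auto
      then have "z \<notin> {p..q}" using xy(2) by blast
      then show "0 = w z" using pq(4) by simp
    qed (use int[OF xy(1)] in auto)
    then have "F y - F x = 0" by (rule has_integral_unique) simp
    then show ?thesis by simp
  qed
  have "(w has_integral (F b - F a)) {a<..<b}"
    using int[of a b] pq by (subst has_integral_Icc_iff_Ioo[symmetric]) auto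
  moreover have "(w has_integral 0) {a<..<b}"
    using 0 has_integral_integral_lebesgue_on[OF supp_fun_integrable[OF w]] by simp
  ultimately have "F b - F a = 0" by (rule has_integral_unique)
  then have Fab: "F b = F a" by simp
  define \<phi> where "\<phi> x = F x - F a" for x
  have d: "(\<phi> has_vector_derivative w x) (at x)" for x
    unfolding \<phi>_def using has_vector_derivative_diff[OF F has_vector_derivative_const] by simp
  have "\<phi> x = 0" if "x \<notin> {p..q}" for x
  proof (cases "x < p")
    case True
    have "F (min x a) = F (max x a)" by (rule const) (use True pq in auto)
    then show ?thesis unfolding \<phi>_def by (auto simp: min_def max_def split: if_splits)
  next
    case False
    then have "q < x" using that by auto
    have "F (min x b) = F (max x b)" by (rule const) (use \<open>q < x\<close> pq in auto)
    then have "F x = F b" by (auto simp: min_def max_def split: if_splits)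
    then show ?thesis using Fab by (simp add: \<phi>_def)
  qed
  then have "test_fun a b \<phi>"
    unfolding test_fun_def C1_differentiable_on_def using d c pq
    by (intro conjI exI[of _ w] exI[of _ "{p..q}"]) auto
  then show ?thesis using d vector_derivative_at by blast
qed

lemma supp_fun_lin:
  assumes "supp_fun a b v" "supp_fun a b w" shows "supp_fun a b (\<lambda>x. v x - k * w x)"
proof -
  obtain p q where 1: "a < p" "p < q" "q < b" "\<And>x. x \<notin> {p..q} \<Longrightarrow> v x = 0"
    using assms(1) by (auto simp: supp_fun_def)
  obtain r s where 2: "a < r" "r < s" "s < b" "\<And>x. x \<notin> {r..s} \<Longrightarrow> w x = 0"
    using assms(2) by (auto simp: supp_fun_def)
  have "v x - k * w x = 0" if "x \<notin> {min p r..max q s}" for x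
  proof -
    have "x \<notin> {p..q}" "x \<notin> {r..s}" using that by auto
    then show ?thesis using 1(4)[of x] 2(4)[of x] by simp
  qed
  moreover have "continuous_on UNIV (\<lambda>x. v x - k * w x)"
    using assms by (auto simp: supp_fun_def intro!: continuous_intros)
  ultimately show ?thesis unfolding supp_fun_def using 1(1,2,3) 2(1,2,3)
    by (intro conjI exI[of _ "min p r"] exI[of _ "max q s"]) auto
qed

lemma ex_supp_fun:
  assumes "a < b"
  shows "\<exists>h. supp_fun a b h \<and> (LINT x|int_meas a b. h x) = 1"
proof -
  define p q where "p = (2*a + b)/3" and "q = (a + 2*b)/3"
  have pq: "a < p" "p < q" "q < b" using assms by (auto simp: p_def q_def field_simps)
  define h where "h x = max 0 ((x - p) * (q - x))" for x :: real
  have s: "supp_fun a b h"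
  proof (rule supp_funI[of _ a p q b])
    show "continuous_on UNIV h" unfolding h_def by (intro continuous_intros)
    fix x assume "x \<notin> {p..q}"
    then have "(x - p) * (q - x) \<le> 0" using pq by (auto simp: mult_le_0_iff)
    then show "h x = 0" by (simp add: h_def)
  qed (use pq in auto)
  have "(LINT x|int_meas a b. h x) \<noteq> 0"
  proof
    assume "(LINT x|int_meas a b. h x) = 0"
    then have "AE x in int_meas a b. h x = 0"
      using supp_fun_integrable[OF s] by (subst (asm) integral_nonneg_eq_0_iff_AE) (auto simp: h_def)
    then have "AE x in lebesgue. x \<in> {a<..<b} \<longrightarrow> h x = 0"
      by (simp add: AE_restrict_space_iff)
    then have "AE x in lebesgue. x \<notin> {p<..<q}"
      by eventually_elim (use pq in \<open>auto simp: h_def max_def mult_le_0_iff split: if_splits\<close>)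
    then have "{p<..<q} \<in> null_sets lebesgue" by (subst AE_iff_null_sets) auto
    then have "negligible {p<..<q}" by (simp add: negligible_iff_null_sets)
    then show False using pq open_not_negligible[of "{p<..<q}"] by auto
  qed
  then have "supp_fun a b (\<lambda>x. 0 - (- 1 / (LINT x|int_meas a b. h x)) * h x)"
    by (intro supp_fun_lin s) (use pq in \<open>auto simp: supp_fun_def\<close>)
  then show ?thesis
    using \<open>(LINT x|int_meas a b. h x) \<noteq> 0\<close>
    by (intro exI[of _ "\<lambda>x. 0 - (- 1 / (LINT x|int_meas a b. h x)) * h x"]) auto
qed

lemma weak_deriv_zero_const:
  assumes f: "has_weak_deriv a b f g" and g: "ae_eq a b g (\<lambda>x. 0)" and ab: "a < b"
  shows "\<exists>c. ae_eq a b f (\<lambda>x. c)"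
proof -
  let ?M = "int_meas a b"
  obtain h where h: "supp_fun a b h" "(LINT x|?M. h x) = 1" using ex_supp_fun[OF ab] by blast
  define c where "c = (LINT x|?M. h x *\<^sub>R f x)"
  have fi: "integrable ?M f" and gi: "integrable ?M g"
    using f by (auto simp: has_weak_deriv_def L2_integrable)
  have ci: "integrable ?M (\<lambda>x. c)" for c :: complex
    by (rule L2_integrable[OF L2_one])
  have "AE x in ?M. f x - c = 0"
  proof (rule fundamental_lemma)
    show "integrable ?M (\<lambda>x. f x - c)" using fi ci by auto
    fix w assume w: "supp_fun a b w"
    define k where "k = (LINT x|?M. w x)"
    have "(LINT x|?M. w x - k * h x) = 0"
      using supp_fun_integrable[OF w] supp_fun_integrable[OF h(1)] h(2) by (simp add: k_def)
    then obtain \<phi> where \<phi>: "test_fun a b \<phi>" "\<And>x. vector_derivative \<phi> (at x) = w x - k * h x"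
      using supp_fun_antideriv[OF supp_fun_lin[OF w h(1), of k]] by blast
    have "(LINT x|?M. \<phi> x *\<^sub>R g x) = (LINT x|?M. 0)"
    proof (rule integral_cong_AE)
      show "AE x in ?M. \<phi> x *\<^sub>R g x = 0"
        using g unfolding ae_eq_def by (auto elim: eventually_mono)
      show "(\<lambda>x. \<phi> x *\<^sub>R g x) \<in> borel_measurable ?M"
        using supp_fun_mult_integrable[OF gi test_fun_supp(1)[OF \<phi>(1) ab]] by auto
    qed simp
    then have "0 = (LINT x|?M. (w x - k * h x) *\<^sub>R f x)"
      using f \<phi> unfolding has_weak_deriv_def by auto
    also have "\<dots> = (LINT x|?M. w x *\<^sub>R f x - k *\<^sub>R (h x *\<^sub>R f x))"
      by (simp add: scaleR_diff_left)
    also have "\<dots> = (LINT x|?M. w x *\<^sub>R f x) - k *\<^sub>R c"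
      using supp_fun_mult_integrable[OF fi w] supp_fun_mult_integrable[OF fi h(1)]
      by (simp add: c_def flip: scaleR_scaleR)
    also have "k *\<^sub>R c = (LINT x|?M. w x *\<^sub>R c)"
      using supp_fun_integrable[OF w] by (simp add: k_def)
    also have "(LINT x|?M. w x *\<^sub>R f x) - \<dots> = (LINT x|?M. w x *\<^sub>R (f x - c))"
      using supp_fun_mult_integrable[OF fi w] supp_fun_mult_integrable[OF ci w]
      by (simp add: scaleR_diff_right)
    finally show "(LINT x|?M. w x *\<^sub>R (f x - c)) = 0" by simp
  qed (rule ab)
  then have "ae_eq a b f (\<lambda>x. c)" by (simp add: ae_eq_def)
  then show ?thesis ..
qed

lemma weak_deriv_zero:
  assumes f: "has_weak_deriv a b f g" and g: "ae_eq a b g (\<lambda>x. 0)" and ab: "a < b"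
    and v: "has_value a b f p 0" and p: "p \<in> {a..b}"
  shows "ae_eq a b f (\<lambda>x. 0)"
proof -
  obtain c where c: "ae_eq a b f (\<lambda>x. c)" using weak_deriv_zero_const[OF f g ab] by blast
  obtain h where h: "continuous_on {a..b} h" "ae_eq a b f h" "h p = 0"
    using v by (auto simp: has_value_def)
  have "ae_eq a b h (\<lambda>x. c)" using ae_eq_trans[OF ae_eq_sym[OF h(2)] c] .
  then have ae: "AE x in lebesgue. x \<in> {a<..<b} \<longrightarrow> h x = c"
    by (simp add: ae_eq_def AE_restrict_space_iff)
  have eq: "h x = c" if x: "x \<in> {a<..<b}" for x
  proof (rule ccontr)
    assume "h x \<noteq> c"
    have "continuous_on {a<..<b} h" using h(1) by (rule continuous_on_subset) auto
    then have "open {x \<in> {a<..<b}. h x \<in> - {c}}"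
      using continuous_openin_preimage_gen[of "{a<..<b}" h "- {c}"]
      by (simp add: openin_open_eq vimage_def Int_def open_Compl)
    moreover have "x \<in> {x \<in> {a<..<b}. h x \<in> - {c}}" using x \<open>h x \<noteq> c\<close> by auto
    moreover have "negligible {x \<in> {a<..<b}. h x \<in> - {c}}"
    proof -
      have "AE x in lebesgue. x \<notin> {x \<in> {a<..<b}. h x \<in> - {c}}"
        using ae by eventually_elim auto
      then show ?thesis
        using \<open>open {x \<in> {a<..<b}. h x \<in> - {c}}\<close>
        by (auto simp: negligible_iff_null_sets AE_iff_null_sets)
    qed
    ultimately show False using open_not_negligible by blast
  qed
  have "h p = c"
  proof (rule continuous_constant_on_closure[where S = "{a<..<b}" and f = h])
    show "continuous_on (closure {a<..<b}) h" using h(1) ab by simp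
  qed (use eq p ab in auto)
  then show ?thesis using c h(3) by simp
qed

lemma has_weak_deriv_add:
  assumes "has_weak_deriv a b f g" "has_weak_deriv a b f' g'" "a < b"
  shows "has_weak_deriv a b (\<lambda>x. f x + f' x) (\<lambda>x. g x + g' x)"
  unfolding has_weak_deriv_def
proof (intro conjI allI impI)
  show "(\<lambda>x. f x + f' x) \<in> L2 a b" "(\<lambda>x. g x + g' x) \<in> L2 a b"
    using assms by (auto simp: has_weak_deriv_def intro: L2_add)
  fix \<phi> assume \<phi>: "test_fun a b \<phi>"
  have i: "integrable (int_meas a b) f" "integrable (int_meas a b) f'"
    "integrable (int_meas a b) g" "integrable (int_meas a b) g'"
    using assms by (auto simp: has_weak_deriv_def intro: L2_integrable)
  note s = test_fun_supp[OF \<phi> assms(3)]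
  show "(LINT x|int_meas a b. vector_derivative \<phi> (at x) *\<^sub>R (f x + f' x)) =
        - (LINT x|int_meas a b. \<phi> x *\<^sub>R (g x + g' x))"
    using assms(1,2) \<phi> i[THEN supp_fun_mult_integrable, OF s(1)]
      i[THEN supp_fun_mult_integrable, OF s(2)]
    unfolding has_weak_deriv_def by (simp add: scaleR_add_right)
qed

lemma has_weak_deriv_scale:
  assumes "has_weak_deriv a b f g"
  shows "has_weak_deriv a b (\<lambda>x. c * f x) (\<lambda>x. c * g x)"
  using assms unfolding has_weak_deriv_def
  by (auto intro: L2_scale simp flip: mult_scaleR_right)

lemma has_weak_deriv_zero: "has_weak_deriv a b (\<lambda>x. 0) (\<lambda>x. 0)"
  by (simp add: has_weak_deriv_def)

lemma has_weak_deriv_cong: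
  assumes "has_weak_deriv a b f g" "ae_eq a b f f'" "ae_eq a b g g'" "f' \<in> L2 a b" "g' \<in> L2 a b"
    "a < b"
  shows "has_weak_deriv a b f' g'"
  unfolding has_weak_deriv_def
proof (intro conjI allI impI assms)
  fix \<phi> assume \<phi>: "test_fun a b \<phi>"
  note s = test_fun_supp[OF \<phi> assms(6)]
  have i: "integrable (int_meas a b) f" "integrable (int_meas a b) f'"
    "integrable (int_meas a b) g" "integrable (int_meas a b) g'"
    using assms by (auto simp: has_weak_deriv_def intro: L2_integrable)
  have "(LINT x|int_meas a b. vector_derivative \<phi> (at x) *\<^sub>R f' x) =
        (LINT x|int_meas a b. vector_derivative \<phi> (at x) *\<^sub>R f x)"
    using i[THEN supp_fun_mult_integrable, OF s(2)] assms(2) unfolding ae_eq_def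
    by (intro integral_cong_AE) (auto elim: eventually_mono)
  also have "\<dots> = - (LINT x|int_meas a b. \<phi> x *\<^sub>R g x)"
    using assms(1) \<phi> by (simp add: has_weak_deriv_def)
  also have "(LINT x|int_meas a b. \<phi> x *\<^sub>R g x) = (LINT x|int_meas a b. \<phi> x *\<^sub>R g' x)"
    using i[THEN supp_fun_mult_integrable, OF s(1)] assms(3) unfolding ae_eq_def
    by (intro integral_cong_AE) (auto elim: eventually_mono)
  finally show "(LINT x|int_meas a b. vector_derivative \<phi> (at x) *\<^sub>R f' x) =
        - (LINT x|int_meas a b. \<phi> x *\<^sub>R g' x)" .
qed

lemma H1_L2: "f \<in> H1 a b \<Longrightarrow> f \<in> L2 a b"
  by (auto simp: H1_def has_weak_deriv_def)

lemma H1_iff: "f \<in> H1 a b \<longleftrightarrow> (\<exists>g. has_weak_deriv a b f g)"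
  by (simp add: H1_def)

lemma weak_deriv_works: "f \<in> H1 a b \<Longrightarrow> has_weak_deriv a b f (weak_deriv a b f)"
  unfolding H1_iff weak_deriv_def by (erule someI_ex)

lemma weak_deriv_L2: "f \<in> H1 a b \<Longrightarrow> weak_deriv a b f \<in> L2 a b"
  using weak_deriv_works by (auto simp: has_weak_deriv_def)

lemma supp_fun_approx:
  assumes w: "supp_fun a b w"
  shows "\<exists>\<phi> B. (\<forall>n. test_fun a b (\<phi> n)) \<and> (\<forall>n x. \<bar>\<phi> n x\<bar> \<le> B) \<and>
           (\<forall>x. (\<lambda>n::nat. \<phi> n x) \<longlonglongrightarrow> w x)"
proof -
  obtain p q where pq: "a < p" "p < q" "q < b" "\<And>x. x \<notin> {p..q} \<Longrightarrow> w x = 0"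
    and c: "continuous_on UNIV w"
    using w by (auto simp: supp_fun_def)
  obtain B where B: "\<And>x. \<bar>w x\<bar> \<le> B" using supp_fun_bounded[OF w] by blast
  have "\<exists>F. \<forall>x::real. -\<infinity> < ereal x \<longrightarrow> ereal x < \<infinity> \<longrightarrow> (F has_vector_derivative w x) (at x)"
    using c by (intro einterval_antiderivative) (auto simp: continuous_on_eq_continuous_at)
  then obtain F where F: "\<And>x. (F has_vector_derivative w x) (at x)" by auto
  then have DF: "\<And>x. (F has_real_derivative w x) (at x)"
    by (simp add: has_real_derivative_iff_has_vector_derivative)
  define h where "h n = (p - a) / (2 * real (Suc n))" for n
  have h0: "h n > 0" for n using pq by (simp add: h_def)
  have hle: "h n \<le> (p - a) / 2" for n using pq unfolding h_def by (intro divide_left_mono) auto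
  have hlim: "h \<longlonglongrightarrow> 0"
  proof -
    have "(\<lambda>n. (p - a) / 2 * inverse (real (Suc n))) \<longlonglongrightarrow> (p - a) / 2 * 0"
      by (intro tendsto_intros LIMSEQ_inverse_real_of_nat)
    then show ?thesis by (simp add: h_def[abs_def] field_simps)
  qed
  define \<phi> where "\<phi> n x = (F (x + h n) - F x) / h n" for n x
  have mvt: "\<exists>z. x < z \<and> z < x + h n \<and> \<phi> n x = w z" for n x
  proof -
    obtain z where "z > x" "z < x + h n" "F (x + h n) - F x = (x + h n - x) * w z"
      using MVT2[of x "x + h n" F w] h0[of n] DF by auto
    then show ?thesis using h0[of n] by (intro exI[of _ z]) (auto simp: \<phi>_def)
  qed
  have "test_fun a b (\<phi> n)" for n
    unfolding test_fun_def C1_differentiable_on_def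
  proof (intro conjI exI[of _ "\<lambda>x. (w (x + h n) - w x) / h n"] ballI exI[of _ "{(a + p) / 2..q}"] allI impI)
    fix x
    have "((\<lambda>x. F (x + h n)) has_real_derivative w (x + h n)) (at x)"
      using DERIV_shift[of F "w (x + h n)" x "h n"] DF by simp
    then show "(\<phi> n has_vector_derivative (w (x + h n) - w x) / h n) (at x)"
      unfolding \<phi>_def has_real_derivative_iff_has_vector_derivative[symmetric]
      by (intro DERIV_cdivide DERIV_diff DF)
  next
    show "continuous_on UNIV (\<lambda>x. (w (x + h n) - w x) / h n)"
      using h0[of n]
      by (intro continuous_intros c continuous_on_compose2[OF c, of UNIV "\<lambda>x. x + h n"]) auto
  next
    fix x assume x: "x \<notin> {(a + p) / 2..q}"
    obtain z where z: "x < z" "z < x + h n" "\<phi> n x = w z" using mvt by blast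
    have "z \<notin> {p..q}" using x z hle[of n] by (auto simp: field_simps)
    then show "\<phi> n x = 0" using z(3) pq(4) by simp
  qed (use pq in \<open>auto simp: field_simps\<close>)
  moreover have "\<bar>\<phi> n x\<bar> \<le> B" for n x using mvt[of x n] B by metis
  moreover have "(\<lambda>n. \<phi> n x) \<longlonglongrightarrow> w x" for x
  proof -
    have "((\<lambda>h. (F (x + h) - F x) / h) \<longlongrightarrow> w x) (at 0)" using DF[of x] by (simp add: DERIV_def)
    moreover have "filterlim h (at 0) sequentially"
      using hlim h0 by (auto simp: filterlim_at intro!: always_eventually) (metis less_irrefl)
    ultimately show ?thesis unfolding \<phi>_def by (rule filterlim_compose)
  qed
  ultimately show ?thesis by blast
qed

lemma has_weak_deriv_unique:
  assumes "has_weak_deriv a b f g" "has_weak_deriv a b f g'" "a < b"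
  shows "ae_eq a b g g'"
proof -
  have gi: "integrable (int_meas a b) g" "integrable (int_meas a b) g'"
    using assms by (auto simp: has_weak_deriv_def intro: L2_integrable)
  let ?M = "int_meas a b"
  have L: "f \<in> L2 a b" "g \<in> L2 a b" "g' \<in> L2 a b" using assms by (auto simp: has_weak_deriv_def)
  let ?d = "\<lambda>x. g x + - 1 * g' x"
  have d: "has_weak_deriv a b (\<lambda>x. f x + - 1 * f x) ?d"
    by (intro has_weak_deriv_add has_weak_deriv_scale assms)
  then have dz: "(LINT x|?M. \<phi> x *\<^sub>R ?d x) = 0" if "test_fun a b \<phi>" for \<phi>
    using that by (auto simp: has_weak_deriv_def)
  have "AE x in ?M. ?d x = 0"
  proof (rule fundamental_lemma)
    show di: "integrable ?M ?d" using gi by auto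
    fix w assume w: "supp_fun a b w"
    obtain \<phi> B where \<phi>: "\<And>n. test_fun a b (\<phi> n)" "\<And>n x. \<bar>\<phi> n x\<bar> \<le> B" "\<And>x. (\<lambda>n. \<phi> n x) \<longlonglongrightarrow> w x"
      using supp_fun_approx[OF w] by blast
    have "(\<lambda>n. LINT x|?M. \<phi> n x *\<^sub>R ?d x) \<longlonglongrightarrow> (LINT x|?M. w x *\<^sub>R ?d x)"
    proof (rule integral_dominated_convergence[where w = "\<lambda>x. B * norm (?d x)"])
      show "(\<lambda>x. w x *\<^sub>R ?d x) \<in> borel_measurable ?M"
        using supp_fun_mult_integrable[OF di w] by (rule borel_measurable_integrable)
      show "(\<lambda>x. \<phi> n x *\<^sub>R ?d x) \<in> borel_measurable ?M" for n
        using supp_fun_mult_integrable[OF di test_fun_supp(1)[OF \<phi>(1) assms(3)]]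
        by (rule borel_measurable_integrable)
      show "integrable ?M (\<lambda>x. B * norm (?d x))"
        using integrable_norm[OF di] by (rule integrable_mult_right)
      show "AE x in ?M. (\<lambda>n. \<phi> n x *\<^sub>R ?d x) \<longlonglongrightarrow> w x *\<^sub>R ?d x"
        by (intro AE_I2 tendsto_intros \<phi>(3))
      show "AE x in ?M. norm (\<phi> n x *\<^sub>R ?d x) \<le> B * norm (?d x)" for n
        unfolding norm_scaleR by (intro AE_I2 mult_right_mono \<phi>(2)) auto
    qed
    then show "(LINT x|?M. w x *\<^sub>R ?d x) = 0"
      unfolding dz[OF \<phi>(1)] using LIMSEQ_unique tendsto_const by blast
  qed (rule assms(3))
  then show ?thesis by (simp add: ae_eq_def)
qed

lemma weak_deriv_cong:
  assumes "f \<in> L2 a b" "f' \<in> L2 a b" "ae_eq a b f f'" "a < b"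
  shows "weak_deriv a b f = weak_deriv a b f'"
proof -
  have "has_weak_deriv a b f g \<longleftrightarrow> has_weak_deriv a b f' g" for g
    using has_weak_deriv_cong[of a b f g f' g] has_weak_deriv_cong[of a b f' g f g] assms
    by (auto simp: has_weak_deriv_def intro: ae_eq_sym)
  then show ?thesis by (simp add: weak_deriv_def)
qed

lemma H1_cong:
  assumes "f \<in> H1 a b" "f' \<in> L2 a b" "ae_eq a b f f'" "a < b"
  shows "f' \<in> H1 a b"
  using assms has_weak_deriv_cong[of a b f _ f'] unfolding H1_iff
  by (meson ae_eq_refl has_weak_deriv_def)

lemma H1_add: "f \<in> H1 a b \<Longrightarrow> g \<in> H1 a b \<Longrightarrow> a < b \<Longrightarrow> (\<lambda>x. f x + g x) \<in> H1 a b"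
  unfolding H1_iff using has_weak_deriv_add by blast

lemma H1_scale: "f \<in> H1 a b \<Longrightarrow> (\<lambda>x. c * f x) \<in> H1 a b"
  unfolding H1_iff using has_weak_deriv_scale by blast

lemma H1_zero [simp]: "(\<lambda>x. 0) \<in> H1 a b"
  unfolding H1_iff using has_weak_deriv_zero by blast

lemma weak_deriv_add:
  assumes "f \<in> H1 a b" "g \<in> H1 a b" "a < b"
  shows "ae_eq a b (weak_deriv a b (\<lambda>x. f x + g x)) (\<lambda>x. weak_deriv a b f x + weak_deriv a b g x)"
  using assms
  by (intro has_weak_deriv_unique[OF weak_deriv_works[OF H1_add] has_weak_deriv_add] weak_deriv_works)

lemma weak_deriv_scale:
  assumes "f \<in> H1 a b" "a < b"
  shows "ae_eq a b (weak_deriv a b (\<lambda>x. c * f x)) (\<lambda>x. c * weak_deriv a b f x)"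
  using assms
  by (intro has_weak_deriv_unique[OF weak_deriv_works[OF H1_scale] has_weak_deriv_scale] weak_deriv_works)

lemma has_value_add:
  assumes "has_value a b f p c" "has_value a b g p d"
  shows "has_value a b (\<lambda>x. f x + g x) p (c + d)"
proof -
  obtain f' where f': "continuous_on {a..b} f'" "ae_eq a b f f'" "f' p = c"
    using assms(1) by (auto simp: has_value_def)
  obtain g' where g': "continuous_on {a..b} g'" "ae_eq a b g g'" "g' p = d"
    using assms(2) by (auto simp: has_value_def)
  show ?thesis
    unfolding has_value_def using f' g'
    by (intro exI[of _ "\<lambda>x. f' x + g' x"] conjI continuous_on_add ae_eq_add) auto
qed

lemma has_value_scale:
  assumes "has_value a b f p d"
  shows "has_value a b (\<lambda>x. c * f x) p (c * d)"
proof -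
  obtain f' where f': "continuous_on {a..b} f'" "ae_eq a b f f'" "f' p = d"
    using assms by (auto simp: has_value_def)
  show ?thesis
    unfolding has_value_def using f'
    by (intro exI[of _ "\<lambda>x. c * f' x"] conjI continuous_on_mult_left ae_eq_scale) auto
qed

lemma has_value_zero [simp]: "has_value a b (\<lambda>x. 0) p 0"
  unfolding has_value_def by (intro exI[of _ "\<lambda>x. 0"]) auto

lemma has_value_cong: "has_value a b f p c \<Longrightarrow> ae_eq a b f g \<Longrightarrow> has_value a b g p c"
  unfolding has_value_def using ae_eq_trans[OF ae_eq_sym] by blast

lemma l2_inner_cong:
  assumes "ae_eq a b f f'" "ae_eq a b g g'" "f \<in> L2 a b" "f' \<in> L2 a b" "g \<in> L2 a b" "g' \<in> L2 a b"
  shows "l2_inner a b f g = l2_inner a b f' g'"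
  unfolding l2_inner_def
proof (rule integral_cong_AE)
  show "AE x in int_meas a b. f x * cnj (g x) = f' x * cnj (g' x)"
    using assms(1,2) unfolding ae_eq_def by eventually_elim simp
qed (auto intro!: borel_measurable_integrable L2_integrable_mult assms)

lemma l2_norm_cong:
  assumes "ae_eq a b f f'" "f \<in> L2 a b" "f' \<in> L2 a b"
  shows "l2_norm a b f = l2_norm a b f'"
proof -
  have "(LINT x|int_meas a b. (cmod (f x))\<^sup>2) = (LINT x|int_meas a b. (cmod (f' x))\<^sup>2)"
  proof (rule integral_cong_AE)
    show "AE x in int_meas a b. (cmod (f x))\<^sup>2 = (cmod (f' x))\<^sup>2"
      using assms(1) unfolding ae_eq_def by eventually_elim simp
  qed (use assms in \<open>auto simp: L2_def intro!: borel_measurable_integrable\<close>)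
  then show ?thesis by (simp add: l2_norm_def)
qed

lemma l2_inner_commute: "l2_inner a b g f = cnj (l2_inner a b f g)"
  unfolding l2_inner_def by (subst Bochner_Integration.integral_cnj[symmetric]) (simp add: mult.commute)

lemma l2_inner_add_left:
  assumes "f \<in> L2 a b" "f' \<in> L2 a b" "g \<in> L2 a b"
  shows "l2_inner a b (\<lambda>x. f x + f' x) g = l2_inner a b f g + l2_inner a b f' g"
  using L2_integrable_mult assms by (simp add: l2_inner_def distrib_right)

lemma l2_inner_scale_left: "l2_inner a b (\<lambda>x. c * f x) g = c * l2_inner a b f g"
  by (simp add: l2_inner_def mult.assoc)

lemma l2_inner_self: "l2_inner a b f f = complex_of_real ((l2_norm a b f)\<^sup>2)"
proof -
  have "l2_inner a b f f = (LINT x|int_meas a b. complex_of_real ((cmod (f x))\<^sup>2))"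
    unfolding l2_inner_def by (simp only: complex_norm_square)
  also have "\<dots> = complex_of_real (LINT x|int_meas a b. (cmod (f x))\<^sup>2)"
    by (rule integral_complex_of_real)
  finally show ?thesis by (simp add: l2_norm_def)
qed

lemma l2_norm_zero [simp]: "l2_norm a b (\<lambda>x. 0) = 0"
  by (simp add: l2_norm_def)

lemma l2_norm_eq_0:
  assumes "f \<in> L2 a b" "l2_norm a b f = 0"
  shows "ae_eq a b f (\<lambda>x. 0)"
proof -
  have "AE x in int_meas a b. (cmod (f x))\<^sup>2 = 0"
    using assms by (subst integral_nonneg_eq_0_iff_AE[symmetric]) (auto simp: l2_norm_def L2_def)
  then show ?thesis by (simp add: ae_eq_def)
qed


section \<open>The state space\<close>

type_synonym state_rep =
  "(real \<Rightarrow> complex) \<times> (real \<Rightarrow> complex) \<times> (real \<Rightarrow> complex) \<times> (real \<Rightarrow> complex) \<times> (real \<Rightarrow> complex)"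

definition state_carrier :: "state_rep set" where
  "state_carrier = {(u, v, w, u2, v2).
     u \<in> H1 0 1 \<and> v \<in> L2 0 1 \<and> w \<in> L2 1 2 \<and> u2 \<in> H1 2 3 \<and> v2 \<in> L2 2 3 \<and>
     has_value 0 1 u 0 0 \<and> has_value 2 3 u2 3 0}"

fun state_rel :: "state_rep \<Rightarrow> state_rep \<Rightarrow> bool" where
  "state_rel (u, v, w, u2, v2) (u', v', w', u2', v2') \<longleftrightarrow>
     (u, v, w, u2, v2) \<in> state_carrier \<and> (u', v', w', u2', v2') \<in> state_carrier \<and>
     ae_eq 0 1 u u' \<and> ae_eq 0 1 v v' \<and> ae_eq 1 2 w w' \<and> ae_eq 2 3 u2 u2' \<and> ae_eq 2 3 v2 v2'"

text \<open>The type \<open>state\<close> is the space \<open>X\<close>, with \<open>(u2, v2)\<close> in place of the pair of tilde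
  components.  It is only made an instance of the library's real inner product spaces, through the
  real part of the complex inner product \<open>cinner_state\<close>; this induces the same norm.\<close>

quotient_type state = state_rep / partial: state_rel
proof (rule part_equivpI)
  show "\<exists>x. state_rel x x"
    by (intro exI[of _ "(\<lambda>x. 0, \<lambda>x. 0, \<lambda>x. 0, \<lambda>x. 0, \<lambda>x. 0)"]) (simp add: state_carrier_def)
  show "symp state_rel" by (rule sympI) (auto intro: ae_eq_sym)
  show "transp state_rel" by (rule transpI) (auto intro: ae_eq_trans)
qed

lift_definition scaleC_state :: "complex \<Rightarrow> state \<Rightarrow> state" is
  "\<lambda>c (u, v, w, u2, v2).
     (\<lambda>x. c * u x, \<lambda>x. c * v x, \<lambda>x. c * w x, \<lambda>x. c * u2 x, \<lambda>x. c * v2 x)"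
  using has_value_scale[of _ _ _ _ 0]
  by (fastforce simp: state_carrier_def intro: H1_scale L2_scale ae_eq_scale)

lift_definition cinner_state :: "state \<Rightarrow> state \<Rightarrow> complex" is
  "\<lambda>(u, v, w, u2, v2) (u', v', w', u2', v2').
     l2_inner 0 1 (weak_deriv 0 1 u) (weak_deriv 0 1 u') + l2_inner 0 1 v v' + l2_inner 1 2 w w' +
     l2_inner 2 3 (weak_deriv 2 3 u2) (weak_deriv 2 3 u2') + l2_inner 2 3 v2 v2'"
proof clarify
  fix u1 v1 w1 y1 z1 u2 v2 w2 y2 z2 u3 v3 w3 y3 z3 u4 v4 w4 y4 z4
  assume 1: "state_rel (u1, v1, w1, y1, z1) (u2, v2, w2, y2, z2)"
    and 2: "state_rel (u3, v3, w3, y3, z3) (u4, v4, w4, y4, z4)"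
  have "weak_deriv 0 1 u1 = weak_deriv 0 1 u2" "weak_deriv 2 3 y1 = weak_deriv 2 3 y2"
    "weak_deriv 0 1 u3 = weak_deriv 0 1 u4" "weak_deriv 2 3 y3 = weak_deriv 2 3 y4"
    using 1 2 by (auto simp: state_carrier_def H1_L2 intro!: weak_deriv_cong)
  moreover have "l2_inner 0 1 v1 v3 = l2_inner 0 1 v2 v4" "l2_inner 1 2 w1 w3 = l2_inner 1 2 w2 w4"
    "l2_inner 2 3 z1 z3 = l2_inner 2 3 z2 z4"
    using 1 2 by (auto simp: state_carrier_def intro!: l2_inner_cong)
  ultimately show
    "l2_inner 0 1 (weak_deriv 0 1 u1) (weak_deriv 0 1 u3) + l2_inner 0 1 v1 v3 + l2_inner 1 2 w1 w3 +
     l2_inner 2 3 (weak_deriv 2 3 y1) (weak_deriv 2 3 y3) + l2_inner 2 3 z1 z3 =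
     l2_inner 0 1 (weak_deriv 0 1 u2) (weak_deriv 0 1 u4) + l2_inner 0 1 v2 v4 + l2_inner 1 2 w2 w4 +
     l2_inner 2 3 (weak_deriv 2 3 y2) (weak_deriv 2 3 y4) + l2_inner 2 3 z2 z4"
    by simp
qed

lemma cinner_state_commute: "cinner_state y x = cnj (cinner_state x y)"
  by transfer (auto simp: l2_inner_commute[symmetric])

lemma cinner_state_scale_left: "cinner_state (scaleC_state c x) y = c * cinner_state x y"
proof (transfer, clarify)
  fix c u1 v1 w1 y1 z1 u3 v3 w3 y3 z3
  assume "state_rel (u1, v1, w1, y1, z1) (u1, v1, w1, y1, z1)"
    "state_rel (u3, v3, w3, y3, z3) (u3, v3, w3, y3, z3)"
  then have H: "u1 \<in> H1 0 1" "y1 \<in> H1 2 3" "u3 \<in> H1 0 1" "y3 \<in> H1 2 3"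
    by (auto simp: state_carrier_def)
  have "l2_inner 0 1 (weak_deriv 0 1 (\<lambda>x. c * u1 x)) (weak_deriv 0 1 u3) =
      l2_inner 0 1 (\<lambda>x. c * weak_deriv 0 1 u1 x) (weak_deriv 0 1 u3)"
    "l2_inner 2 3 (weak_deriv 2 3 (\<lambda>x. c * y1 x)) (weak_deriv 2 3 y3) =
      l2_inner 2 3 (\<lambda>x. c * weak_deriv 2 3 y1 x) (weak_deriv 2 3 y3)"
    by (intro l2_inner_cong weak_deriv_scale ae_eq_refl L2_scale weak_deriv_L2 H1_scale H; simp)+
  then show
    "l2_inner 0 1 (weak_deriv 0 1 (\<lambda>x. c * u1 x)) (weak_deriv 0 1 u3) +
     l2_inner 0 1 (\<lambda>x. c * v1 x) v3 + l2_inner 1 2 (\<lambda>x. c * w1 x) w3 +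
     l2_inner 2 3 (weak_deriv 2 3 (\<lambda>x. c * y1 x)) (weak_deriv 2 3 y3) +
     l2_inner 2 3 (\<lambda>x. c * z1 x) z3 =
     c * (l2_inner 0 1 (weak_deriv 0 1 u1) (weak_deriv 0 1 u3) + l2_inner 0 1 v1 v3 +
       l2_inner 1 2 w1 w3 + l2_inner 2 3 (weak_deriv 2 3 y1) (weak_deriv 2 3 y3) + l2_inner 2 3 z1 z3)"
    by (simp add: l2_inner_scale_left distrib_left)
qed

instantiation state :: real_vector
begin

lift_definition zero_state :: state is "(\<lambda>x. 0, \<lambda>x. 0, \<lambda>x. 0, \<lambda>x. 0, \<lambda>x. 0)"
  by (simp add: state_carrier_def)

lift_definition plus_state :: "state \<Rightarrow> state \<Rightarrow> state" is
  "\<lambda>(u, v, w, u2, v2) (u', v', w', u2', v2').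
     (\<lambda>x. u x + u' x, \<lambda>x. v x + v' x, \<lambda>x. w x + w' x, \<lambda>x. u2 x + u2' x, \<lambda>x. v2 x + v2' x)"
  using has_value_add[of _ _ _ _ 0 _ 0]
  by (fastforce simp: state_carrier_def intro: H1_add L2_add ae_eq_add)

definition uminus_state :: "state \<Rightarrow> state" where
  "uminus_state x = scaleC_state (- 1) x"

definition minus_state :: "state \<Rightarrow> state \<Rightarrow> state" where
  "minus_state x y = x + - y"

definition scaleR_state :: "real \<Rightarrow> state \<Rightarrow> state" where
  "scaleR_state r x = scaleC_state (complex_of_real r) x"

instance
proof
  have closure_add: "has_value a b (\<lambda>x. f x + g x) p 0"
    if "has_value a b f p 0" "has_value a b g p 0" for a b p f g
    using has_value_add[OF that] by simp
  have closure_scale: "has_value a b (\<lambda>x. c * f x) p 0" if "has_value a b f p 0" for a b p f c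
    using has_value_scale[OF that] by simp
  note cl = H1_add H1_scale L2_add L2_scale closure_add closure_scale
  fix x y z :: state and r s :: real
  show "x + y + z = x + (y + z)"
    by transfer (auto simp: state_carrier_def add.assoc intro!: cl)
  show "x + y = y + x"
    by transfer (auto simp: state_carrier_def add.commute intro!: cl)
  show "0 + x = x"
    by transfer (auto simp: state_carrier_def intro!: cl)
  show "- x + x = 0"
    unfolding uminus_state_def by transfer (auto simp: state_carrier_def intro!: cl)
  show "x - y = x + - y" by (rule minus_state_def)
  show "r *\<^sub>R (x + y) = r *\<^sub>R x + r *\<^sub>R y"
    unfolding scaleR_state_def by transfer (auto simp: state_carrier_def distrib_left intro!: cl)
  show "(r + s) *\<^sub>R x = r *\<^sub>R x + s *\<^sub>R x"
    unfolding scaleR_state_def by transfer (auto simp: state_carrier_def distrib_right intro!: cl)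
  show "r *\<^sub>R s *\<^sub>R x = (r * s) *\<^sub>R x"
    unfolding scaleR_state_def by transfer (auto simp: state_carrier_def mult.assoc intro!: cl)
  show "1 *\<^sub>R x = x"
    unfolding scaleR_state_def by transfer (auto simp: state_carrier_def intro!: cl)
qed

end

instantiation state :: real_inner
begin

lift_definition norm_state :: "state \<Rightarrow> real" is
  "\<lambda>(u, v, w, u2, v2).
     sqrt ((l2_norm 0 1 (weak_deriv 0 1 u))\<^sup>2 + (l2_norm 0 1 v)\<^sup>2 + (l2_norm 1 2 w)\<^sup>2 +
           (l2_norm 2 3 (weak_deriv 2 3 u2))\<^sup>2 + (l2_norm 2 3 v2)\<^sup>2)"
proof clarify
  fix u1 v1 w1 y1 z1 u2 v2 w2 y2 z2
  assume 1: "state_rel (u1, v1, w1, y1, z1) (u2, v2, w2, y2, z2)"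
  have "weak_deriv 0 1 u1 = weak_deriv 0 1 u2" "weak_deriv 2 3 y1 = weak_deriv 2 3 y2"
    using 1 by (auto simp: state_carrier_def H1_L2 intro!: weak_deriv_cong)
  moreover have "l2_norm 0 1 v1 = l2_norm 0 1 v2" "l2_norm 1 2 w1 = l2_norm 1 2 w2"
    "l2_norm 2 3 z1 = l2_norm 2 3 z2"
    using 1 by (auto simp: state_carrier_def intro!: l2_norm_cong)
  ultimately show
    "sqrt ((l2_norm 0 1 (weak_deriv 0 1 u1))\<^sup>2 + (l2_norm 0 1 v1)\<^sup>2 + (l2_norm 1 2 w1)\<^sup>2 +
           (l2_norm 2 3 (weak_deriv 2 3 y1))\<^sup>2 + (l2_norm 2 3 z1)\<^sup>2) =
     sqrt ((l2_norm 0 1 (weak_deriv 0 1 u2))\<^sup>2 + (l2_norm 0 1 v2)\<^sup>2 + (l2_norm 1 2 w2)\<^sup>2 +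
           (l2_norm 2 3 (weak_deriv 2 3 y2))\<^sup>2 + (l2_norm 2 3 z2)\<^sup>2)"
    by simp
qed

definition inner_state :: "state \<Rightarrow> state \<Rightarrow> real" where
  "inner_state x y = Re (cinner_state x y)"

definition sgn_state :: "state \<Rightarrow> state" where
  "sgn_state x = x /\<^sub>R norm x"

definition dist_state :: "state \<Rightarrow> state \<Rightarrow> real" where
  "dist_state x y = norm (x - y)"

definition uniformity_state :: "(state \<times> state) filter" where
  "uniformity_state = (INF e\<in>{0<..}. principal {(x, y). dist x y < e})"

definition open_state :: "state set \<Rightarrow> bool" where
  "open_state U = (\<forall>x\<in>U. eventually (\<lambda>(x', y). x' = x \<longrightarrow> y \<in> U) uniformity)"

instance
proof
  fix x y z :: state and r :: real
  show "sgn x = x /\<^sub>R norm x" by (rule sgn_state_def)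
  show "dist x y = norm (x - y)" by (rule dist_state_def)
  show "uniformity = (INF e\<in>{0<..}. principal {(x::state, y). dist x y < e})"
    by (rule uniformity_state_def)
  show "open U = (\<forall>x\<in>U. eventually (\<lambda>(x', y). x' = x \<longrightarrow> y \<in> U) uniformity)" for U :: "state set"
    by (rule open_state_def)
  show "inner x y = inner y x"
    unfolding inner_state_def by (subst cinner_state_commute) simp
  show "inner (r *\<^sub>R x) y = r * inner x y"
    unfolding inner_state_def scaleR_state_def cinner_state_scale_left by simp
  have "cinner_state (x + y) z = cinner_state x z + cinner_state y z"
  proof (transfer, clarify)
    fix u1 v1 w1 y1 z1 u2 v2 w2 y2 z2 u3 v3 w3 y3 z3
    assume "state_rel (u1, v1, w1, y1, z1) (u1, v1, w1, y1, z1)"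
      "state_rel (u2, v2, w2, y2, z2) (u2, v2, w2, y2, z2)"
      "state_rel (u3, v3, w3, y3, z3) (u3, v3, w3, y3, z3)"
    then have H: "u1 \<in> H1 0 1" "y1 \<in> H1 2 3" "u2 \<in> H1 0 1" "y2 \<in> H1 2 3"
      "u3 \<in> H1 0 1" "y3 \<in> H1 2 3"
      and L: "v1 \<in> L2 0 1" "v2 \<in> L2 0 1" "v3 \<in> L2 0 1" "w1 \<in> L2 1 2" "w2 \<in> L2 1 2" "w3 \<in> L2 1 2"
      "z1 \<in> L2 2 3" "z2 \<in> L2 2 3" "z3 \<in> L2 2 3"
      by (auto simp: state_carrier_def)
    have "l2_inner 0 1 (weak_deriv 0 1 (\<lambda>x. u1 x + u2 x)) (weak_deriv 0 1 u3) =
        l2_inner 0 1 (\<lambda>x. weak_deriv 0 1 u1 x + weak_deriv 0 1 u2 x) (weak_deriv 0 1 u3)"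
      "l2_inner 2 3 (weak_deriv 2 3 (\<lambda>x. y1 x + y2 x)) (weak_deriv 2 3 y3) =
        l2_inner 2 3 (\<lambda>x. weak_deriv 2 3 y1 x + weak_deriv 2 3 y2 x) (weak_deriv 2 3 y3)"
      by (intro l2_inner_cong weak_deriv_add ae_eq_refl L2_add weak_deriv_L2 H1_add H; simp)+
    then show
      "l2_inner 0 1 (weak_deriv 0 1 (\<lambda>x. u1 x + u2 x)) (weak_deriv 0 1 u3) +
       l2_inner 0 1 (\<lambda>x. v1 x + v2 x) v3 + l2_inner 1 2 (\<lambda>x. w1 x + w2 x) w3 +
       l2_inner 2 3 (weak_deriv 2 3 (\<lambda>x. y1 x + y2 x)) (weak_deriv 2 3 y3) +
       l2_inner 2 3 (\<lambda>x. z1 x + z2 x) z3 =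
       l2_inner 0 1 (weak_deriv 0 1 u1) (weak_deriv 0 1 u3) + l2_inner 0 1 v1 v3 +
       l2_inner 1 2 w1 w3 + l2_inner 2 3 (weak_deriv 2 3 y1) (weak_deriv 2 3 y3) + l2_inner 2 3 z1 z3 +
       (l2_inner 0 1 (weak_deriv 0 1 u2) (weak_deriv 0 1 u3) + l2_inner 0 1 v2 v3 +
       l2_inner 1 2 w2 w3 + l2_inner 2 3 (weak_deriv 2 3 y2) (weak_deriv 2 3 y3) + l2_inner 2 3 z2 z3)"
      using H L by (simp add: l2_inner_add_left weak_deriv_L2)
  qed
  then show "inner (x + y) z = inner x z + inner y z" by (simp add: inner_state_def)
  have norm2: "inner x x = (norm x)\<^sup>2"
    unfolding inner_state_def by transfer (auto simp: l2_inner_self)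
  then show "0 \<le> inner x x" by simp
  have "0 \<le> norm x" by transfer auto
  then show "norm x = sqrt (inner x x)" using norm2 by simp
  have "x = 0" if "norm x = 0" using that
  proof (transfer, clarify)
    fix u v w y z
    assume r: "state_rel (u, v, w, y, z) (u, v, w, y, z)"
      and "sqrt ((l2_norm 0 1 (weak_deriv 0 1 u))\<^sup>2 + (l2_norm 0 1 v)\<^sup>2 + (l2_norm 1 2 w)\<^sup>2 +
           (l2_norm 2 3 (weak_deriv 2 3 y))\<^sup>2 + (l2_norm 2 3 z)\<^sup>2) = 0"
    then have n: "l2_norm 0 1 (weak_deriv 0 1 u) = 0" "l2_norm 0 1 v = 0" "l2_norm 1 2 w = 0"
      "l2_norm 2 3 (weak_deriv 2 3 y) = 0" "l2_norm 2 3 z = 0"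
      by (auto simp: add_nonneg_eq_0_iff)
    have c: "u \<in> H1 0 1" "v \<in> L2 0 1" "w \<in> L2 1 2" "y \<in> H1 2 3" "z \<in> L2 2 3"
      "has_value 0 1 u 0 0" "has_value 2 3 y 3 0"
      using r by (auto simp: state_carrier_def)
    have "ae_eq 0 1 u (\<lambda>x. 0)" "ae_eq 2 3 y (\<lambda>x. 0)"
      by (rule weak_deriv_zero[OF weak_deriv_works[OF c(1)] l2_norm_eq_0[OF weak_deriv_L2[OF c(1)] n(1)] _ c(6)],
          simp, simp)
         (rule weak_deriv_zero[OF weak_deriv_works[OF c(4)] l2_norm_eq_0[OF weak_deriv_L2[OF c(4)] n(4)] _ c(7)],
          simp, simp)
    then show "state_rel (u, v, w, y, z) (\<lambda>x. 0, \<lambda>x. 0, \<lambda>x. 0, \<lambda>x. 0, \<lambda>x. 0)"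
      using c n l2_norm_eq_0 by (auto simp: state_carrier_def)
  qed
  moreover have "norm (0::state) = 0"
  proof transfer
    have z: "ae_eq a b (weak_deriv a b (\<lambda>x. 0)) (\<lambda>x. 0)" if "a < b" for a b
      by (rule has_weak_deriv_unique[OF weak_deriv_works has_weak_deriv_zero that]) simp
    have "l2_norm a b (weak_deriv a b (\<lambda>x. 0)) = 0" if "a < b" for a b
      using l2_norm_cong[OF z[OF that]] by (simp add: weak_deriv_L2)
    then show "(case (\<lambda>x. 0, \<lambda>x. 0, \<lambda>x. 0, \<lambda>x. 0, \<lambda>x. 0) of (u, v, w, u2, v2) \<Rightarrow>
       sqrt ((l2_norm 0 1 (weak_deriv 0 1 u))\<^sup>2 + (l2_norm 0 1 v)\<^sup>2 + (l2_norm 1 2 w)\<^sup>2 +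
           (l2_norm 2 3 (weak_deriv 2 3 u2))\<^sup>2 + (l2_norm 2 3 v2)\<^sup>2)) = 0"
      by simp
  qed
  ultimately show "inner x x = 0 \<longleftrightarrow> x = 0" using norm2 by auto
qed

end


section \<open>The operator \<open>A\<close> and its resolvent\<close>

text \<open>Together with membership in \<open>state_carrier\<close>, which every representative of an element of \<open>X\<close>
  satisfies, this is the condition defining \<open>D(A)\<close>.  An existential over \<open>c\<close> states the equality
  of two boundary values.\<close>

definition domain_rep :: "state_rep \<Rightarrow> bool" where
  "domain_rep = (\<lambda>(u, v, w, u2, v2).
     u \<in> H2 0 1 \<and> v \<in> H1 0 1 \<and> w \<in> H2 1 2 \<and> u2 \<in> H2 2 3 \<and> v2 \<in> H1 2 3 \<and>
     has_value 0 1 v 0 0 \<and> has_value 2 3 v2 3 0 \<and>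
     (\<exists>c. has_value 0 1 (weak_deriv 0 1 u) 1 c \<and> has_value 1 2 (weak_deriv 1 2 w) 1 c) \<and>
     (\<exists>c. has_value 0 1 v 1 c \<and> has_value 1 2 w 1 c) \<and>
     (\<exists>c. has_value 2 3 (weak_deriv 2 3 u2) 2 c \<and> has_value 1 2 (weak_deriv 1 2 w) 2 c) \<and>
     (\<exists>c. has_value 2 3 v2 2 c \<and> has_value 1 2 w 2 c))"

lemma H2_cong:
  assumes "f \<in> H2 a b" "f' \<in> L2 a b" "ae_eq a b f f'" "a < b"
  shows "f' \<in> H2 a b"
  using assms H1_cong weak_deriv_cong[OF _ assms(2-4)] by (auto simp: H2_def H1_L2)

lemma H2_weak_deriv_L2: "f \<in> H2 a b \<Longrightarrow> weak_deriv a b (weak_deriv a b f) \<in> L2 a b"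
  by (auto simp: H2_def weak_deriv_L2)

lemma domain_rep_cong:
  assumes "domain_rep x" "state_rel x y"
  shows "domain_rep y"
proof -
  obtain u v w p q where x: "x = (u, v, w, p, q)" by (cases x)
  obtain u' v' w' p' q' where y: "y = (u', v', w', p', q')" by (cases y)
  have d: "u \<in> H2 0 1" "v \<in> H1 0 1" "w \<in> H2 1 2" "p \<in> H2 2 3" "q \<in> H1 2 3"
    using assms(1) by (auto simp: domain_rep_def x)
  have l: "u \<in> L2 0 1" "v \<in> L2 0 1" "w \<in> L2 1 2" "p \<in> L2 2 3" "q \<in> L2 2 3"
    "u' \<in> L2 0 1" "v' \<in> L2 0 1" "w' \<in> L2 1 2" "p' \<in> L2 2 3" "q' \<in> L2 2 3"
    using assms(2) by (auto simp: x y state_carrier_def H1_L2)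
  have e: "ae_eq 0 1 u u'" "ae_eq 0 1 v v'" "ae_eq 1 2 w w'" "ae_eq 2 3 p p'" "ae_eq 2 3 q q'"
    using assms(2) by (auto simp: x y)
  have w: "weak_deriv 0 1 u' = weak_deriv 0 1 u" "weak_deriv 1 2 w' = weak_deriv 1 2 w"
    "weak_deriv 2 3 p' = weak_deriv 2 3 p"
    by (rule weak_deriv_cong[symmetric]; use l e in simp)+
  have d': "u' \<in> H2 0 1" "v' \<in> H1 0 1" "w' \<in> H2 1 2" "p' \<in> H2 2 3" "q' \<in> H1 2 3"
    by (rule H2_cong[OF d(1) _ e(1)] H1_cong[OF d(2) _ e(2)] H2_cong[OF d(3) _ e(3)]
        H2_cong[OF d(4) _ e(4)] H1_cong[OF d(5) _ e(5)]; use l in simp)+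
  show ?thesis
    using assms(1) d' has_value_cong[OF _ e(2)] has_value_cong[OF _ e(3)] has_value_cong[OF _ e(5)]
    unfolding domain_rep_def x y prod.case w by blast
qed

lift_definition in_domain :: "state \<Rightarrow> bool" is domain_rep
proof -
  fix x y assume r: "state_rel x y"
  then have "state_rel y x" by (cases x; cases y) (auto intro: ae_eq_sym)
  with r show "domain_rep x = domain_rep y" using domain_rep_cong by blast
qed

definition dom_A :: "state set" where
  "dom_A = {x. in_domain x}"

text \<open>\<open>op_A\<close> is the operator on \<open>dom_A\<close>; outside of its domain it has the irrelevant value 0.\<close>

lift_definition op_A :: "state \<Rightarrow> state" is
  "\<lambda>(u, v, w, u2, v2).
     if domain_rep (u, v, w, u2, v2)
     then (v, weak_deriv 0 1 (weak_deriv 0 1 u), weak_deriv 1 2 (weak_deriv 1 2 w),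
           v2, weak_deriv 2 3 (weak_deriv 2 3 u2))
     else (\<lambda>x. 0, \<lambda>x. 0, \<lambda>x. 0, \<lambda>x. 0, \<lambda>x. 0)"
proof clarify
  fix u v w p q u' v' w' p' q'
  assume r: "state_rel (u, v, w, p, q) (u', v', w', p', q')"
  have r': "state_rel (u', v', w', p', q') (u, v, w, p, q)" using r by (auto intro: ae_eq_sym)
  have l: "u \<in> L2 0 1" "v \<in> L2 0 1" "w \<in> L2 1 2" "p \<in> L2 2 3" "q \<in> L2 2 3"
    "u' \<in> L2 0 1" "v' \<in> L2 0 1" "w' \<in> L2 1 2" "p' \<in> L2 2 3" "q' \<in> L2 2 3"
    using r by (auto simp: state_carrier_def H1_L2)
  have e: "ae_eq 0 1 u u'" "ae_eq 0 1 v v'" "ae_eq 1 2 w w'" "ae_eq 2 3 p p'" "ae_eq 2 3 q q'"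
    using r by auto
  have w: "weak_deriv 0 1 u' = weak_deriv 0 1 u" "weak_deriv 1 2 w' = weak_deriv 1 2 w"
    "weak_deriv 2 3 p' = weak_deriv 2 3 p"
    by (rule weak_deriv_cong[symmetric]; use l e in simp)+
  have d: "domain_rep (u, v, w, p, q) = domain_rep (u', v', w', p', q')"
    using domain_rep_cong r r' by blast
  show "state_rel
     (if domain_rep (u, v, w, p, q)
      then (v, weak_deriv 0 1 (weak_deriv 0 1 u), weak_deriv 1 2 (weak_deriv 1 2 w),
           q, weak_deriv 2 3 (weak_deriv 2 3 p))
      else (\<lambda>x. 0, \<lambda>x. 0, \<lambda>x. 0, \<lambda>x. 0, \<lambda>x. 0))
     (if domain_rep (u', v', w', p', q')
      then (v', weak_deriv 0 1 (weak_deriv 0 1 u'), weak_deriv 1 2 (weak_deriv 1 2 w'),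
           q', weak_deriv 2 3 (weak_deriv 2 3 p'))
      else (\<lambda>x. 0, \<lambda>x. 0, \<lambda>x. 0, \<lambda>x. 0, \<lambda>x. 0))"
  proof (cases "domain_rep (u, v, w, p, q)")
    case True
    then have "domain_rep (u', v', w', p', q')" using d by simp
    with True show ?thesis
      using e w by (auto simp: domain_rep_def state_carrier_def H2_weak_deriv_L2)
  next
    case False
    then show ?thesis using d by (simp add: state_carrier_def)
  qed
qed

text \<open>\<open>R(z,T) = (z - T)\<^sup>-\<^sup>1\<close> and \<open>\<rho>(T)\<close> for an operator \<open>T\<close> with domain \<open>D\<close>; the resolvent is
  meaningful only for \<open>z\<close> in the resolvent set.\<close>

definition resolvent :: "state set \<Rightarrow> (state \<Rightarrow> state) \<Rightarrow> complex \<Rightarrow> state \<Rightarrow> state" where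
  "resolvent D T z = inv_into D (\<lambda>x. scaleC_state z x - T x)"

definition resolvent_set :: "state set \<Rightarrow> (state \<Rightarrow> state) \<Rightarrow> complex set" where
  "resolvent_set D T =
     {z. bij_betw (\<lambda>x. scaleC_state z x - T x) D UNIV \<and> bounded_linear (resolvent D T z)}"

end

theory Submission
  imports Defs
begin

text \<open>Write \<open>z = is\<close> and let \<open>\<mu>\<close> be the square root of \<open>z\<close> with positive real part. On the wave
  segments the combinations \<open>u' + v\<close> and \<open>u' - v\<close> of a solution of the resolvent equation satisfy
  scalar linear equations with coefficients \<open>z\<close> and \<open>-z\<close>, whose propagators are unimodular; on the
  heat segment \<open>w' + \<mu> w\<close> and \<open>w' - \<mu> w\<close> satisfy equations with coefficients \<open>\<mu>\<close> and \<open>-\<mu>\<close>, which are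
  contractive when solved from the right and from the left endpoint respectively. So everything is
  controlled by the data and the two unknowns \<open>\<alpha> = u'(0)\<close> and \<open>\<beta> = u2'(3)\<close>, and the coupling
  conditions become \<open>D \<alpha> - exp (-\<mu>) E \<beta> = O(|\<mu>|)\<close> together with its mirror image, where
  \<open>D, E = cos s \<plusminus> i \<mu> sin s\<close>. Because \<open>\<mu>\<close> lies on a diagonal of the complex plane, \<open>|D| \<ge> 1/2\<close>,
  while \<open>exp (-\<mu>) E\<close> is negligible for large \<open>s\<close>; hence \<open>\<alpha>, \<beta> = O(|\<mu>|) = O(sqrt |s|)\<close>.\<close>

section \<open>Primitives and weak derivatives\<close>

lemma borel_measurable_int_meas:
  "f \<in> borel_measurable borel \<Longrightarrow> f \<in> borel_measurable (int_meas a b)"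
  by (intro measurable_restrict_space1 measurable_completion) simp

lemma L2_continuous:
  assumes "continuous_on {a..b} f"
  shows "f \<in> L2 a b"
proof -
  have [measurable]: "f \<in> borel_measurable (int_meas a b)"
    by (rule continuous_imp_measurable_on_sets_lebesgue[OF continuous_on_subset[OF assms]]) auto
  have "bounded (f ` {a..b})"
    by (intro compact_imp_bounded compact_continuous_image assms) auto
  then obtain B where B: "\<And>x. x \<in> {a..b} \<Longrightarrow> cmod (f x) \<le> B" unfolding bounded_iff by blast
  interpret finite_measure "int_meas a b" by (rule finite_measure_int_meas)
  have "integrable (int_meas a b) (\<lambda>x. (cmod (f x))\<^sup>2)"
  proof (rule integrable_const_bound)
    show "AE x in int_meas a b. norm ((cmod (f x))\<^sup>2) \<le> B\<^sup>2"
      using B by (intro AE_I2) (auto intro!: power_mono)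
  qed simp
  then show ?thesis by (simp add: L2_def)
qed

lemma L2_mult_continuous:
  assumes "f \<in> L2 a b" "continuous_on {a..b} E"
  shows "(\<lambda>x. E x * f x) \<in> L2 a b"
proof -
  have [measurable]: "f \<in> borel_measurable (int_meas a b)" "E \<in> borel_measurable (int_meas a b)"
    using assms L2_continuous by (auto simp: L2_def)
  have "bounded (E ` {a..b})"
    by (intro compact_imp_bounded compact_continuous_image assms) auto
  then obtain B where B: "\<And>x. x \<in> {a..b} \<Longrightarrow> cmod (E x) \<le> B" unfolding bounded_iff by blast
  have "integrable (int_meas a b) (\<lambda>x. (cmod (E x * f x))\<^sup>2)"
  proof (rule Bochner_Integration.integrable_bound)
    show "integrable (int_meas a b) (\<lambda>x. B\<^sup>2 * (cmod (f x))\<^sup>2)"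
      using assms by (auto simp: L2_def)
    show "AE x in int_meas a b. norm ((cmod (E x * f x))\<^sup>2) \<le> norm (B\<^sup>2 * (cmod (f x))\<^sup>2)"
      using B by (intro AE_I2) (auto simp: norm_mult power_mult_distrib intro!: mult_right_mono power_mono)
  qed simp
  then show ?thesis by (simp add: L2_def)
qed

text \<open>The primitive of \<open>g\<close> that vanishes at \<open>a\<close>. The indicator keeps
  the measure independent of \<open>x\<close>, so that dominated convergence and Fubini apply
  directly.\<close>

definition prim :: "real \<Rightarrow> real \<Rightarrow> (real \<Rightarrow> complex) \<Rightarrow> real \<Rightarrow> complex" where
  "prim a b g x = (LINT t|int_meas a b. indicator {..x} t *\<^sub>R g t)"

lemma integrable_indicator_int_meas:
  fixes g :: "real \<Rightarrow> 'a::{banach, second_countable_topology}"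
  assumes "integrable (int_meas a b) g" "S \<in> sets borel"
  shows "integrable (int_meas a b) (\<lambda>t. indicator S t *\<^sub>R g t)"
proof (rule Bochner_Integration.integrable_bound)
  have [measurable]: "g \<in> borel_measurable (int_meas a b)" using assms by auto
  have [measurable]: "(indicator S :: real \<Rightarrow> real) \<in> borel_measurable (int_meas a b)"
    by (rule borel_measurable_int_meas) (use assms in simp)
  show "(\<lambda>t. indicator S t *\<^sub>R g t) \<in> borel_measurable (int_meas a b)" by measurable
  show "AE x in int_meas a b. norm (indicator S x *\<^sub>R g x) \<le> norm (g x)"
    by (auto simp: indicator_def)
qed (rule assms)

lemma AE_int_meas_neq: "AE t in int_meas a b. t \<noteq> c"
proof -
  have "{c} \<in> null_sets lebesgue" using negligible_sing negligible_iff_null_sets by blast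
  then have "AE t in lebesgue. t \<notin> {c}" by (rule AE_not_in)
  then show ?thesis by (auto simp: AE_restrict_space_iff elim: eventually_mono)
qed

text \<open>Dominated convergence along sequences: the indicators of \<open>{..X n}\<close> converge
  pointwise except possibly at \<open>t = c\<close>, which is a null set.\<close>

lemma continuous_on_prim:
  assumes "integrable (int_meas a b) g"
  shows "continuous_on UNIV (prim a b g)"
  unfolding continuous_on_sequentially
proof (intro allI impI ballI, elim conjE, unfold comp_def)
  fix X :: "nat \<Rightarrow> real" and c assume lim: "X \<longlonglongrightarrow> c"
  show "(\<lambda>n. prim a b g (X n)) \<longlonglongrightarrow> prim a b g c"
    unfolding prim_def
  proof (rule integral_dominated_convergence[where w = "\<lambda>t. norm (g t)"])
    show "AE t in int_meas a b. (\<lambda>n. indicator {..X n} t *\<^sub>R g t) \<longlonglongrightarrow> indicator {..c} t *\<^sub>R g t"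
      using AE_int_meas_neq[where a=a and b=b and c=c]
    proof eventually_elim
      fix t assume "t \<noteq> c"
      then consider "t < c" | "c < t" by linarith
      then have "\<forall>\<^sub>F n in sequentially. indicator {..c} t = (indicator {..X n} t :: real)"
      proof cases
        case 1
        show ?thesis using order_tendstoD(1)[OF lim 1] by eventually_elim (use 1 in auto)
      next
        case 2
        show ?thesis using order_tendstoD(2)[OF lim 2] by eventually_elim (use 2 in auto)
      qed
      then show "(\<lambda>n. indicator {..X n} t *\<^sub>R g t) \<longlonglongrightarrow> indicator {..c} t *\<^sub>R g t"
        by (intro tendsto_eventually) (auto elim: eventually_mono)
    qed
    show "AE t in int_meas a b. norm (indicator {..X n} t *\<^sub>R g t) \<le> norm (g t)" for n
      by (auto simp: indicator_def)
  qed (auto intro!: borel_measurable_integrable integrable_indicator_int_meas integrable_norm assms)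
qed

text \<open>The inner integral in the Fubini argument for primitives: the fundamental theorem on
  \<open>{t..b}\<close> together with \<open>\<phi> b = 0\<close>.\<close>

lemma integral_indicator_vector_derivative:
  assumes \<phi>: "test_fun a b \<phi>" and t: "a < t" "t < b"
  shows "(LINT x|int_meas a b. indicator {t..} x * vector_derivative \<phi> (at x)) = - \<phi> t"
proof -
  let ?d = "\<lambda>x. vector_derivative \<phi> (at x)"
  have ab: "a < b" using t by simp
  note s = test_fun_supp[OF \<phi> ab]
  have d: "(\<phi> has_vector_derivative ?d x) (at x)" for x
    using \<phi> by (auto simp: test_fun_def C1_differentiable_on_eq vector_derivative_works)
  have b: "\<phi> b = 0" using s(1) by (auto simp: supp_fun_def)
  have int: "integrable (int_meas a b) (\<lambda>x. indicator {t..} x *\<^sub>R ?d x)"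
    by (intro integrable_indicator_int_meas supp_fun_integrable s) simp
  have "(?d has_integral (\<phi> b - \<phi> t)) {t..b}"
    using t d by (intro fundamental_theorem_of_calculus) (auto intro: has_vector_derivative_at_within)
  then have "((\<lambda>x. if x \<in> {t..b} then ?d x else 0) has_integral (\<phi> b - \<phi> t)) {a..b}"
    using t by (subst has_integral_restrict) auto
  then have "((\<lambda>x. if x \<in> {t..b} then ?d x else 0) has_integral (\<phi> b - \<phi> t)) {a<..<b}"
    by (simp add: has_integral_Icc_iff_Ioo)
  then have "((\<lambda>x. indicator {t..} x *\<^sub>R ?d x) has_integral (\<phi> b - \<phi> t)) {a<..<b}"
    by (rule has_integral_eq[rotated]) (auto simp: indicator_def)
  then show ?thesis
    using has_integral_unique[OF has_integral_integral_lebesgue_on[OF int]] b by simp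
qed

text \<open>Integration by parts against a test function is here the exchange of the two integrals
  over the triangle \<open>t \<le> x\<close>.\<close>

lemma has_weak_deriv_prim:
  assumes g: "g \<in> L2 a b" and ab: "a < b"
  shows "has_weak_deriv a b (prim a b g) g"
  unfolding has_weak_deriv_def
proof (intro conjI allI impI)
  let ?M = "int_meas a b"
  have gi: "integrable ?M g" using g by (rule L2_integrable)
  show "prim a b g \<in> L2 a b"
    by (rule L2_continuous[OF continuous_on_subset[OF continuous_on_prim[OF gi]]]) simp
  show "g \<in> L2 a b" by (rule g)
  fix \<phi> assume \<phi>: "test_fun a b \<phi>"
  let ?d = "\<lambda>x. vector_derivative \<phi> (at x)"
  note s = test_fun_supp[OF \<phi> ab]
  interpret F: finite_measure ?M by (rule finite_measure_int_meas)
  interpret P: pair_sigma_finite ?M ?M ..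
  have dm: "?d \<in> borel_measurable borel"
    using s(2) by (auto simp: supp_fun_def intro: borel_measurable_continuous_onI)
  have [measurable]: "?d \<in> borel_measurable ?M" by (rule borel_measurable_int_meas[OF dm])
  have [measurable]: "g \<in> borel_measurable ?M" using gi by auto
  have [measurable]: "(\<lambda>x. x) \<in> borel_measurable ?M" by (rule borel_measurable_int_meas) simp
  \<comment> \<open>The kernel is written with \<open>if\<close> so that joint measurability is
    found automatically; \<open>ind\<close> and \<open>ind2\<close> reread it as an indicator in
    \<open>t\<close> and in \<open>x\<close>, for the two orders of integration.\<close>
  define f where "f = (\<lambda>x t. (?d x * (if t \<le> x then 1 else 0)) *\<^sub>R g t)"
  have fm: "case_prod f \<in> borel_measurable (?M \<Otimes>\<^sub>M ?M)"
    unfolding f_def by measurable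
  have ind: "f x t = ?d x *\<^sub>R (indicator {..x} t *\<^sub>R g t)" for x t
    by (simp add: f_def indicator_def)
  have ind2: "f x t = (indicator {t..} x * ?d x) *\<^sub>R g t" for x t
    by (simp add: f_def indicator_def)
  have nf: "norm (f x t) = \<bar>?d x\<bar> * norm (indicator {..x} t *\<^sub>R g t)" for x t
    unfolding ind norm_scaleR[of "?d x"] by simp
  have int: "integrable (?M \<Otimes>\<^sub>M ?M) (case_prod f)"
  proof (rule P.Fubini_integrable[OF fm])
    have n: "norm (LINT t|?M. norm (case_prod f (x, t))) \<le> norm (?d x *\<^sub>R (LINT t|?M. norm (g t)))" for x
    proof -
      have "(LINT t|?M. norm (indicator {..x} t *\<^sub>R g t)) \<le> (LINT t|?M. norm (g t))"
        by (intro integral_mono integrable_norm integrable_indicator_int_meas gi) (auto simp: indicator_def)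
      then show ?thesis by (simp only: prod.case nf) (simp add: abs_mult mult_left_mono del: norm_scaleR)
    qed
    show "integrable ?M (\<lambda>x. LINT t|?M. norm (case_prod f (x, t)))"
    proof (rule Bochner_Integration.integrable_bound)
      show "integrable ?M (\<lambda>x. ?d x *\<^sub>R (LINT t|?M. norm (g t)))"
        using supp_fun_integrable[OF s(2)] by auto
      show "(\<lambda>x. LINT t|?M. norm (case_prod f (x, t))) \<in> borel_measurable ?M"
        using fm by measurable
    qed (use n in auto)
    show "AE x in ?M. integrable ?M (\<lambda>t. case_prod f (x, t))"
      unfolding prod.case ind
      by (intro AE_I2 integrable_scaleR_right integrable_indicator_int_meas gi) simp
  qed
  have "(LINT x|?M. ?d x *\<^sub>R prim a b g x) = (LINT x|?M. LINT t|?M. f x t)"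
    unfolding ind prim_def
    by (intro Bochner_Integration.integral_cong refl integral_scaleR_right[symmetric]
        integrable_indicator_int_meas gi)
  also have "\<dots> = (LINT t|?M. LINT x|?M. f x t)"
    by (rule P.Fubini_integral[OF int, symmetric])
  also have "\<dots> = (LINT t|?M. - (\<phi> t *\<^sub>R g t))"
  proof (rule Bochner_Integration.integral_cong[OF refl])
    fix t assume "t \<in> space ?M"
    then have t: "a < t" "t < b" by auto
    have "(LINT x|?M. f x t) = (LINT x|?M. indicator {t..} x * ?d x) *\<^sub>R g t"
      unfolding ind2 using integrable_indicator_int_meas[OF supp_fun_integrable[OF s(2)], of "{t..}"]
      by simp
    then show "(LINT x|?M. f x t) = - (\<phi> t *\<^sub>R g t)"
      using integral_indicator_vector_derivative[OF \<phi> t] by simp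
  qed
  finally show "(LINT x|?M. ?d x *\<^sub>R prim a b g x) = - (LINT x|?M. \<phi> x *\<^sub>R g x)" by simp
qed

lemma has_weak_deriv_const:
  assumes "a < b" shows "has_weak_deriv a b (\<lambda>x. c) (\<lambda>x. 0)"
  unfolding has_weak_deriv_def
proof (intro conjI allI impI L2_one L2_zero)
  fix \<phi> assume \<phi>: "test_fun a b \<phi>"
  let ?d = "\<lambda>x. vector_derivative \<phi> (at x)"
  note s = test_fun_supp[OF \<phi> assms]
  have d: "(\<phi> has_vector_derivative ?d x) (at x)" for x
    using \<phi> by (auto simp: test_fun_def C1_differentiable_on_eq vector_derivative_works)
  have "\<phi> a = 0" "\<phi> b = 0" using s(1) by (auto simp: supp_fun_def)
  moreover have "(?d has_integral (\<phi> b - \<phi> a)) {a..b}"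
    using assms d by (intro fundamental_theorem_of_calculus) (auto intro: has_vector_derivative_at_within)
  ultimately have "(?d has_integral 0) {a<..<b}" by (simp add: has_integral_Icc_iff_Ioo)
  then have "(LINT x|int_meas a b. ?d x) = 0"
    using has_integral_unique[OF has_integral_integral_lebesgue_on[OF supp_fun_integrable[OF s(2)]]]
    by simp
  then show "(LINT x|int_meas a b. ?d x *\<^sub>R c) = - (LINT x|int_meas a b. \<phi> x *\<^sub>R 0)"
    using supp_fun_integrable[OF s(2)] by simp
qed

section \<open>Continuous representatives and boundary values\<close>

lemma ae_eq_const_iff:
  assumes "a < b" shows "ae_eq a b (\<lambda>x. c) (\<lambda>x. d) \<longleftrightarrow> c = d"
proof -
  have "\<not> (AE x in int_meas a b. False)"
  proof
    assume "AE x in int_meas a b. False"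
    then have "AE x in lebesgue. x \<notin> {a<..<b}" by (simp add: AE_restrict_space_iff)
    then have "{a<..<b} \<in> null_sets lebesgue" by (subst AE_iff_null_sets) auto
    then have "negligible {a<..<b}" by (simp add: negligible_iff_null_sets)
    then show False using assms open_not_negligible[of "{a<..<b}"] by auto
  qed
  then show ?thesis by (cases "c = d") (auto simp: ae_eq_def)
qed

text \<open>With \<open>c = f p - g p\<close>, the constant \<open>c\<close> agrees almost
  everywhere with the continuous function \<open>c - (f - g)\<close>, which is 0 at
  \<open>p\<close>. A function with zero weak derivative and value 0 at a point vanishes, so
  \<open>c = 0\<close>.\<close>

lemma ae_eq_continuous:
  assumes c: "continuous_on {a..b} f" "continuous_on {a..b} g" and e: "ae_eq a b f g"
    and ab: "a < b" and p: "p \<in> {a..b}"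
  shows "f p = g p"
proof -
  let ?c = "f p - g p"
  have "ae_eq a b (\<lambda>x. ?c) (\<lambda>x. ?c - (f x - g x))"
    using e unfolding ae_eq_def by eventually_elim auto
  then have "has_value a b (\<lambda>x. ?c) p 0"
    unfolding has_value_def
    by (intro exI[of _ "\<lambda>x. ?c - (f x - g x)"]) (auto intro!: continuous_intros c)
  then have "ae_eq a b (\<lambda>x. ?c) (\<lambda>x. 0)"
    by (rule weak_deriv_zero[OF has_weak_deriv_const[OF ab] ae_eq_refl ab _ p])
  then show ?thesis using ae_eq_const_iff[OF ab] by simp
qed

text \<open>Boundary values can be read off from any chosen continuous representative, since two
  such representatives agree on the closed interval.\<close>

lemma has_value_iff:
  assumes "continuous_on {a..b} g" "ae_eq a b f g" "a < b" "p \<in> {a..b}"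
  shows "has_value a b f p c \<longleftrightarrow> g p = c"
proof
  assume "has_value a b f p c"
  then obtain h where "continuous_on {a..b} h" "ae_eq a b f h" "h p = c" by (auto simp: has_value_def)
  then show "g p = c"
    using ae_eq_continuous[OF assms(1) _ ae_eq_trans[OF ae_eq_sym[OF assms(2)]] assms(3,4)] by blast
qed (use assms in \<open>auto simp: has_value_def\<close>)

text \<open>The difference of \<open>f\<close> and \<open>prim a b g\<close> has weak derivative
  zero and is therefore constant.\<close>

lemma has_weak_deriv_imp_prim:
  assumes "has_weak_deriv a b f g" "a < b"
  obtains c where "ae_eq a b f (\<lambda>x. c + prim a b g x)"
proof -
  have "g \<in> L2 a b" using assms by (simp add: has_weak_deriv_def)
  from has_weak_deriv_scale[OF has_weak_deriv_prim[OF this assms(2)], of "-1"]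
  have "has_weak_deriv a b (\<lambda>x. f x + - 1 * prim a b g x) (\<lambda>x. g x + - 1 * g x)"
    by (rule has_weak_deriv_add[OF assms(1) _ assms(2)])
  from weak_deriv_zero_const[OF this _ assms(2)]
  obtain c where "ae_eq a b (\<lambda>x. f x + - 1 * prim a b g x) (\<lambda>x. c)" by auto
  then have "ae_eq a b f (\<lambda>x. c + prim a b g x)"
    unfolding ae_eq_def by eventually_elim (simp add: algebra_simps)
  then show ?thesis by (rule that)
qed

lemma continuous_representative:
  assumes "has_weak_deriv a b f g" "a < b"
  obtains h where "continuous_on {a..b} h" "ae_eq a b f h" "has_weak_deriv a b h g"
proof -
  obtain c where c: "ae_eq a b f (\<lambda>x. c + prim a b g x)" by (rule has_weak_deriv_imp_prim[OF assms])
  have L: "f \<in> L2 a b" "g \<in> L2 a b" using assms by (auto simp: has_weak_deriv_def)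
  have cont: "continuous_on {a..b} (\<lambda>x. c + prim a b g x)"
    by (intro continuous_intros continuous_on_subset[OF continuous_on_prim] L2_integrable L) simp
  show ?thesis
    by (rule that[OF cont c])
       (rule has_weak_deriv_cong[OF assms(1) c ae_eq_refl L2_continuous[OF cont] L(2) assms(2)])
qed

text \<open>Both \<open>f\<close> and its representation through \<open>prim\<close> are continuous,
  so they agree at every point of \<open>{a..b}\<close>, the endpoints included.\<close>

lemma has_weak_deriv_diff_eq:
  assumes "has_weak_deriv a b f g" "continuous_on {a..b} f" "a < b" "a \<le> x" "x \<le> y" "y \<le> b"
  shows "f y - f x = (LINT t|int_meas a b. indicator {x<..y} t *\<^sub>R g t)"
proof -
  obtain c where c: "ae_eq a b f (\<lambda>x. c + prim a b g x)" by (rule has_weak_deriv_imp_prim[OF assms(1,3)])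
  have g: "integrable (int_meas a b) g" using assms by (auto simp: has_weak_deriv_def intro: L2_integrable)
  have cont: "continuous_on {a..b} (\<lambda>x. c + prim a b g x)"
    by (intro continuous_intros continuous_on_subset[OF continuous_on_prim] g) simp
  have e: "f p = c + prim a b g p" if "p \<in> {a..b}" for p
    by (rule ae_eq_continuous[OF assms(2) cont c assms(3) that])
  have "f y - f x = prim a b g y - prim a b g x" using e assms by simp
  also have "\<dots> = (LINT t|int_meas a b. indicator {..y} t *\<^sub>R g t - indicator {..x} t *\<^sub>R g t)"
    unfolding prim_def using integrable_indicator_int_meas[OF g] by simp
  also have "\<dots> = (LINT t|int_meas a b. indicator {x<..y} t *\<^sub>R g t)"
    using assms(5) by (intro Bochner_Integration.integral_cong) (auto simp: indicator_def)
  finally show ?thesis .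
qed

lemma supp_fun_mult:
  assumes "supp_fun a b w" "continuous_on UNIV e"
  shows "supp_fun a b (\<lambda>x. w x * e x)"
  using assms unfolding supp_fun_def by (fastforce intro: continuous_on_mult)

text \<open>The product of a test function with \<open>e\<close> is again a test function; testing
  the derivative of \<open>f\<close> against it and expanding gives the product rule.\<close>

lemma has_weak_deriv_mult_real:
  assumes f: "has_weak_deriv a b f g" and e: "\<And>x. (e has_real_derivative e' x) (at x)"
    and e': "continuous_on UNIV e'" and ab: "a < b"
  shows "has_weak_deriv a b (\<lambda>x. complex_of_real (e x) * f x)
    (\<lambda>x. complex_of_real (e x) * g x + complex_of_real (e' x) * f x)"
  unfolding has_weak_deriv_def
proof (intro conjI allI impI)
  let ?M = "int_meas a b"
  have ec: "continuous_on UNIV e"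
    using e by (auto intro!: continuous_at_imp_continuous_on DERIV_isCont)
  have L: "f \<in> L2 a b" "g \<in> L2 a b" using f by (auto simp: has_weak_deriv_def)
  have fi: "integrable ?M f" and gi: "integrable ?M g" using L by (auto intro: L2_integrable)
  have c: "continuous_on {a..b} (\<lambda>x. complex_of_real (e x))" "continuous_on {a..b} (\<lambda>x. complex_of_real (e' x))"
    by (auto intro!: continuous_intros continuous_on_subset[OF ec] continuous_on_subset[OF e'])
  show "(\<lambda>x. complex_of_real (e x) * f x) \<in> L2 a b"
    "(\<lambda>x. complex_of_real (e x) * g x + complex_of_real (e' x) * f x) \<in> L2 a b"
    by (intro L2_add L2_mult_continuous L c)+
  fix \<phi> assume \<phi>: "test_fun a b \<phi>"
  let ?d = "\<lambda>x. vector_derivative \<phi> (at x)"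
  note s = test_fun_supp[OF \<phi> ab]
  have d: "(\<phi> has_real_derivative ?d x) (at x)" for x
    using \<phi> unfolding has_real_derivative_iff_has_vector_derivative
    by (auto simp: test_fun_def C1_differentiable_on_eq vector_derivative_works)
  have dc: "continuous_on UNIV ?d" using s(2) by (simp add: supp_fun_def)
  have pc: "continuous_on UNIV \<phi>" using s(1) by (simp add: supp_fun_def)
  have de: "((\<lambda>x. \<phi> x * e x) has_vector_derivative (?d x * e x + \<phi> x * e' x)) (at x)" for x
    unfolding has_real_derivative_iff_has_vector_derivative[symmetric]
    by (auto intro!: derivative_eq_intros d e)
  then have vd: "vector_derivative (\<lambda>x. \<phi> x * e x) (at x) = ?d x * e x + \<phi> x * e' x" for x
    by (rule vector_derivative_at)
  have "test_fun a b (\<lambda>x. \<phi> x * e x)"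
    unfolding test_fun_def
  proof
    show "(\<lambda>x. \<phi> x * e x) C1_differentiable_on UNIV"
      unfolding C1_differentiable_on_def using de
      by (intro exI[of _ "\<lambda>x. ?d x * e x + \<phi> x * e' x"]) (auto intro!: continuous_intros dc pc ec e')
    show "\<exists>K. compact K \<and> K \<subseteq> {a<..<b} \<and> (\<forall>x. x \<notin> K \<longrightarrow> \<phi> x * e x = 0)"
      using \<phi> unfolding test_fun_def by (metis mult_zero_left)
  qed
  then have "(LINT x|?M. (?d x * e x + \<phi> x * e' x) *\<^sub>R f x) = - (LINT x|?M. (\<phi> x * e x) *\<^sub>R g x)"
    using f unfolding has_weak_deriv_def vd[symmetric] by blast
  moreover note i = supp_fun_mult_integrable[OF fi supp_fun_mult[OF s(2) ec]]
    supp_fun_mult_integrable[OF fi supp_fun_mult[OF s(1) e']]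
    supp_fun_mult_integrable[OF gi supp_fun_mult[OF s(1) ec]]
  ultimately have "(LINT x|?M. (?d x * e x) *\<^sub>R f x) + (LINT x|?M. (\<phi> x * e' x) *\<^sub>R f x) =
      - (LINT x|?M. (\<phi> x * e x) *\<^sub>R g x)"
    by (simp add: scaleR_add_left)
  then have "(LINT x|?M. (?d x * e x) *\<^sub>R f x) =
      - ((LINT x|?M. (\<phi> x * e x) *\<^sub>R g x) + (LINT x|?M. (\<phi> x * e' x) *\<^sub>R f x))"
    by (simp only: minus_add_distrib add_uminus_conv_diff eq_diff_eq)
  also have "(LINT x|?M. (\<phi> x * e x) *\<^sub>R g x) + (LINT x|?M. (\<phi> x * e' x) *\<^sub>R f x) =
      (LINT x|?M. (\<phi> x * e x) *\<^sub>R g x + (\<phi> x * e' x) *\<^sub>R f x)"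
    by (rule Bochner_Integration.integral_add[symmetric]; rule i)
  finally show "(LINT x|?M. ?d x *\<^sub>R (complex_of_real (e x) * f x)) =
      - (LINT x|?M. \<phi> x *\<^sub>R (complex_of_real (e x) * g x + complex_of_real (e' x) * f x))"
    by (simp add: scaleR_conv_of_real algebra_simps)
qed

text \<open>Test functions are real valued, so the complex factor is split into its real and
  imaginary parts.\<close>

lemma has_weak_deriv_mult:
  assumes f: "has_weak_deriv a b f g" and E: "\<And>x. (E has_vector_derivative E' x) (at x)"
    and E': "continuous_on UNIV E'" and ab: "a < b"
  shows "has_weak_deriv a b (\<lambda>x. E x * f x) (\<lambda>x. E x * g x + E' x * f x)"
proof -
  have "((\<lambda>x. Re (E x)) has_real_derivative Re (E' x)) (at x)"
    "((\<lambda>x. Im (E x)) has_real_derivative Im (E' x)) (at x)" for x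
    unfolding has_real_derivative_iff_has_vector_derivative
    using bounded_linear.has_vector_derivative[OF bounded_linear_Re E]
      bounded_linear.has_vector_derivative[OF bounded_linear_Im E] by auto
  note 1 = has_weak_deriv_mult_real[OF f this(1) _ ab] has_weak_deriv_mult_real[OF f this(2) _ ab]
  have "has_weak_deriv a b
     (\<lambda>x. complex_of_real (Re (E x)) * f x + \<i> * (complex_of_real (Im (E x)) * f x))
     (\<lambda>x. complex_of_real (Re (E x)) * g x + complex_of_real (Re (E' x)) * f x +
        \<i> * (complex_of_real (Im (E x)) * g x + complex_of_real (Im (E' x)) * f x))"
    by (intro has_weak_deriv_add has_weak_deriv_scale 1 ab continuous_intros E')
  moreover have "complex_of_real (Re z) * u + \<i> * (complex_of_real (Im z) * u) = z * u" for z u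
    by (simp add: complex_eq_iff)
  moreover have "complex_of_real (Re z) * u + complex_of_real (Re z') * u' +
        \<i> * (complex_of_real (Im z) * u + complex_of_real (Im z') * u') = z * u + z' * u'" for z u z' u'
    by (simp add: complex_eq_iff)
  ultimately show ?thesis by simp
qed

text \<open>Cauchy-Schwarz against the constant 1 on an interval of length at most 1, obtained by
  integrating \<open>2 |k| m \<le> |k|^2 + m^2\<close> with a constant weight
  \<open>m\<close>.\<close>

lemma integral_cmod_le_l2_norm:
  assumes k: "k \<in> L2 a b" and ab: "a \<le> b" "b \<le> a + 1"
  shows "(LINT t|int_meas a b. cmod (k t)) \<le> l2_norm a b k"
proof (rule field_le_epsilon)
  fix e :: real assume e: "e > 0"
  let ?M = "int_meas a b" and ?N = "l2_norm a b k"
  interpret finite_measure ?M by (rule finite_measure_int_meas)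
  have N: "(LINT t|?M. (cmod (k t))\<^sup>2) = ?N\<^sup>2" "0 \<le> ?N" by (simp_all add: l2_norm_def)
  \<comment> \<open>The natural weight is the norm itself; adding \<open>e\<close> keeps it positive
    when the norm is zero.\<close>
  define m where "m = ?N + e"
  have m: "m > 0" "?N \<le> m" using e N by (auto simp: m_def)
  have i: "integrable ?M (\<lambda>t. (cmod (k t))\<^sup>2)" using k by (simp add: L2_def)
  have "(LINT t|?M. cmod (k t)) \<le> (LINT t|?M. (cmod (k t))\<^sup>2 / (2 * m) + m / 2)"
  proof (rule integral_mono)
    fix t
    have "2 * cmod (k t) * m \<le> (cmod (k t))\<^sup>2 + m\<^sup>2" by (rule sum_squares_bound)
    then show "cmod (k t) \<le> (cmod (k t))\<^sup>2 / (2 * m) + m / 2"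
      using m by (simp add: field_simps power2_eq_square)
  qed (use i in \<open>auto intro: integrable_norm L2_integrable k\<close>)
  also have "\<dots> = ?N\<^sup>2 / (2 * m) + (b - a) * (m / 2)"
    using i ab by (simp add: N measure_restrict_space)
  also have "\<dots> \<le> m\<^sup>2 / (2 * m) + 1 * (m / 2)"
    using m N ab by (intro add_mono divide_right_mono power_mono mult_right_mono) auto
  also have "\<dots> = m" using m by (simp add: power2_eq_square)
  also have "\<dots> = ?N + e" by (rule m_def)
  finally show "(LINT t|?M. cmod (k t)) \<le> ?N + e" .
qed

section \<open>Linear equations with square integrable data\<close>

lemma has_vector_derivative_exp_linear:
  "((\<lambda>x. exp (c * complex_of_real x + d)) has_vector_derivative c * exp (c * complex_of_real x + d)) (at x)"
proof -
  have "((\<lambda>z. exp (c * z + d)) has_field_derivative c * exp (c * complex_of_real x + d)) (at (complex_of_real x))"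
    by (auto intro!: derivative_eq_intros)
  from has_vector_derivative_real_field[OF this] show ?thesis by simp
qed

text \<open>With the integrating factor \<open>E = exp (c - \<mu> t)\<close> the equation becomes
  \<open>(E y)' = E k\<close>. Since \<open>|E| \<le> 1\<close> between \<open>x\<close> and
  \<open>x'\<close>, the increment of \<open>E y\<close> is at most the integral of
  \<open>|k|\<close>. The free constant \<open>c\<close> allows \<open>E\<close> to be normalised to
  1 at either end.\<close>

lemma weak_ode_bound:
  assumes y: "has_weak_deriv a b y (\<lambda>x. \<mu> * y x + k x)" "continuous_on {a..b} y" and k: "k \<in> L2 a b"
    and ab: "a < b" "b \<le> a + 1" "a \<le> x" "x \<le> x'" "x' \<le> b"
    and c: "\<And>t. x \<le> t \<Longrightarrow> t \<le> x' \<Longrightarrow> Re (c - \<mu> * complex_of_real t) \<le> 0"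
  shows "cmod (exp (c - \<mu> * x') * y x' - exp (c - \<mu> * x) * y x) \<le> l2_norm a b k"
proof -
  let ?E = "\<lambda>x. exp (- \<mu> * complex_of_real x + c)"
  have E: "?E t = exp (c - \<mu> * t)" for t :: real by simp
  have Ec: "continuous_on UNIV ?E" by (intro continuous_intros)
  have "has_weak_deriv a b (\<lambda>x. ?E x * y x) (\<lambda>x. ?E x * (\<mu> * y x + k x) + (- \<mu> * ?E x) * y x)"
    by (rule has_weak_deriv_mult[OF y(1) has_vector_derivative_exp_linear _ ab(1)])
       (intro continuous_intros)
  then have d: "has_weak_deriv a b (\<lambda>x. ?E x * y x) (\<lambda>x. ?E x * k x)"
    by (simp add: algebra_simps)
  have "integrable (int_meas a b) (\<lambda>x. ?E x * k x)"
    using d by (auto simp: has_weak_deriv_def intro: L2_integrable)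
  then have i: "integrable (int_meas a b) (\<lambda>t. indicator {x<..x'} t *\<^sub>R (?E t * k t))"
    by (rule integrable_indicator_int_meas) simp
  have "?E x' * y x' - ?E x * y x = (LINT t|int_meas a b. indicator {x<..x'} t *\<^sub>R (?E t * k t))"
    by (intro has_weak_deriv_diff_eq[OF d] ab continuous_intros y continuous_on_subset[OF Ec]) simp
  also have "cmod \<dots> \<le> (LINT t|int_meas a b. cmod (indicator {x<..x'} t *\<^sub>R (?E t * k t)))"
    by (rule integral_norm_bound)
  also have "\<dots> \<le> (LINT t|int_meas a b. cmod (k t))"
  proof (rule integral_mono)
    fix t
    have "cmod (?E t) \<le> 1" if "t \<in> {x<..x'}" using c[of t] that by (simp add: norm_exp_eq_Re)
    then show "cmod (indicator {x<..x'} t *\<^sub>R (?E t * k t)) \<le> cmod (k t)"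
      by (auto simp: indicator_def norm_mult intro: mult_left_le_one_le)
  qed (intro integrable_norm i L2_integrable k)+
  also have "\<dots> \<le> l2_norm a b k" by (rule integral_cmod_le_l2_norm[OF k]) (use ab in auto)
  finally show ?thesis unfolding E .
qed

text \<open>The choice \<open>c = \<mu> x\<close> normalises the factor at the point of evaluation,
  and the sign of \<open>Re \<mu>\<close> makes the propagator from \<open>a\<close> non-growing.
  The backward version is the mirror image.\<close>

corollary weak_ode_bound_forward:
  assumes "has_weak_deriv a b y (\<lambda>x. \<mu> * y x + k x)" "continuous_on {a..b} y" "k \<in> L2 a b"
    "a < b" "b \<le> a + 1" "Re \<mu> \<le> 0" "x \<in> {a..b}"
  shows "cmod (y x - exp (\<mu> * (x - a)) * y a) \<le> l2_norm a b k"
  using weak_ode_bound[OF assms(1-5) order_refl, of x "\<mu> * x"] assms(6,7)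
  by (simp add: right_diff_distrib mult_left_mono_neg)

corollary weak_ode_bound_backward:
  assumes "has_weak_deriv a b y (\<lambda>x. \<mu> * y x + k x)" "continuous_on {a..b} y" "k \<in> L2 a b"
    "a < b" "b \<le> a + 1" "0 \<le> Re \<mu>" "x \<in> {a..b}"
  shows "cmod (y x - exp (- (\<mu> * (b - x))) * y b) \<le> l2_norm a b k"
  using weak_ode_bound[OF assms(1-5), of x b "\<mu> * x"] assms(6,7)
  by (simp add: right_diff_distrib mult_left_mono norm_minus_commute)

text \<open>Variation of constants. The order of the quantifiers matters: \<open>K\<close> does not
  depend on \<open>c\<close>, so the end value is an affine function of the initial value, as the
  shooting argument requires.\<close>

lemma weak_ode_solution:
  assumes k: "k \<in> L2 a b" and ab: "a < b"
  shows "\<exists>K. \<forall>c. \<exists>y. continuous_on {a..b} y \<and> has_weak_deriv a b y (\<lambda>x. \<mu> * y x + k x) \<and>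
    y a = c \<and> y b = exp (\<mu> * (b - a)) * c + K"
proof (intro exI allI)
  define h where "h t = exp (- \<mu> * complex_of_real t + \<mu> * a) * k t" for t
  let ?E = "\<lambda>x. exp (\<mu> * complex_of_real x + (- \<mu> * a))"
  have h: "h \<in> L2 a b" unfolding h_def
    by (intro L2_mult_continuous k continuous_intros)
  fix c
  define y where "y x = ?E x * (c + prim a b h x)" for x
  have pc: "continuous_on {a..b} (prim a b h)"
    by (rule continuous_on_subset[OF continuous_on_prim[OF L2_integrable[OF h]]]) simp
  have "has_weak_deriv a b (\<lambda>x. c + prim a b h x) (\<lambda>x. 0 + h x)"
    by (intro has_weak_deriv_add has_weak_deriv_const has_weak_deriv_prim ab h)
  then have "has_weak_deriv a b y (\<lambda>x. ?E x * (0 + h x) + (\<mu> * ?E x) * (c + prim a b h x))"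
    unfolding y_def
    by (rule has_weak_deriv_mult[OF _ has_vector_derivative_exp_linear _ ab]) (intro continuous_intros)
  moreover have "?E x * h x = k x" for x
    by (simp add: h_def flip: mult.assoc exp_add)
  ultimately have "has_weak_deriv a b y (\<lambda>x. \<mu> * y x + k x)"
    by (simp add: y_def algebra_simps)
  moreover have "continuous_on {a..b} y" unfolding y_def by (intro continuous_intros pc)
  \<comment> \<open>The indicator of \<open>{..a}\<close> vanishes on the open interval.\<close>
  moreover have "prim a b h a = (LINT t|int_meas a b. 0)"
    unfolding prim_def by (intro Bochner_Integration.integral_cong) auto
  then have "y a = c" by (simp add: y_def)
  moreover have "y b = exp (\<mu> * (b - a)) * c + exp (\<mu> * (b - a)) * prim a b h b"
    by (simp add: y_def algebra_simps)
  ultimately show "continuous_on {a..b} y \<and> has_weak_deriv a b y (\<lambda>x. \<mu> * y x + k x) \<and>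
    y a = c \<and> y b = exp (\<mu> * (b - a)) * c + exp (\<mu> * (b - a)) * prim a b h b"
    by blast
qed

section \<open>Norm estimates in \<open>L2\<close>\<close>

lemma l2_norm_nonneg: "0 \<le> l2_norm a b f"
  by (simp add: l2_norm_def)

lemma l2_norm_uminus: "l2_norm a b (\<lambda>x. - f x) = l2_norm a b f"
  by (simp add: l2_norm_def)

lemma L2_uminus: "f \<in> L2 a b \<Longrightarrow> (\<lambda>x. - f x) \<in> L2 a b"
  using L2_scale[of f a b "-1"] by simp

lemma L2_diff: "f \<in> L2 a b \<Longrightarrow> g \<in> L2 a b \<Longrightarrow> (\<lambda>x. f x - g x) \<in> L2 a b"
  using L2_add[OF _ L2_uminus, of f a b g] by simp

text \<open>Integrate \<open>|f + g|^2 \<le> 2 |f|^2 + 2 |g|^2\<close>; as both norms share the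
  bound \<open>M\<close>, this yields the same constant as the triangle inequality.\<close>

lemma l2_norm_add_le:
  assumes f: "f \<in> L2 a b" "l2_norm a b f \<le> M" and g: "g \<in> L2 a b" "l2_norm a b g \<le> M"
  shows "l2_norm a b (\<lambda>x. f x + g x) \<le> 2 * M"
proof -
  have i: "integrable (int_meas a b) (\<lambda>x. (cmod (f x))\<^sup>2)" "integrable (int_meas a b) (\<lambda>x. (cmod (g x))\<^sup>2)"
    "integrable (int_meas a b) (\<lambda>x. (cmod (f x + g x))\<^sup>2)"
    using f g L2_add[OF f(1) g(1)] by (auto simp: L2_def)
  have e: "(LINT x|int_meas a b. (cmod (u x))\<^sup>2) = (l2_norm a b u)\<^sup>2" for u :: "real \<Rightarrow> complex"
    by (simp add: l2_norm_def)
  have "(l2_norm a b (\<lambda>x. f x + g x))\<^sup>2 \<le> (LINT x|int_meas a b. 2 * (cmod (f x))\<^sup>2 + 2 * (cmod (g x))\<^sup>2)"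
    unfolding e[symmetric]
  proof (rule integral_mono)
    fix x
    have "(cmod (f x + g x))\<^sup>2 \<le> (cmod (f x) + cmod (g x))\<^sup>2"
      by (intro power_mono norm_triangle_ineq) auto
    also have "\<dots> \<le> 2 * (cmod (f x))\<^sup>2 + 2 * (cmod (g x))\<^sup>2"
      using sum_squares_bound[of "cmod (f x)" "cmod (g x)"] by (simp add: power2_sum)
    finally show "(cmod (f x + g x))\<^sup>2 \<le> 2 * (cmod (f x))\<^sup>2 + 2 * (cmod (g x))\<^sup>2" .
  qed (use i in auto)
  also have "\<dots> = 2 * (l2_norm a b f)\<^sup>2 + 2 * (l2_norm a b g)\<^sup>2" using i by (simp add: e)
  also have "\<dots> \<le> 2 * M\<^sup>2 + 2 * M\<^sup>2"
    using f g by (intro add_mono mult_left_mono power_mono) (auto simp: l2_norm_nonneg)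
  also have "\<dots> = (2 * M)\<^sup>2" by (simp add: power2_eq_square)
  finally show ?thesis
    by (rule power2_le_imp_le) (use f l2_norm_nonneg[of a b f] in linarith)
qed

lemma l2_norm_le_bound:
  assumes "\<And>x. a < x \<Longrightarrow> x < b \<Longrightarrow> cmod (f x) \<le> B" "f \<in> L2 a b" "0 \<le> B" "a \<le> b" "b \<le> a + 1"
  shows "l2_norm a b f \<le> B"
proof -
  interpret finite_measure "int_meas a b" by (rule finite_measure_int_meas)
  have "(LINT x|int_meas a b. (cmod (f x))\<^sup>2) \<le> (LINT x|int_meas a b. B\<^sup>2)"
    using assms by (intro integral_mono) (auto simp: L2_def intro!: power_mono)
  also have "\<dots> = (b - a) * B\<^sup>2" using assms by (simp add: measure_restrict_space)
  also have "\<dots> \<le> 1 * B\<^sup>2" using assms by (intro mult_right_mono) auto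
  finally have "(LINT x|int_meas a b. (cmod (f x))\<^sup>2) \<le> 1 * B\<^sup>2" .
  from real_sqrt_le_mono[OF this] show ?thesis using assms by (simp add: l2_norm_def)
qed

section \<open>The equations on the three segments\<close>

text \<open>Here \<open>p\<close> stands for \<open>u'\<close>: with resolvent data \<open>(F, g)\<close> and \<open>f = F'\<close>, these are the equations
  \<open>z v - u'' = g\<close> and the derivative of \<open>z u - v = F\<close>.  In \<open>heat_eq\<close>, \<open>q\<close> stands for \<open>w'\<close>.\<close>

definition wave_eq :: "real \<Rightarrow> real \<Rightarrow> complex \<Rightarrow> (real \<Rightarrow> complex) \<Rightarrow> (real \<Rightarrow> complex) \<Rightarrow>
    (real \<Rightarrow> complex) \<Rightarrow> (real \<Rightarrow> complex) \<Rightarrow> bool" where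
  "wave_eq a b z f g p v \<longleftrightarrow> continuous_on {a..b} p \<and> continuous_on {a..b} v \<and>
     has_weak_deriv a b p (\<lambda>x. z * v x - g x) \<and> has_weak_deriv a b v (\<lambda>x. z * p x - f x)"

definition heat_eq :: "real \<Rightarrow> real \<Rightarrow> complex \<Rightarrow> (real \<Rightarrow> complex) \<Rightarrow>
    (real \<Rightarrow> complex) \<Rightarrow> (real \<Rightarrow> complex) \<Rightarrow> bool" where
  "heat_eq a b z h w q \<longleftrightarrow> continuous_on {a..b} w \<and> continuous_on {a..b} q \<and>
     has_weak_deriv a b w q \<and> has_weak_deriv a b q (\<lambda>x. z * w x - h x)"

lemma has_weak_deriv_lincomb:
  assumes "has_weak_deriv a b f f'" "has_weak_deriv a b g g'" "a < b"
  shows "has_weak_deriv a b (\<lambda>x. c * f x + d * g x) (\<lambda>x. c * f' x + d * g' x)"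
  by (intro has_weak_deriv_add has_weak_deriv_scale assms)

text \<open>These are the travelling-wave coordinates, which decouple the system; both come from
  \<open>p + c v\<close>, with \<open>c = 1\<close> and \<open>c = -1\<close>.\<close>

lemma wave_eq_diag:
  assumes w: "wave_eq a b z f g p v" "a < b"
  shows "has_weak_deriv a b (\<lambda>x. p x + v x) (\<lambda>x. z * (p x + v x) + - (f x + g x))"
    and "has_weak_deriv a b (\<lambda>x. p x - v x) (\<lambda>x. (- z) * (p x - v x) + (f x + - g x))"
proof -
  have "has_weak_deriv a b (\<lambda>x. 1 * p x + c * v x) (\<lambda>x. 1 * (z * v x - g x) + c * (z * p x - f x))" for c
    using w by (intro has_weak_deriv_lincomb) (auto simp: wave_eq_def)
  from this[of 1] this[of "-1"]
  show "has_weak_deriv a b (\<lambda>x. p x + v x) (\<lambda>x. z * (p x + v x) + - (f x + g x))"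
    "has_weak_deriv a b (\<lambda>x. p x - v x) (\<lambda>x. (- z) * (p x - v x) + (f x + - g x))"
    by (simp_all add: algebra_simps)
qed

lemma heat_eq_diag:
  assumes w: "heat_eq a b (\<mu>\<^sup>2) h w q" "a < b"
  shows "has_weak_deriv a b (\<lambda>x. q x + \<mu> * w x) (\<lambda>x. \<mu> * (q x + \<mu> * w x) + - h x)"
    and "has_weak_deriv a b (\<lambda>x. q x - \<mu> * w x) (\<lambda>x. (- \<mu>) * (q x - \<mu> * w x) + - h x)"
proof -
  have "has_weak_deriv a b (\<lambda>x. 1 * q x + c * w x) (\<lambda>x. 1 * (\<mu>\<^sup>2 * w x - h x) + c * q x)" for c
    using w by (intro has_weak_deriv_lincomb) (auto simp: heat_eq_def)
  from this[of \<mu>] this[of "-\<mu>"]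
  show "has_weak_deriv a b (\<lambda>x. q x + \<mu> * w x) (\<lambda>x. \<mu> * (q x + \<mu> * w x) + - h x)"
    "has_weak_deriv a b (\<lambda>x. q x - \<mu> * w x) (\<lambda>x. (- \<mu>) * (q x - \<mu> * w x) + - h x)"
    by (simp_all add: algebra_simps power2_eq_square)
qed

lemma exp_i_times:
  fixes s y :: real
  shows "exp (\<i> * complex_of_real s * complex_of_real y) =
      complex_of_real (cos (s * y)) + \<i> * complex_of_real (sin (s * y))"
    and "exp (- (\<i> * complex_of_real s * complex_of_real y)) =
      complex_of_real (cos (s * y)) - \<i> * complex_of_real (sin (s * y))"
proof -
  have "\<i> * complex_of_real s * complex_of_real y = \<i> * complex_of_real (s * y)"
    "- (\<i> * complex_of_real s * complex_of_real y) = \<i> * complex_of_real (- (s * y))" by simp_all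
  then show "exp (\<i> * complex_of_real s * complex_of_real y) =
      complex_of_real (cos (s * y)) + \<i> * complex_of_real (sin (s * y))"
    "exp (- (\<i> * complex_of_real s * complex_of_real y)) =
      complex_of_real (cos (s * y)) - \<i> * complex_of_real (sin (s * y))"
    by (simp_all only: flip: cis_conv_exp) (simp_all add: complex_eq_iff)
qed

text \<open>Returns from the travelling-wave coordinates to \<open>P\<close> and \<open>V\<close>
  without loss in the constant, by taking half the sum and half the difference.\<close>

lemma cmod_half_combine:
  assumes "cmod (P + V - (c + d)) \<le> m" "cmod (P - V - (c - d)) \<le> m"
  shows "cmod (P - c) \<le> m" "cmod (V - d) \<le> m"
proof -
  have "2 * (P - c) = (P + V - (c + d)) + (P - V - (c - d))" by simp
  then have "cmod (2 * (P - c)) \<le> m + m" using norm_triangle_mono[OF assms] by metis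
  then show "cmod (P - c) \<le> m" unfolding norm_mult by simp
  have eq: "2 * (V - d) = (P + V - (c + d)) - (P - V - (c - d))" by simp
  have "cmod (2 * (V - d)) \<le> cmod (P + V - (c + d)) + cmod (P - V - (c - d))"
    unfolding eq by (rule norm_triangle_ineq4)
  then have "cmod (2 * (V - d)) \<le> m + m" using assms by linarith
  then show "cmod (V - d) \<le> m" unfolding norm_mult by simp
qed

context
  fixes a b s M :: real and f g p v :: "real \<Rightarrow> complex"
  assumes w: "wave_eq a b (\<i> * complex_of_real s) f g p v"
    and L: "f \<in> L2 a b" "g \<in> L2 a b" "l2_norm a b f \<le> M" "l2_norm a b g \<le> M"
    and ab: "a < b" "b \<le> a + 1"
begin

lemma wave_eq_data:
  shows "continuous_on {a..b} (\<lambda>x. p x + v x)" "continuous_on {a..b} (\<lambda>x. p x - v x)"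
    and "(\<lambda>x. - (f x + g x)) \<in> L2 a b" "(\<lambda>x. f x + - g x) \<in> L2 a b"
    and "l2_norm a b (\<lambda>x. - (f x + g x)) \<le> 2 * M" "l2_norm a b (\<lambda>x. f x + - g x) \<le> 2 * M"
proof -
  show "continuous_on {a..b} (\<lambda>x. p x + v x)" "continuous_on {a..b} (\<lambda>x. p x - v x)"
    using w by (auto simp: wave_eq_def intro!: continuous_intros)
  show "(\<lambda>x. - (f x + g x)) \<in> L2 a b" "(\<lambda>x. f x + - g x) \<in> L2 a b"
    by (intro L2_uminus L2_add L)+
  show "l2_norm a b (\<lambda>x. - (f x + g x)) \<le> 2 * M"
    unfolding l2_norm_uminus by (intro l2_norm_add_le L)
  show "l2_norm a b (\<lambda>x. f x + - g x) \<le> 2 * M"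
    by (intro l2_norm_add_le L2_uminus L) (use L in \<open>simp add: l2_norm_uminus\<close>)
qed

text \<open>As \<open>v a = 0\<close>, both \<open>p + v\<close> and \<open>p - v\<close> start from
  \<open>p a\<close>. Half the sum of their unimodular propagators is the cosine, half the
  difference is \<open>\<i>\<close> times the sine.\<close>

lemma wave_eq_left:
  assumes v: "v a = 0" and x: "x \<in> {a..b}"
  shows "cmod (p x - complex_of_real (cos (s * (x - a))) * p a) \<le> 2 * M"
    and "cmod (v x - \<i> * complex_of_real (sin (s * (x - a))) * p a) \<le> 2 * M"
proof -
  note d = wave_eq_diag[OF w ab(1)]
  have 1: "cmod (p x + v x - exp (\<i> * complex_of_real s * complex_of_real (x - a)) * (p a + v a)) \<le> 2 * M"
    using weak_ode_bound_forward[OF d(1) wave_eq_data(1,3) ab _ x] wave_eq_data(5) by simp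
  have 2: "cmod (p x - v x - exp (- (\<i> * complex_of_real s * complex_of_real (x - a))) * (p a - v a)) \<le> 2 * M"
    using weak_ode_bound_forward[OF d(2) wave_eq_data(2,4) ab _ x] wave_eq_data(6) by simp
  have "cmod (p x + v x - (complex_of_real (cos (s * (x - a))) * p a + \<i> * complex_of_real (sin (s * (x - a))) * p a)) \<le> 2 * M"
    using 1 by (simp only: exp_i_times v add_0_right diff_0_right distrib_right left_diff_distrib
        diff_minus_eq_add add_uminus_conv_diff)
  moreover have "cmod (p x - v x - (complex_of_real (cos (s * (x - a))) * p a - \<i> * complex_of_real (sin (s * (x - a))) * p a)) \<le> 2 * M"
    using 2 by (simp only: exp_i_times v add_0_right diff_0_right distrib_right left_diff_distrib
        diff_minus_eq_add add_uminus_conv_diff)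
  ultimately show "cmod (p x - complex_of_real (cos (s * (x - a))) * p a) \<le> 2 * M"
    "cmod (v x - \<i> * complex_of_real (sin (s * (x - a))) * p a) \<le> 2 * M"
    by (rule cmod_half_combine)+
qed

text \<open>Propagation backwards from \<open>b\<close> exchanges the two exponentials, whence the
  minus sign in front of the sine.\<close>

lemma wave_eq_right:
  assumes v: "v b = 0" and x: "x \<in> {a..b}"
  shows "cmod (p x - complex_of_real (cos (s * (b - x))) * p b) \<le> 2 * M"
    and "cmod (v x - - (\<i> * complex_of_real (sin (s * (b - x))) * p b)) \<le> 2 * M"
proof -
  note d = wave_eq_diag[OF w ab(1)]
  have 1: "cmod (p x + v x - exp (- (\<i> * complex_of_real s * complex_of_real (b - x))) * (p b + v b)) \<le> 2 * M"
    using weak_ode_bound_backward[OF d(1) wave_eq_data(1,3) ab _ x] wave_eq_data(5) by simp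
  have 2: "cmod (p x - v x - exp (\<i> * complex_of_real s * complex_of_real (b - x)) * (p b - v b)) \<le> 2 * M"
    using weak_ode_bound_backward[OF d(2) wave_eq_data(2,4) ab _ x] wave_eq_data(6) by simp
  have "cmod (p x + v x - (complex_of_real (cos (s * (b - x))) * p b + - (\<i> * complex_of_real (sin (s * (b - x))) * p b))) \<le> 2 * M"
    using 1 by (simp only: exp_i_times v add_0_right diff_0_right distrib_right left_diff_distrib
        diff_minus_eq_add add_uminus_conv_diff)
  moreover have "cmod (p x - v x - (complex_of_real (cos (s * (b - x))) * p b - - (\<i> * complex_of_real (sin (s * (b - x))) * p b))) \<le> 2 * M"
    using 2 by (simp only: exp_i_times v add_0_right diff_0_right distrib_right left_diff_distrib
        diff_minus_eq_add add_uminus_conv_diff)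
  ultimately show "cmod (p x - complex_of_real (cos (s * (b - x))) * p b) \<le> 2 * M"
    "cmod (v x - - (\<i> * complex_of_real (sin (s * (b - x))) * p b)) \<le> 2 * M"
    by (rule cmod_half_combine)+
qed

end

text \<open>\<open>q + \<mu> w\<close> is propagated from \<open>b\<close> and
  \<open>q - \<mu> w\<close> from \<open>a\<close>, so that no growing exponential occurs.\<close>

lemma heat_eq_bounds:
  assumes w: "heat_eq a b (\<mu>\<^sup>2) h w q" and h: "h \<in> L2 a b" "l2_norm a b h \<le> M"
    and ab: "a < b" "b \<le> a + 1" and \<mu>: "0 \<le> Re \<mu>" and x: "x \<in> {a..b}"
  shows "cmod (q x + \<mu> * w x - exp (- (\<mu> * (b - x))) * (q b + \<mu> * w b)) \<le> M"
    and "cmod (q x - \<mu> * w x - exp (- (\<mu> * (x - a))) * (q a - \<mu> * w a)) \<le> M"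
proof -
  note d = heat_eq_diag[OF w ab(1)]
  have c: "continuous_on {a..b} (\<lambda>x. q x + \<mu> * w x)" "continuous_on {a..b} (\<lambda>x. q x - \<mu> * w x)"
    using w by (auto simp: heat_eq_def intro!: continuous_intros)
  show "cmod (q x + \<mu> * w x - exp (- (\<mu> * (b - x))) * (q b + \<mu> * w b)) \<le> M"
    using weak_ode_bound_backward[OF d(1) c(1) L2_uminus[OF h(1)] ab \<mu> x] h(2)
    by (simp add: l2_norm_uminus)
  show "cmod (q x - \<mu> * w x - exp (- (\<mu> * (x - a))) * (q a - \<mu> * w a)) \<le> M"
    using weak_ode_bound_forward[OF d(2) c(2) L2_uminus[OF h(1)] ab _ x] h(2) \<mu>
    by (simp add: l2_norm_uminus)
qed

section \<open>Solving the equations on one segment\<close>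

lemma wave_eq_solution:
  assumes L: "f \<in> L2 a (a + 1)" "g \<in> L2 a (a + 1)"
  shows "\<exists>K1 K2. \<forall>c d. \<exists>p v. wave_eq a (a + 1) (\<i> * complex_of_real s) f g p v \<and> p a = c \<and> v a = d \<and>
    p (a + 1) = complex_of_real (cos s) * c + \<i> * complex_of_real (sin s) * d + K1 \<and> v (a + 1) = \<i> * complex_of_real (sin s) * c + complex_of_real (cos s) * d + K2"
proof -
  let ?z = "\<i> * complex_of_real s" and ?b = "a + 1"
  have ab: "a < a + 1" by simp
  have k: "(\<lambda>x. - (f x + g x)) \<in> L2 a ?b" "(\<lambda>x. f x - g x) \<in> L2 a ?b"
    by (intro L2_uminus L2_add L2_diff L)+
  obtain K where K: "\<forall>c. \<exists>y. continuous_on {a..?b} y \<and>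
      has_weak_deriv a ?b y (\<lambda>x. ?z * y x + - (f x + g x)) \<and> y a = c \<and> y ?b = exp (?z * (?b - a)) * c + K"
    using weak_ode_solution[OF k(1) ab, of ?z] by (elim exE) (rule that)
  obtain K' where K': "\<forall>c. \<exists>y. continuous_on {a..?b} y \<and>
      has_weak_deriv a ?b y (\<lambda>x. - ?z * y x + (f x - g x)) \<and> y a = c \<and> y ?b = exp (- ?z * (?b - a)) * c + K'"
    using weak_ode_solution[OF k(2) ab, of "- ?z"] by (elim exE) (rule that)
  show ?thesis
  \<comment> \<open>The data contribute \<open>K\<close> and \<open>K'\<close> to the end values of
    \<open>p + v\<close> and \<open>p - v\<close>. They are fixed before \<open>c\<close> and
    \<open>d\<close>, so the end values are affine in the initial values.\<close>
  proof (rule exI[of _ "(K + K') / 2"], rule exI[of _ "(K - K') / 2"], intro allI)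
    fix c d
    obtain y where y: "continuous_on {a..?b} y" "has_weak_deriv a ?b y (\<lambda>x. ?z * y x + - (f x + g x))"
      "y a = c + d" "y ?b = exp (?z * (?b - a)) * (c + d) + K" using K by blast
    obtain y' where y': "continuous_on {a..?b} y'" "has_weak_deriv a ?b y' (\<lambda>x. - ?z * y' x + (f x - g x))"
      "y' a = c - d" "y' ?b = exp (- ?z * (?b - a)) * (c - d) + K'" using K' by blast
    \<comment> \<open>The scalar solutions \<open>y\<close> and \<open>y'\<close> play the roles of
      \<open>p + v\<close> and \<open>p - v\<close>; half the sum and half the difference invert
      this change of variables.\<close>
    let ?p = "\<lambda>x. 1/2 * y x + 1/2 * y' x" and ?v = "\<lambda>x. 1/2 * y x + (-1/2) * y' x"
    have e: "y ?b = (complex_of_real (cos s) + \<i> * complex_of_real (sin s)) * (c + d) + K" "y' ?b = (complex_of_real (cos s) - \<i> * complex_of_real (sin s)) * (c - d) + K'"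
      using exp_i_times[of s 1] y(4) y'(4) by simp_all
    show "\<exists>p v. wave_eq a ?b ?z f g p v \<and> p a = c \<and> v a = d \<and>
      p ?b = complex_of_real (cos s) * c + \<i> * complex_of_real (sin s) * d + (K + K') / 2 \<and> v ?b = \<i> * complex_of_real (sin s) * c + complex_of_real (cos s) * d + (K - K') / 2"
    proof (intro exI conjI)
      have "(\<lambda>x. ?z * ?v x - g x) = (\<lambda>x. 1/2 * (?z * y x + - (f x + g x)) + 1/2 * (- ?z * y' x + (f x - g x)))"
        "(\<lambda>x. ?z * ?p x - f x) = (\<lambda>x. 1/2 * (?z * y x + - (f x + g x)) + (-1/2) * (- ?z * y' x + (f x - g x)))"
        by (simp_all add: fun_eq_iff field_simps)
      moreover have "has_weak_deriv a ?b ?p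
          (\<lambda>x. 1/2 * (?z * y x + - (f x + g x)) + 1/2 * (- ?z * y' x + (f x - g x)))"
        "has_weak_deriv a ?b ?v
          (\<lambda>x. 1/2 * (?z * y x + - (f x + g x)) + (-1/2) * (- ?z * y' x + (f x - g x)))"
        by (intro has_weak_deriv_lincomb y y' ab)+
      ultimately have "has_weak_deriv a ?b ?p (\<lambda>x. ?z * ?v x - g x)"
        "has_weak_deriv a ?b ?v (\<lambda>x. ?z * ?p x - f x)"
        by (simp_all only:)
      then show "wave_eq a ?b ?z f g ?p ?v"
        unfolding wave_eq_def by (auto intro!: continuous_intros y y')
    qed (simp_all only: y(3) y'(3) e, simp_all add: field_simps)
  qed
qed

text \<open>The end values are recorded as \<open>q + \<mu> w\<close> and
  \<open>q - \<mu> w\<close>, the coordinates in which the propagator is diagonal. Recovering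
  \<open>w\<close> from them divides by \<open>2 \<mu>\<close>.\<close>

lemma heat_eq_solution:
  assumes h: "h \<in> L2 a (a + 1)" and \<mu>: "\<mu> \<noteq> 0"
  shows "\<exists>K1 K2. \<forall>c d. \<exists>w q. heat_eq a (a + 1) (\<mu>\<^sup>2) h w q \<and> w a = c \<and> q a = d \<and>
    q (a + 1) + \<mu> * w (a + 1) = exp \<mu> * (d + \<mu> * c) + K1 \<and>
    q (a + 1) - \<mu> * w (a + 1) = exp (- \<mu>) * (d - \<mu> * c) + K2"
proof -
  let ?b = "a + 1"
  have ab: "a < a + 1" by simp
  have k: "(\<lambda>x. - h x) \<in> L2 a ?b" by (intro L2_uminus h)
  obtain K where K: "\<forall>c. \<exists>y. continuous_on {a..?b} y \<and>
      has_weak_deriv a ?b y (\<lambda>x. \<mu> * y x + - h x) \<and> y a = c \<and> y ?b = exp (\<mu> * (?b - a)) * c + K"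
    using weak_ode_solution[OF k ab, of \<mu>] by (elim exE) (rule that)
  obtain K' where K': "\<forall>c. \<exists>y. continuous_on {a..?b} y \<and>
      has_weak_deriv a ?b y (\<lambda>x. - \<mu> * y x + - h x) \<and> y a = c \<and> y ?b = exp (- \<mu> * (?b - a)) * c + K'"
    using weak_ode_solution[OF k ab, of "- \<mu>"] by (elim exE) (rule that)
  show ?thesis
  proof (rule exI[of _ "K"], rule exI[of _ "K'"], intro allI)
    fix c d
    obtain y where y: "continuous_on {a..?b} y" "has_weak_deriv a ?b y (\<lambda>x. \<mu> * y x + - h x)"
      "y a = d + \<mu> * c" "y ?b = exp (\<mu> * (?b - a)) * (d + \<mu> * c) + K" using K by blast
    obtain y' where y': "continuous_on {a..?b} y'" "has_weak_deriv a ?b y' (\<lambda>x. - \<mu> * y' x + - h x)"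
      "y' a = d - \<mu> * c" "y' ?b = exp (- \<mu> * (?b - a)) * (d - \<mu> * c) + K'" using K' by blast
    have e: "y ?b = exp \<mu> * (d + \<mu> * c) + K" "y' ?b = exp (- \<mu>) * (d - \<mu> * c) + K'"
      using y(4) y'(4) by simp_all
    let ?q = "\<lambda>x. 1/2 * y x + 1/2 * y' x" and ?w = "\<lambda>x. 1/(2 * \<mu>) * y x + (-1/(2 * \<mu>)) * y' x"
    show "\<exists>w q. heat_eq a ?b (\<mu>\<^sup>2) h w q \<and> w a = c \<and> q a = d \<and>
      q ?b + \<mu> * w ?b = exp \<mu> * (d + \<mu> * c) + K \<and> q ?b - \<mu> * w ?b = exp (- \<mu>) * (d - \<mu> * c) + K'"
    proof (intro exI conjI)
      have "?q = (\<lambda>x. 1/(2 * \<mu>) * (\<mu> * y x + - h x) + (-1/(2 * \<mu>)) * (- \<mu> * y' x + - h x))"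
        "(\<lambda>x. \<mu>\<^sup>2 * ?w x - h x) = (\<lambda>x. 1/2 * (\<mu> * y x + - h x) + 1/2 * (- \<mu> * y' x + - h x))"
        using \<mu> by (simp_all add: fun_eq_iff field_simps power2_eq_square)
      moreover have "has_weak_deriv a ?b ?w
          (\<lambda>x. 1/(2 * \<mu>) * (\<mu> * y x + - h x) + (-1/(2 * \<mu>)) * (- \<mu> * y' x + - h x))"
        "has_weak_deriv a ?b ?q (\<lambda>x. 1/2 * (\<mu> * y x + - h x) + 1/2 * (- \<mu> * y' x + - h x))"
        by (intro has_weak_deriv_lincomb y y' ab)+
      ultimately have "has_weak_deriv a ?b ?w ?q" "has_weak_deriv a ?b ?q (\<lambda>x. \<mu>\<^sup>2 * ?w x - h x)"
        by (simp_all only:)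
      then show "heat_eq a ?b (\<mu>\<^sup>2) h ?w ?q"
        unfolding heat_eq_def by (auto intro!: continuous_intros y y' simp: \<mu>)
    qed (use \<mu> in \<open>simp_all only: y(3) y'(3) e, simp_all add: field_simps\<close>)
  qed
qed

section \<open>The coupled boundary value problem\<close>

context
  fixes s :: real and \<mu> :: complex
  assumes \<mu>: "\<mu>\<^sup>2 = \<i> * complex_of_real s" "40 \<le> Re \<mu>"
begin

lemma Im_root: "(Im \<mu>)\<^sup>2 = (Re \<mu>)\<^sup>2"
  using arg_cong[OF \<mu>(1), of Re] by (simp add: power2_eq_square)

lemma cmod_root_ge: "1 \<le> cmod \<mu>"
  using complex_Re_le_cmod[of \<mu>] \<mu>(2) by linarith

text \<open>With \<open>k = Re \<mu> \<ge> 40\<close> the Taylor bound gives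
  \<open>exp k \<ge> k^2 / 2 \<ge> 20 k\<close>, while \<open>8 |\<mu>| \<le> 16 k\<close>. The
  second claim is the first divided by \<open>4 exp k\<close>.\<close>

lemma exp_root: "8 * cmod \<mu> \<le> exp (Re \<mu>)" "cmod (exp (- \<mu>)) * (2 * cmod \<mu>) \<le> 1 / 4"
proof -
  let ?k = "Re \<mu>"
  have "cmod \<mu> \<le> 2 * ?k"
  proof (rule power2_le_imp_le)
    show "(cmod \<mu>)\<^sup>2 \<le> (2 * ?k)\<^sup>2" by (simp add: cmod_power2 Im_root)
  qed (use \<mu> in simp)
  moreover have "40 * ?k \<le> ?k\<^sup>2" using \<mu>(2) by (simp add: power2_eq_square mult_right_mono)
  moreover have "1 + ?k + ?k\<^sup>2 / 2 \<le> exp ?k" using \<mu>(2) by (intro exp_lower_Taylor_quadratic) simp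
  ultimately show "8 * cmod \<mu> \<le> exp ?k" using \<mu>(2) by linarith
  then show "cmod (exp (- \<mu>)) * (2 * cmod \<mu>) \<le> 1 / 4"
    unfolding norm_exp_eq_Re uminus_complex.sel by (simp add: exp_minus field_simps)
qed

text \<open>\<open>D\<close> and \<open>E\<close> are the values of \<open>p + \<mu> v\<close> and
  \<open>p - \<mu> v\<close> at 1 for the homogeneous wave on \<open>[0,1]\<close> with
  \<open>p 0 = 1\<close> and \<open>v 0 = 0\<close>. On \<open>[2,3]\<close>, started from 3, the
  velocity changes sign and the two exchange roles.\<close>

context
  fixes D E :: complex
  assumes D_def: "D = cos s + \<i> * sin s * \<mu>"
    and E_def: "E = cos s - \<i> * sin s * \<mu>"
begin

text \<open>With \<open>\<mu> = k \<plusminus> i k\<close> the square of \<open>|D|\<close> is \<open>(cos s \<mp> k sin s)\<^sup>2 + (k sin s)\<^sup>2\<close>.\<close>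

lemma D_lower: "1 / 2 \<le> cmod D"
proof (rule power2_le_imp_le)
  define k y c S where "k = Re \<mu>" and "y = Im \<mu>" and "c = cos s" and "S = sin s"
  have cS: "c\<^sup>2 + S\<^sup>2 = 1" by (simp add: c_def S_def)
  have yk: "y\<^sup>2 = k\<^sup>2" using Im_root by (simp add: k_def y_def)
  have "(cmod D)\<^sup>2 = (c - S * y)\<^sup>2 + (S * k)\<^sup>2"
    by (simp add: cmod_power2 D_def k_def y_def c_def S_def)
  also have "\<dots> = c\<^sup>2 - 2 * (c * (S * y)) + 2 * (S\<^sup>2 * k\<^sup>2)"
    by (simp add: power2_diff power_mult_distrib yk)
  finally have 1: "(cmod D)\<^sup>2 = c\<^sup>2 - 2 * (c * (S * y)) + 2 * (S\<^sup>2 * k\<^sup>2)" .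
  \<comment> \<open>This square gives \<open>2 c S y \<le> 3/4 c^2 + 4/3 S^2 k^2\<close>, so at
    least \<open>c^2 / 4 + 2/3 S^2 k^2\<close> of \<open>|D|^2\<close> remains; as
    \<open>k \<ge> 1\<close>, this is at least \<open>(c^2 + S^2) / 4\<close>.\<close>
  have "0 \<le> (3 * c - 4 * (S * y))\<^sup>2" by simp
  also have "\<dots> = 9 * c\<^sup>2 - 24 * (c * (S * y)) + 16 * (S\<^sup>2 * k\<^sup>2)"
    by (simp add: power2_diff power_mult_distrib yk)
  finally have 2: "24 * (c * (S * y)) \<le> 9 * c\<^sup>2 + 16 * (S\<^sup>2 * k\<^sup>2)" by simp
  have "1\<^sup>2 \<le> k\<^sup>2" using \<mu>(2) by (intro power_mono) (auto simp: k_def)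
  then have "S\<^sup>2 * 1 \<le> S\<^sup>2 * k\<^sup>2" by (intro mult_left_mono) auto
  \<comment> \<open>The products are abstracted to variables, which makes the claim linear.\<close>
  moreover have "1 / 4 \<le> d" if "d = C - 2 * X + 2 * Y" "24 * X \<le> 9 * C + 16 * Y" "C + T = 1" "T * 1 \<le> Y" "0 \<le> T"
    for C X Y T d :: real using that by linarith
  ultimately have "1 / 4 \<le> (cmod D)\<^sup>2" using 1 2 cS zero_le_power2 by blast
  then show "(1 / 2)\<^sup>2 \<le> (cmod D)\<^sup>2" by (simp add: power2_eq_square)
qed simp

lemma E_upper: "cmod E \<le> 2 * cmod \<mu>"
proof -
  have "cmod E \<le> cmod (complex_of_real (cos s)) + cmod (\<i> * sin s * \<mu>)"
    unfolding E_def by (rule norm_triangle_ineq4)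
  also have "\<dots> \<le> 1 + 1 * cmod \<mu>"
    by (intro add_mono) (auto simp: norm_mult intro!: mult_left_le_one_le)
  finally show ?thesis using cmod_root_ge by linarith
qed

text \<open>Adding this bound to its mirror image absorbs the term in \<open>\<beta>\<close>.\<close>

lemma coupling_bound_step:
  fixes p1 v1 p2 v2 \<alpha> \<beta> :: complex
  assumes M: "0 \<le> M"
    and "cmod (p1 - cos s * \<alpha>) \<le> 2 * M" "cmod (v1 - \<i> * sin s * \<alpha>) \<le> 2 * M"
    and "cmod (p2 - cos s * \<beta>) \<le> 2 * M" "cmod (v2 + \<i> * sin s * \<beta>) \<le> 2 * M"
    and "cmod ((p1 + \<mu> * v1) - exp (- \<mu>) * (p2 + \<mu> * v2)) \<le> M"
  shows "cmod \<alpha> / 2 \<le> cmod \<beta> / 4 + 9 * (cmod \<mu> * M)"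
    and "cmod (p2 + \<mu> * v2 - E * \<beta>) \<le> 4 * (cmod \<mu> * M)"
proof -
  let ?L = "cmod \<mu>" and ?e = "cmod (exp (- \<mu>))"
  have LM: "M \<le> ?L * M" using mult_right_mono[OF cmod_root_ge M] by simp
  have tri: "cmod (a + \<mu> * b) \<le> 4 * (?L * M)" if "cmod a \<le> 2 * M" "cmod b \<le> 2 * M" for a b
  proof -
    have "cmod (a + \<mu> * b) \<le> cmod a + ?L * cmod b" by (metis norm_triangle_ineq norm_mult)
    also have "\<dots> \<le> 2 * M + ?L * (2 * M)" using that by (intro add_mono mult_left_mono) auto
    finally show ?thesis using LM by simp
  qed
  have 1: "cmod (p1 + \<mu> * v1 - D * \<alpha>) \<le> 4 * (?L * M)"
    using tri[OF assms(2,3)] by (simp add: D_def algebra_simps)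
  show 2: "cmod (p2 + \<mu> * v2 - E * \<beta>) \<le> 4 * (?L * M)"
    using tri[OF assms(4,5)] by (simp add: E_def algebra_simps)
  \<comment> \<open>Four contributions: the defect on the heat segment, the error on the first wave
    segment, the damped error on the second one, and the coupling to \<open>\<beta>\<close>.\<close>
  have "D * \<alpha> = (p1 + \<mu> * v1 - exp (- \<mu>) * (p2 + \<mu> * v2)) - (p1 + \<mu> * v1 - D * \<alpha>)
      + exp (- \<mu>) * (p2 + \<mu> * v2 - E * \<beta>) + exp (- \<mu>) * E * \<beta>"
    by (simp add: algebra_simps)
  also have "cmod \<dots> \<le> cmod (p1 + \<mu> * v1 - exp (- \<mu>) * (p2 + \<mu> * v2)) + cmod (p1 + \<mu> * v1 - D * \<alpha>)
      + ?e * cmod (p2 + \<mu> * v2 - E * \<beta>) + ?e * cmod E * cmod \<beta>"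
    by (intro norm_triangle_mono norm_triangle_le_diff) (auto simp: norm_mult)
  also have "\<dots> \<le> M + 4 * (?L * M) + 1 * (4 * (?L * M)) + 1/4 * cmod \<beta>"
  proof (intro add_mono mult_mono mult_right_mono assms 1 2)
    show "?e \<le> 1" using \<mu>(2) by (simp add: norm_exp_eq_Re)
    have "?e * cmod E \<le> ?e * (2 * ?L)" by (intro mult_left_mono E_upper) simp
    then show "?e * cmod E \<le> 1 / 4" using exp_root(2) by linarith
  qed auto
  \<comment> \<open>Here \<open>9 = 1 + 4 + 4\<close>, after estimating \<open>M\<close> by
    \<open>|\<mu>| M\<close>.\<close>
  finally have "cmod D * cmod \<alpha> \<le> cmod \<beta> / 4 + 9 * (?L * M)" using LM unfolding norm_mult by linarith
  moreover have "1 / 2 * cmod \<alpha> \<le> cmod D * cmod \<alpha>" using D_lower by (intro mult_right_mono) auto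
  ultimately show "cmod \<alpha> / 2 \<le> cmod \<beta> / 4 + 9 * (?L * M)" by linarith
qed

end

end

context
  fixes s M :: real and \<mu> :: complex and f1 g1 h f2 g2 p1 v1 w q p2 v2 :: "real \<Rightarrow> complex"
  assumes \<mu>: "\<mu>\<^sup>2 = \<i> * complex_of_real s" "40 \<le> Re \<mu>"
    and eqs: "wave_eq 0 1 (\<i> * complex_of_real s) f1 g1 p1 v1" "heat_eq 1 2 (\<i> * complex_of_real s) h w q"
      "wave_eq 2 3 (\<i> * complex_of_real s) f2 g2 p2 v2"
    and bc: "v1 0 = 0" "p1 1 = q 1" "v1 1 = w 1" "p2 2 = q 2" "v2 2 = w 2" "v2 3 = 0"
    and L: "f1 \<in> L2 0 1" "g1 \<in> L2 0 1" "h \<in> L2 1 2" "f2 \<in> L2 2 3" "g2 \<in> L2 2 3"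
    and M: "l2_norm 0 1 f1 \<le> M" "l2_norm 0 1 g1 \<le> M" "l2_norm 1 2 h \<le> M"
      "l2_norm 2 3 f2 \<le> M" "l2_norm 2 3 g2 \<le> M"
begin

text \<open>On the heat segment \<open>q + \<mu> w\<close> and \<open>q - \<mu> w\<close> are only
  of order \<open>|\<mu>|^2 M\<close>, but isolating \<open>w\<close> divides by
  \<open>\<mu>\<close> and brings back the order \<open>|\<mu>| M\<close>. The constant
  \<open>149 = 4 + 2 * 72 + 1\<close> is the one needed there; the wave segments need less.\<close>

lemma coupled_bounds:
  shows "x \<in> {0..1} \<Longrightarrow> cmod (p1 x) \<le> 149 * (cmod \<mu> * M)"
    and "x \<in> {0..1} \<Longrightarrow> cmod (v1 x) \<le> 149 * (cmod \<mu> * M)"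
    and "x \<in> {1..2} \<Longrightarrow> cmod (w x) \<le> 149 * (cmod \<mu> * M)"
    and "x \<in> {2..3} \<Longrightarrow> cmod (p2 x) \<le> 149 * (cmod \<mu> * M)"
    and "x \<in> {2..3} \<Longrightarrow> cmod (v2 x) \<le> 149 * (cmod \<mu> * M)"
proof -
  let ?L = "cmod \<mu>"
  let ?E = "cos s - \<i> * sin s * \<mu>"
  have M0: "0 \<le> M" by (rule order_trans[OF l2_norm_nonneg M(1)])
  have L1: "1 \<le> ?L" by (rule cmod_root_ge[OF \<mu>])
  have LM: "M \<le> ?L * M" using mult_right_mono[OF L1 M0] by simp
  note left = wave_eq_left[OF eqs(1) L(1,2) M(1,2) _ _ bc(1), simplified]
  note right = wave_eq_right[OF eqs(3) L(4,5) M(4,5) _ _ bc(6), simplified]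
  note heat = heat_eq_bounds[OF eqs(2)[folded \<mu>(1)] L(3) M(3), simplified]
  let ?\<alpha> = "p1 0" and ?\<beta> = "p2 3"
  have k: "0 \<le> Re \<mu>" using \<mu>(2) by simp
  have a: "cmod (q 1 - cos s * ?\<alpha>) \<le> 2 * M" "cmod (w 1 - \<i> * sin s * ?\<alpha>) \<le> 2 * M"
    using left[of 1] bc by simp_all
  have b: "cmod (q 2 - cos s * ?\<beta>) \<le> 2 * M" "cmod (w 2 + \<i> * sin s * ?\<beta>) \<le> 2 * M"
    using right[of 2] bc by simp_all
  have c: "cmod ((q 1 + \<mu> * w 1) - exp (- \<mu>) * (q 2 + \<mu> * w 2)) \<le> M"
    "cmod ((q 2 - \<mu> * w 2) - exp (- \<mu>) * (q 1 - \<mu> * w 1)) \<le> M"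
    using heat(1)[of 1] heat(2)[of 2] k by simp_all
  note s1 = coupling_bound_step[OF \<mu> refl refl M0 a b c(1)]
  have a': "cmod (- w 1 + \<i> * sin s * ?\<alpha>) \<le> 2 * M" and b': "cmod (- w 2 - \<i> * sin s * ?\<beta>) \<le> 2 * M"
    using a(2) b(2) norm_minus_cancel[of "w 1 - \<i> * sin s * ?\<alpha>"] norm_minus_cancel[of "w 2 + \<i> * sin s * ?\<beta>"]
    by simp_all
  \<comment> \<open>The reflection of \<open>[0,3]\<close> at its midpoint maps one wave segment to the other, up to the sign
    of the velocities.\<close>
  have s2: "cmod ?\<beta> / 2 \<le> cmod ?\<alpha> / 4 + 9 * (?L * M)"
    "cmod (q 1 - \<mu> * w 1 - ?E * ?\<alpha>) \<le> 4 * (?L * M)"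
    using coupling_bound_step[OF \<mu> refl refl M0 b(1) b' a(1) a'] c(2) by simp_all
  \<comment> \<open>Adding \<open>s1(1)\<close> and \<open>s2(1)\<close> gives
    \<open>(|\<alpha>| + |\<beta>|) / 4 \<le> 18 |\<mu>| M\<close>.\<close>
  have \<alpha>\<beta>: "cmod ?\<alpha> \<le> 72 * (?L * M)" "cmod ?\<beta> \<le> 72 * (?L * M)"
    using s1(1) s2(1) norm_ge_zero[of ?\<alpha>] norm_ge_zero[of ?\<beta>] by linarith+
  have trig: "cmod y \<le> 149 * (?L * M)"
    if "cmod (y - c * \<gamma>) \<le> 2 * M" "cmod c \<le> 1" "cmod \<gamma> \<le> 72 * (?L * M)" for y c \<gamma>
  proof -
    have "cmod y \<le> cmod (y - c * \<gamma>) + cmod (c * \<gamma>)" using norm_triangle_sub[of y "c * \<gamma>"] by simp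
    also have "cmod (c * \<gamma>) \<le> 1 * (72 * (?L * M))"
      unfolding norm_mult using that by (intro mult_mono) auto
    finally show ?thesis using that(1) LM M0 by linarith
  qed
  show "cmod (p1 x) \<le> 149 * (?L * M)" "cmod (v1 x) \<le> 149 * (?L * M)" if "x \<in> {0..1}"
    using left[of x] that \<alpha>\<beta>(1)
    by (auto intro!: trig[of "p1 x" "cos (s * x)" ?\<alpha>] trig[of "v1 x" "\<i> * sin (s * x)" ?\<alpha>] simp: norm_mult)
  show "cmod (p2 x) \<le> 149 * (?L * M)" "cmod (v2 x) \<le> 149 * (?L * M)" if "x \<in> {2..3}"
    using right[of x] that \<alpha>\<beta>(2)
    by (auto intro!: trig[of "p2 x" "cos (s * (3 - x))" ?\<beta>]
        trig[of "v2 x" "- \<i> * sin (s * (3 - x))" ?\<beta>] simp: norm_mult)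
  show "cmod (w x) \<le> 149 * (?L * M)" if x: "x \<in> {1..2}"
  proof -
    \<comment> \<open>The values entering the decaying propagators are close to
      \<open>E \<beta>\<close> at 2 and to \<open>E \<alpha>\<close> at 1; the bound
      \<open>|E| \<le> 2 |\<mu>|\<close> costs the second power of \<open>|\<mu>|\<close>.\<close>
    have end_bound: "cmod y \<le> 148 * (?L * (?L * M))"
      if "cmod (y - ?E * \<gamma>) \<le> 4 * (?L * M)" "cmod \<gamma> \<le> 72 * (?L * M)" for y \<gamma>
    proof -
      have "cmod y \<le> cmod (y - ?E * \<gamma>) + cmod (?E * \<gamma>)" using norm_triangle_sub[of y "?E * \<gamma>"] by simp
      also have "cmod (?E * \<gamma>) \<le> (2 * ?L) * (72 * (?L * M))"
        unfolding norm_mult using that E_upper[OF \<mu> refl refl] by (intro mult_mono) auto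
      finally have "cmod y \<le> 4 * (?L * M) + 144 * (?L * (?L * M))" using that(1) by simp
      moreover have "?L * M \<le> ?L * (?L * M)" using LM by (intro mult_left_mono) auto
      ultimately show ?thesis by linarith
    qed
    have inner_bound: "cmod y \<le> 149 * (?L * (?L * M))"
      if "cmod (y - exp (- (\<mu> * complex_of_real t)) * \<gamma>) \<le> M" "0 \<le> t" "cmod \<gamma> \<le> 148 * (?L * (?L * M))" for y t \<gamma>
    proof -
      let ?e = "exp (- (\<mu> * complex_of_real t))"
      have "cmod y \<le> cmod (y - ?e * \<gamma>) + cmod (?e * \<gamma>)" using norm_triangle_sub[of y "?e * \<gamma>"] by simp
      also have "cmod (?e * \<gamma>) \<le> 1 * (148 * (?L * (?L * M)))"
        unfolding norm_mult using that k by (intro mult_mono) (auto simp: norm_exp_eq_Re)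
      finally have "cmod y \<le> M + 148 * (?L * (?L * M))" using that(1) by simp
      moreover have "?L * M \<le> ?L * (?L * M)" using LM by (intro mult_left_mono) auto
      ultimately show ?thesis using LM by linarith
    qed
    have r: "cmod (q x + \<mu> * w x) \<le> 149 * (?L * (?L * M))"
      using inner_bound[of "q x + \<mu> * w x" "2 - x"] heat(1)[of x] k x end_bound[OF s1(2) \<alpha>\<beta>(2)] by simp
    have t: "cmod (q x - \<mu> * w x) \<le> 149 * (?L * (?L * M))"
      using inner_bound[of "q x - \<mu> * w x" "x - 1"] heat(2)[of x] k x end_bound[OF s2(2) \<alpha>\<beta>(1)] by simp
    have eq: "2 * \<mu> * w x = (q x + \<mu> * w x) - (q x - \<mu> * w x)" by simp
    have "cmod (2 * \<mu> * w x) \<le> cmod (q x + \<mu> * w x) + cmod (q x - \<mu> * w x)"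
      unfolding eq by (rule norm_triangle_ineq4)
    then have "cmod (2 * \<mu> * w x) \<le> 149 * (?L * (?L * M)) + 149 * (?L * (?L * M))"
      using r t by linarith
    then have "?L * cmod (w x) \<le> ?L * (149 * (?L * M))" by (simp add: norm_mult ac_simps)
    then show ?thesis by (rule mult_left_le_imp_le) (use L1 in linarith)
  qed
qed

end

text \<open>Shooting from \<open>\<alpha> = p1 0\<close>: the velocity at the far end is affine in \<open>\<alpha>\<close>, with slope
  \<open>\<Delta> / (2 \<mu>)\<close>.\<close>

lemma coupled_solution:
  assumes \<mu>: "\<mu>\<^sup>2 = \<i> * complex_of_real s" "40 \<le> Re \<mu>"
    and L: "f1 \<in> L2 0 1" "g1 \<in> L2 0 1" "h \<in> L2 1 2" "f2 \<in> L2 2 3" "g2 \<in> L2 2 3"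
  obtains p1 v1 w q p2 v2 where
    "wave_eq 0 1 (\<i> * complex_of_real s) f1 g1 p1 v1" "heat_eq 1 2 (\<i> * complex_of_real s) h w q"
    "wave_eq 2 3 (\<i> * complex_of_real s) f2 g2 p2 v2"
    "v1 0 = 0" "p1 1 = q 1" "v1 1 = w 1" "p2 2 = q 2" "v2 2 = w 2" "v2 3 = 0"
proof -
  let ?z = "\<i> * complex_of_real s"
  have two_plus_one: "(2::real) + 1 = 3" by simp
  have \<mu>0: "\<mu> \<noteq> 0" using \<mu>(2) by auto
  define c S where "c = complex_of_real (cos s)" and "S = \<i> * complex_of_real (sin s)"
  define D E where "D = c + S * \<mu>" and "E = c - S * \<mu>"
  obtain K1 K2 where left: "\<forall>u v. \<exists>p1 v1. wave_eq 0 1 ?z f1 g1 p1 v1 \<and> p1 0 = u \<and> v1 0 = v \<and>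
      p1 1 = c * u + S * v + K1 \<and> v1 1 = S * u + c * v + K2"
    using wave_eq_solution[of f1 0 g1 s, unfolded add_0, OF L(1,2), folded c_def S_def]
    by (elim exE) (rule that)
  obtain K3 K4 where heat: "\<forall>u v. \<exists>w q. heat_eq 1 2 ?z h w q \<and> w 1 = u \<and> q 1 = v \<and>
      q 2 + \<mu> * w 2 = exp \<mu> * (v + \<mu> * u) + K3 \<and> q 2 - \<mu> * w 2 = exp (- \<mu>) * (v - \<mu> * u) + K4"
    using heat_eq_solution[of h 1 \<mu>, unfolded one_add_one \<mu>(1), OF L(3) \<mu>0]
    by (elim exE) (rule that)
  obtain K5 K6 where right: "\<forall>u v. \<exists>p2 v2. wave_eq 2 3 ?z f2 g2 p2 v2 \<and> p2 2 = u \<and> v2 2 = v \<and>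
      p2 3 = c * u + S * v + K5 \<and> v2 3 = S * u + c * v + K6"
    using wave_eq_solution[of f2 2 g2 s, unfolded two_plus_one, OF L(4,5), folded c_def S_def]
    by (elim exE) (rule that)
  \<comment> \<open>For zero data the diagonal coordinates at 1 are \<open>D \<alpha>\<close> and
    \<open>E \<alpha>\<close>. The heat segment multiplies them by \<open>exp \<mu>\<close> and
    \<open>exp (- \<mu>)\<close>, and the right wave segment combines them with weights
    \<open>D\<close> and \<open>- E\<close> into \<open>2 \<mu> v2 3\<close>.\<close>
  define \<Delta> where "\<Delta> = exp \<mu> * D\<^sup>2 - exp (- \<mu>) * E\<^sup>2"
  have "\<Delta> \<noteq> 0"
  proof
    assume "\<Delta> = 0"
    then have "exp \<mu> * D\<^sup>2 = exp (- \<mu>) * E\<^sup>2" by (simp add: \<Delta>_def)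
    from arg_cong[OF this, of cmod]
    have eq: "cmod (exp \<mu>) * (cmod D)\<^sup>2 = (cmod (exp (- \<mu>)) * cmod E) * cmod E"
      by (simp only: norm_mult norm_power power2_eq_square mult.assoc)
    have D: "1/2 \<le> cmod D" and E: "cmod E \<le> 2 * cmod \<mu>"
      using D_lower[OF \<mu> refl refl] E_upper[OF \<mu> refl refl] by (simp_all add: D_def E_def c_def S_def)
    \<comment> \<open>The first term of \<open>\<Delta>\<close> has modulus at least
      \<open>2 |\<mu>|\<close>, the second at most \<open>|\<mu>| / 2\<close>, so they cannot
      cancel.\<close>
    have "8 * cmod \<mu> * (1/2)\<^sup>2 \<le> cmod (exp \<mu>) * (cmod D)\<^sup>2"
      using exp_root(1)[OF \<mu>] D
      by (intro mult_mono power_mono) (auto simp: norm_exp_eq_Re)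
    also have "\<dots> \<le> (cmod (exp (- \<mu>)) * (2 * cmod \<mu>)) * (2 * cmod \<mu>)"
      unfolding eq by (intro mult_mono E) auto
    also have "\<dots> \<le> 1/4 * (2 * cmod \<mu>)"
      using exp_root(2)[OF \<mu>] by (intro mult_right_mono) auto
    finally show False using cmod_root_ge[OF \<mu>] by (simp add: power2_eq_square)
  qed
  define \<alpha> where "\<alpha> = - (D * (exp \<mu> * (K1 + \<mu> * K2) + K3) - E * (exp (- \<mu>) * (K1 - \<mu> * K2) + K4) + 2 * \<mu> * K6) / \<Delta>"
  have \<alpha>: "\<Delta> * \<alpha> = - (D * (exp \<mu> * (K1 + \<mu> * K2) + K3) - E * (exp (- \<mu>) * (K1 - \<mu> * K2) + K4) + 2 * \<mu> * K6)"
    using \<open>\<Delta> \<noteq> 0\<close> by (simp add: \<alpha>_def)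
  obtain p1 v1 where 1: "wave_eq 0 1 ?z f1 g1 p1 v1" "v1 0 = 0"
    "p1 1 = c * \<alpha> + K1" "v1 1 = S * \<alpha> + K2"
    using left[rule_format, of \<alpha> 0] by auto
  obtain w q where 2: "heat_eq 1 2 ?z h w q" "w 1 = v1 1" "q 1 = p1 1"
    "q 2 + \<mu> * w 2 = exp \<mu> * (p1 1 + \<mu> * v1 1) + K3" "q 2 - \<mu> * w 2 = exp (- \<mu>) * (p1 1 - \<mu> * v1 1) + K4"
    using heat[rule_format, of "v1 1" "p1 1"] by auto
  obtain p2 v2 where 3: "wave_eq 2 3 ?z f2 g2 p2 v2" "p2 2 = q 2" "v2 2 = w 2"
    "v2 3 = S * q 2 + c * w 2 + K6"
    using right[rule_format, of "q 2" "w 2"] by auto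
  have "2 * \<mu> * v2 3 = D * (q 2 + \<mu> * w 2) - E * (q 2 - \<mu> * w 2) + 2 * \<mu> * K6"
    by (simp add: 3(4) D_def E_def algebra_simps)
  also have "\<dots> = D * (exp \<mu> * (D * \<alpha> + (K1 + \<mu> * K2)) + K3) -
      E * (exp (- \<mu>) * (E * \<alpha> + (K1 - \<mu> * K2)) + K4) + 2 * \<mu> * K6"
    by (simp add: 2(4,5) 1(3,4)) (simp add: D_def E_def algebra_simps)
  also have "\<dots> = \<Delta> * \<alpha> + (D * (exp \<mu> * (K1 + \<mu> * K2) + K3) - E * (exp (- \<mu>) * (K1 - \<mu> * K2) + K4) + 2 * \<mu> * K6)"
    by (simp add: \<Delta>_def algebra_simps power2_eq_square)
  also have "\<dots> = 0" unfolding \<alpha> by simp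
  finally have "v2 3 = 0" using \<mu>0 by simp
  then show ?thesis
    using that[OF 1(1) 2(1) 3(1) 1(2) 2(3)[symmetric] 2(2)[symmetric] 3(2,3)] by simp
qed

section \<open>The resolvent\<close>

lemma weak_deriv_ae_eq:
  assumes "has_weak_deriv a b f g" "a < b"
  shows "ae_eq a b (weak_deriv a b f) g"
  using assms by (intro has_weak_deriv_unique[OF weak_deriv_works]) (auto simp: H1_iff)

lemma has_weak_deriv_cong_right:
  assumes "has_weak_deriv a b f g" "ae_eq a b g g'" "g' \<in> L2 a b" "a < b"
  shows "has_weak_deriv a b f g'"
  using has_weak_deriv_cong[OF assms(1) ae_eq_refl assms(2) _ assms(3,4)] assms(1)
  by (simp add: has_weak_deriv_def)

text \<open>Passes to continuous representatives, for which boundary values are ordinary values.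
  Differentiating \<open>z u - v\<close> removes \<open>u\<close> itself and leaves a system in
  \<open>u'\<close> and \<open>v\<close>.\<close>

lemma wave_eq_of_domain:
  assumes u: "u \<in> H2 a b" and v: "v \<in> H1 a b" and ab: "a < b"
  obtains p V where
    "wave_eq a b z (weak_deriv a b (\<lambda>x. z * u x + - 1 * v x))
      (\<lambda>x. z * v x + - 1 * weak_deriv a b (weak_deriv a b u) x) p V"
    "continuous_on {a..b} p" "continuous_on {a..b} V"
    "ae_eq a b (weak_deriv a b u) p" "ae_eq a b v V"
proof -
  let ?f = "weak_deriv a b (\<lambda>x. z * u x + - 1 * v x)"
  let ?g = "\<lambda>x. z * v x + - 1 * weak_deriv a b (weak_deriv a b u) x"
  have H: "u \<in> H1 a b" "weak_deriv a b u \<in> H1 a b" using u by (auto simp: H2_def)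
  have f: "(\<lambda>x. z * u x + - 1 * v x) \<in> H1 a b" by (intro H1_add H1_scale H v ab)
  obtain p where p: "continuous_on {a..b} p" "ae_eq a b (weak_deriv a b u) p"
    "has_weak_deriv a b p (weak_deriv a b (weak_deriv a b u))"
    using continuous_representative[OF weak_deriv_works[OF H(2)] ab] .
  obtain V where V: "continuous_on {a..b} V" "ae_eq a b v V" "has_weak_deriv a b V (weak_deriv a b v)"
    using continuous_representative[OF weak_deriv_works[OF v] ab] .
  have "ae_eq a b ?f (\<lambda>x. z * weak_deriv a b u x + - 1 * weak_deriv a b v x)"
    by (intro weak_deriv_ae_eq has_weak_deriv_add has_weak_deriv_scale weak_deriv_works H v ab)
  then have 1: "ae_eq a b (weak_deriv a b v) (\<lambda>x. z * p x - ?f x)"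
    using p(2) unfolding ae_eq_def by eventually_elim simp
  have 2: "ae_eq a b (weak_deriv a b (weak_deriv a b u)) (\<lambda>x. z * V x - ?g x)"
    using V(2) unfolding ae_eq_def by eventually_elim simp
  have L: "(\<lambda>x. z * p x - ?f x) \<in> L2 a b" "(\<lambda>x. z * V x - ?g x) \<in> L2 a b"
    by (intro L2_diff L2_scale L2_add weak_deriv_L2 L2_continuous H1_L2[OF v] p V H f)+
  show ?thesis
    by (rule that[OF _ p(1) V(1) p(2) V(2)])
       (use has_weak_deriv_cong_right[OF V(3) 1 L(1) ab] has_weak_deriv_cong_right[OF p(3) 2 L(2) ab] p V
        in \<open>simp only: wave_eq_def simp_thms\<close>)
qed

lemma heat_eq_of_domain:
  assumes w: "w \<in> H2 a b" and ab: "a < b"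
  obtains W q where
    "heat_eq a b z (\<lambda>x. z * w x + - 1 * weak_deriv a b (weak_deriv a b w) x) W q"
    "continuous_on {a..b} W" "continuous_on {a..b} q"
    "ae_eq a b w W" "ae_eq a b (weak_deriv a b w) q"
proof -
  let ?h = "\<lambda>x. z * w x + - 1 * weak_deriv a b (weak_deriv a b w) x"
  have H: "w \<in> H1 a b" "weak_deriv a b w \<in> H1 a b" using w by (auto simp: H2_def)
  obtain W where W: "continuous_on {a..b} W" "ae_eq a b w W" "has_weak_deriv a b W (weak_deriv a b w)"
    using continuous_representative[OF weak_deriv_works[OF H(1)] ab] .
  obtain q where q: "continuous_on {a..b} q" "ae_eq a b (weak_deriv a b w) q"
    "has_weak_deriv a b q (weak_deriv a b (weak_deriv a b w))"
    using continuous_representative[OF weak_deriv_works[OF H(2)] ab] .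
  have 1: "ae_eq a b (weak_deriv a b (weak_deriv a b w)) (\<lambda>x. z * W x - ?h x)"
    using W(2) unfolding ae_eq_def by eventually_elim simp
  have L: "(\<lambda>x. z * W x - ?h x) \<in> L2 a b"
    by (intro L2_diff L2_scale L2_add weak_deriv_L2 L2_continuous H1_L2[OF H(1)] W H)
  show ?thesis
    by (rule that[OF _ W(1) q(1) W(2) q(2)])
       (use has_weak_deriv_cong_right[OF W(3) q(2) L2_continuous[OF q(1)] ab]
          has_weak_deriv_cong_right[OF q(3) 1 L ab] W q in \<open>simp only: heat_eq_def simp_thms\<close>)
qed

text \<open>The converse passage: \<open>u\<close> is recovered algebraically from
  \<open>z u - v = f\<close>, hence \<open>z \<noteq> 0\<close>. The equation for \<open>v\<close>
  then identifies its derivative as \<open>p\<close>, which lies in \<open>H1\<close>.\<close>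

lemma wave_eq_domain:
  assumes w: "wave_eq a b z f' g p v" and f: "has_weak_deriv a b f f'" and z: "z \<noteq> 0" and ab: "a < b"
    and g: "g \<in> L2 a b"
  defines "u \<equiv> \<lambda>x. 1 / z * (v x + f x)"
  shows "u \<in> H2 a b" "v \<in> H1 a b" "ae_eq a b (weak_deriv a b u) p"
    "ae_eq a b (\<lambda>x. z * v x + - 1 * weak_deriv a b (weak_deriv a b u) x) g"
proof -
  have c: "continuous_on {a..b} p" "continuous_on {a..b} v"
    and d: "has_weak_deriv a b p (\<lambda>x. z * v x - g x)" "has_weak_deriv a b v (\<lambda>x. z * p x - f' x)"
    using w by (auto simp: wave_eq_def)
  have "has_weak_deriv a b u (\<lambda>x. 1 / z * ((z * p x - f' x) + f' x))"
    unfolding u_def by (intro has_weak_deriv_scale has_weak_deriv_add d f ab)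
  then have du: "has_weak_deriv a b u p" using z by simp
  show v: "v \<in> H1 a b" using d(2) by (auto simp: H1_iff)
  show e: "ae_eq a b (weak_deriv a b u) p" by (rule weak_deriv_ae_eq[OF du ab])
  have u: "u \<in> H1 a b" using du by (auto simp: H1_iff)
  have "weak_deriv a b u \<in> H1 a b"
    using d(1) by (intro H1_cong[OF _ weak_deriv_L2[OF u] ae_eq_sym[OF e] ab]) (auto simp: H1_iff)
  with u show "u \<in> H2 a b" by (simp add: H2_def)
  \<comment> \<open>A genuine equality of functions: \<open>weak_deriv\<close> makes the same choice
    for \<open>L2\<close> functions that agree almost everywhere.\<close>
  have "weak_deriv a b (weak_deriv a b u) = weak_deriv a b p"
    by (rule weak_deriv_cong[OF weak_deriv_L2[OF u] L2_continuous[OF c(1)] e ab])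
  then have "ae_eq a b (weak_deriv a b (weak_deriv a b u)) (\<lambda>x. z * v x - g x)"
    using weak_deriv_ae_eq[OF d(1) ab] by simp
  then show "ae_eq a b (\<lambda>x. z * v x + - 1 * weak_deriv a b (weak_deriv a b u) x) g"
    unfolding ae_eq_def by eventually_elim simp
qed

lemma heat_eq_domain:
  assumes w: "heat_eq a b z h w q" and ab: "a < b"
  shows "w \<in> H2 a b" "ae_eq a b (weak_deriv a b w) q"
    "ae_eq a b (\<lambda>x. z * w x + - 1 * weak_deriv a b (weak_deriv a b w) x) h"
proof -
  have c: "continuous_on {a..b} w" "continuous_on {a..b} q"
    and d: "has_weak_deriv a b w q" "has_weak_deriv a b q (\<lambda>x. z * w x - h x)"
    using w by (auto simp: heat_eq_def)
  show e: "ae_eq a b (weak_deriv a b w) q" by (rule weak_deriv_ae_eq[OF d(1) ab])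
  have u: "w \<in> H1 a b" using d by (auto simp: H1_iff)
  have "weak_deriv a b w \<in> H1 a b"
    using d(2) by (intro H1_cong[OF _ weak_deriv_L2[OF u] ae_eq_sym[OF e] ab]) (auto simp: H1_iff)
  with u show "w \<in> H2 a b" by (simp add: H2_def)
  have "weak_deriv a b (weak_deriv a b w) = weak_deriv a b q"
    by (rule weak_deriv_cong[OF weak_deriv_L2[OF u] L2_continuous[OF c(2)] e ab])
  then have "ae_eq a b (weak_deriv a b (weak_deriv a b w)) (\<lambda>x. z * w x - h x)"
    using weak_deriv_ae_eq[OF d(2) ab] by simp
  then show "ae_eq a b (\<lambda>x. z * w x + - 1 * weak_deriv a b (weak_deriv a b w) x) h"
    unfolding ae_eq_def by eventually_elim simp
qed

section \<open>Bound and solvability of the resolvent equation\<close>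

lemma l2_norm_le_bound_ae:
  assumes "ae_eq a b f h" "continuous_on {a..b} h" "f \<in> L2 a b"
    "\<And>x. x \<in> {a..b} \<Longrightarrow> cmod (h x) \<le> B" "a < b" "b \<le> a + 1"
  shows "l2_norm a b f \<le> B"
proof -
  have "0 \<le> B" by (rule order_trans[OF norm_ge_zero assms(4)[of a]]) (use assms(5) in simp)
  moreover have "l2_norm a b f = l2_norm a b h"
    by (rule l2_norm_cong[OF assms(1,3) L2_continuous[OF assms(2)]])
  ultimately show ?thesis
    using l2_norm_le_bound[of a b h B] L2_continuous[OF assms(2)] assms(4-6) by simp
qed

lemma sqrt_sum5_le:
  assumes "\<And>x. x \<in> {a, b, c, d, e} \<Longrightarrow> 0 \<le> x \<and> x \<le> B"
  shows "sqrt (a\<^sup>2 + b\<^sup>2 + c\<^sup>2 + d\<^sup>2 + e\<^sup>2) \<le> 3 * B"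
proof -
  have "a\<^sup>2 \<le> B\<^sup>2" "b\<^sup>2 \<le> B\<^sup>2" "c\<^sup>2 \<le> B\<^sup>2" "d\<^sup>2 \<le> B\<^sup>2" "e\<^sup>2 \<le> B\<^sup>2"
    using assms by (auto intro!: power_mono)
  then have "a\<^sup>2 + b\<^sup>2 + c\<^sup>2 + d\<^sup>2 + e\<^sup>2 \<le> 9 * B\<^sup>2" using zero_le_power2[of B] by linarith
  also have "\<dots> = (3 * B)\<^sup>2" by (simp add: power_mult_distrib)
  finally have "sqrt (a\<^sup>2 + b\<^sup>2 + c\<^sup>2 + d\<^sup>2 + e\<^sup>2) \<le> sqrt ((3 * B)\<^sup>2)" by (rule real_sqrt_le_mono)
  moreover have "0 \<le> B" using assms[of a] by simp
  ultimately show ?thesis by (simp only: real_sqrt_abs)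
qed

text \<open>Makes the state norm of the data an admissible \<open>M\<close> in
  \<open>coupled_bounds\<close>.\<close>

lemma le_sqrt_sum5:
  fixes a b c d e :: real
  shows "a \<le> sqrt (a\<^sup>2 + b\<^sup>2 + c\<^sup>2 + d\<^sup>2 + e\<^sup>2)" "b \<le> sqrt (a\<^sup>2 + b\<^sup>2 + c\<^sup>2 + d\<^sup>2 + e\<^sup>2)"
    "c \<le> sqrt (a\<^sup>2 + b\<^sup>2 + c\<^sup>2 + d\<^sup>2 + e\<^sup>2)" "d \<le> sqrt (a\<^sup>2 + b\<^sup>2 + c\<^sup>2 + d\<^sup>2 + e\<^sup>2)"
    "e \<le> sqrt (a\<^sup>2 + b\<^sup>2 + c\<^sup>2 + d\<^sup>2 + e\<^sup>2)"
  by (rule real_le_rsqrt; simp add: add_nonneg_nonneg)+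

text \<open>\<open>coupled_bounds\<close> for the continuous representatives, with \<open>M\<close>
  the norm of the data. Each of the five components is at most \<open>149 |\<mu>| M\<close>, and
  \<open>447 = 3 * 149\<close>. Differences appear as \<open>+ - 1 * ...\<close> to match the
  subtraction of states after transfer.\<close>

lemma resolvent_equation_rep_bound:
  assumes \<mu>: "\<mu>\<^sup>2 = \<i> * complex_of_real s" "40 \<le> Re \<mu>"
    and dom: "domain_rep (u, v, w, u2, v2)"
  defines "z \<equiv> \<i> * complex_of_real s"
  defines "f \<equiv> \<lambda>x. z * u x + - 1 * v x" and "g \<equiv> \<lambda>x. z * v x + - 1 * weak_deriv 0 1 (weak_deriv 0 1 u) x"
    and "h \<equiv> \<lambda>x. z * w x + - 1 * weak_deriv 1 2 (weak_deriv 1 2 w) x"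
    and "f2 \<equiv> \<lambda>x. z * u2 x + - 1 * v2 x" and "g2 \<equiv> \<lambda>x. z * v2 x + - 1 * weak_deriv 2 3 (weak_deriv 2 3 u2) x"
  shows "sqrt ((l2_norm 0 1 (weak_deriv 0 1 u))\<^sup>2 + (l2_norm 0 1 v)\<^sup>2 + (l2_norm 1 2 w)\<^sup>2 +
           (l2_norm 2 3 (weak_deriv 2 3 u2))\<^sup>2 + (l2_norm 2 3 v2)\<^sup>2) \<le>
    447 * cmod \<mu> * sqrt ((l2_norm 0 1 (weak_deriv 0 1 f))\<^sup>2 + (l2_norm 0 1 g)\<^sup>2 + (l2_norm 1 2 h)\<^sup>2 +
           (l2_norm 2 3 (weak_deriv 2 3 f2))\<^sup>2 + (l2_norm 2 3 g2)\<^sup>2)"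
    (is "?lhs \<le> 447 * cmod \<mu> * ?M")
proof -
  have d: "u \<in> H2 0 1" "v \<in> H1 0 1" "w \<in> H2 1 2" "u2 \<in> H2 2 3" "v2 \<in> H1 2 3"
    and bc0: "has_value 0 1 v 0 0" "has_value 2 3 v2 3 0"
    using dom by (auto simp: domain_rep_def)
  obtain c1 c2 c3 c4 where bc: "has_value 0 1 (weak_deriv 0 1 u) 1 c1" "has_value 1 2 (weak_deriv 1 2 w) 1 c1"
    "has_value 0 1 v 1 c2" "has_value 1 2 w 1 c2"
    "has_value 2 3 (weak_deriv 2 3 u2) 2 c3" "has_value 1 2 (weak_deriv 1 2 w) 2 c3"
    "has_value 2 3 v2 2 c4" "has_value 1 2 w 2 c4"
    using dom by (auto simp: domain_rep_def)
  have H: "u \<in> H1 0 1" "weak_deriv 0 1 u \<in> H1 0 1" "w \<in> H1 1 2" "weak_deriv 1 2 w \<in> H1 1 2"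
    "u2 \<in> H1 2 3" "weak_deriv 2 3 u2 \<in> H1 2 3"
    using d by (auto simp: H2_def)
  obtain p1 V1 where 1: "wave_eq 0 1 z (weak_deriv 0 1 f) g p1 V1" "continuous_on {0..1} p1" "continuous_on {0..1} V1"
    "ae_eq 0 1 (weak_deriv 0 1 u) p1" "ae_eq 0 1 v V1"
    using wave_eq_of_domain[OF d(1,2), of z] unfolding f_def g_def by auto
  obtain W q where 2: "heat_eq 1 2 z h W q" "continuous_on {1..2} W" "continuous_on {1..2} q"
    "ae_eq 1 2 w W" "ae_eq 1 2 (weak_deriv 1 2 w) q"
    using heat_eq_of_domain[OF d(3), of z] unfolding h_def by auto
  obtain p2 V2 where 3: "wave_eq 2 3 z (weak_deriv 2 3 f2) g2 p2 V2" "continuous_on {2..3} p2" "continuous_on {2..3} V2"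
    "ae_eq 2 3 (weak_deriv 2 3 u2) p2" "ae_eq 2 3 v2 V2"
    using wave_eq_of_domain[OF d(4,5), of z] unfolding f2_def g2_def by auto
  note val = has_value_iff[OF 1(2) 1(4)] has_value_iff[OF 1(3) 1(5)] has_value_iff[OF 2(2) 2(4)]
    has_value_iff[OF 2(3) 2(5)] has_value_iff[OF 3(2) 3(4)] has_value_iff[OF 3(3) 3(5)]
  have bv: "V1 0 = 0" "p1 1 = q 1" "V1 1 = W 1" "p2 2 = q 2" "V2 2 = W 2" "V2 3 = 0"
    using bc0 bc by (simp_all add: val)
  have L: "weak_deriv 0 1 f \<in> L2 0 1" "g \<in> L2 0 1" "h \<in> L2 1 2" "weak_deriv 2 3 f2 \<in> L2 2 3" "g2 \<in> L2 2 3"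
    unfolding f_def g_def h_def f2_def g2_def
    by (intro L2_add L2_scale weak_deriv_L2 H1_add H1_scale H1_L2 d H; simp)+
  note bounds = coupled_bounds[OF \<mu> 1(1)[unfolded z_def] 2(1)[unfolded z_def] 3(1)[unfolded z_def] bv L
      le_sqrt_sum5]
  have "?lhs \<le> 3 * (149 * (cmod \<mu> * ?M))"
  proof (rule sqrt_sum5_le, elim insertE emptyE)
    note n = l2_norm_nonneg
    have L': "weak_deriv 0 1 u \<in> L2 0 1" "v \<in> L2 0 1" "w \<in> L2 1 2" "weak_deriv 2 3 u2 \<in> L2 2 3" "v2 \<in> L2 2 3"
      by (intro weak_deriv_L2 H1_L2 H d)+
    fix x
    show "0 \<le> x \<and> x \<le> 149 * (cmod \<mu> * ?M)" if "x = l2_norm 0 1 (weak_deriv 0 1 u)"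
      using l2_norm_le_bound_ae[OF 1(4,2) L'(1) bounds(1)] n by (simp add: that)
    show "0 \<le> x \<and> x \<le> 149 * (cmod \<mu> * ?M)" if "x = l2_norm 0 1 v"
      using l2_norm_le_bound_ae[OF 1(5,3) L'(2) bounds(2)] n by (simp add: that)
    show "0 \<le> x \<and> x \<le> 149 * (cmod \<mu> * ?M)" if "x = l2_norm 1 2 w"
      using l2_norm_le_bound_ae[OF 2(4,2) L'(3) bounds(3)] n by (simp add: that)
    show "0 \<le> x \<and> x \<le> 149 * (cmod \<mu> * ?M)" if "x = l2_norm 2 3 (weak_deriv 2 3 u2)"
      using l2_norm_le_bound_ae[OF 3(4,2) L'(4) bounds(4)] n by (simp add: that)
    show "0 \<le> x \<and> x \<le> 149 * (cmod \<mu> * ?M)" if "x = l2_norm 2 3 v2"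
      using l2_norm_le_bound_ae[OF 3(5,3) L'(5) bounds(5)] n by (simp add: that)
  qed
  then show ?thesis by simp
qed

text \<open>The coupled problem yields \<open>v\<close>, \<open>w\<close>, \<open>v2\<close>, and
  \<open>u = (v + f) / z\<close>, similarly \<open>u2\<close>. The outer boundary values of
  \<open>u\<close> and \<open>u2\<close> vanish because those of the velocities and of
  \<open>f\<close>, \<open>f2\<close> do.\<close>

lemma resolvent_equation_rep_solvable:
  assumes \<mu>: "\<mu>\<^sup>2 = \<i> * complex_of_real s" "40 \<le> Re \<mu>"
    and car: "(f, g, h, f2, g2) \<in> state_carrier"
  defines "z \<equiv> \<i> * complex_of_real s"
  obtains u v w u2 v2 where "domain_rep (u, v, w, u2, v2)" "(u, v, w, u2, v2) \<in> state_carrier"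
    "state_rel (\<lambda>x. z * u x + - 1 * v x, \<lambda>x. z * v x + - 1 * weak_deriv 0 1 (weak_deriv 0 1 u) x,
        \<lambda>x. z * w x + - 1 * weak_deriv 1 2 (weak_deriv 1 2 w) x,
        \<lambda>x. z * u2 x + - 1 * v2 x, \<lambda>x. z * v2 x + - 1 * weak_deriv 2 3 (weak_deriv 2 3 u2) x)
      (f, g, h, f2, g2)"
proof -
  have z: "z \<noteq> 0" using \<mu> by (auto simp flip: z_def)
  have c: "f \<in> H1 0 1" "g \<in> L2 0 1" "h \<in> L2 1 2" "f2 \<in> H1 2 3" "g2 \<in> L2 2 3"
    "has_value 0 1 f 0 0" "has_value 2 3 f2 3 0"
    using car by (auto simp: state_carrier_def)
  obtain p1 v w q p2 v2 where
    eqs: "wave_eq 0 1 z (weak_deriv 0 1 f) g p1 v" "heat_eq 1 2 z h w q"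
      "wave_eq 2 3 z (weak_deriv 2 3 f2) g2 p2 v2"
    and bc: "v 0 = 0" "p1 1 = q 1" "v 1 = w 1" "p2 2 = q 2" "v2 2 = w 2" "v2 3 = 0"
    unfolding z_def by (rule coupled_solution[OF \<mu> weak_deriv_L2[OF c(1)] c(2,3) weak_deriv_L2[OF c(4)] c(5)])
  define u where "u = (\<lambda>x. 1 / z * (v x + f x))"
  define u2 where "u2 = (\<lambda>x. 1 / z * (v2 x + f2 x))"
  note 1 = wave_eq_domain[OF eqs(1) weak_deriv_works[OF c(1)] z _ c(2), folded u_def, simplified]
  note 2 = heat_eq_domain[OF eqs(2), simplified]
  note 3 = wave_eq_domain[OF eqs(3) weak_deriv_works[OF c(4)] z _ c(5), folded u2_def, simplified]
  have cont: "continuous_on {0..1} p1" "continuous_on {0..1} v" "continuous_on {1..2} w" "continuous_on {1..2} q"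
    "continuous_on {2..3} p2" "continuous_on {2..3} v2"
    using eqs by (auto simp: wave_eq_def heat_eq_def)
  have val: "has_value 0 1 v x (v x)" "has_value 1 2 w x (w x)" "has_value 2 3 v2 x (v2 x)"
    "has_value 0 1 (weak_deriv 0 1 u) x (p1 x)" "has_value 1 2 (weak_deriv 1 2 w) x (q x)"
    "has_value 2 3 (weak_deriv 2 3 u2) x (p2 x)" for x
    using cont 1(3) 2(2) 3(3) ae_eq_refl unfolding has_value_def by blast+
  have dom: "domain_rep (u, v, w, u2, v2)"
    unfolding domain_rep_def prod.case using 1(1,2) 2(1) 3(1,2) val bc by metis
  have "has_value 0 1 u 0 (1 / z * (v 0 + 0))" "has_value 2 3 u2 3 (1 / z * (v2 3 + 0))"
    unfolding u_def u2_def by (intro has_value_scale has_value_add val c)+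
  moreover have H: "u \<in> H1 0 1" "w \<in> H1 1 2" "u2 \<in> H1 2 3"
    using 1(1) 2(1) 3(1) by (auto simp: H2_def)
  ultimately have car': "(u, v, w, u2, v2) \<in> state_carrier"
    using 1 2 3 by (auto simp: state_carrier_def H1_L2 bc)
  have e: "(\<lambda>x. z * u x + - 1 * v x) = f" "(\<lambda>x. z * u2 x + - 1 * v2 x) = f2"
    using z by (auto simp: u_def u2_def)
  have "(\<lambda>x. z * v x + - 1 * weak_deriv 0 1 (weak_deriv 0 1 u) x) \<in> L2 0 1"
    "(\<lambda>x. z * w x + - 1 * weak_deriv 1 2 (weak_deriv 1 2 w) x) \<in> L2 1 2"
    "(\<lambda>x. z * v2 x + - 1 * weak_deriv 2 3 (weak_deriv 2 3 u2) x) \<in> L2 2 3"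
    by (intro L2_add L2_scale H2_weak_deriv_L2 H1_L2 H 1 2 3)+
  then show ?thesis
    using 1(4) 2(3) 3(4) car e by (intro that[OF dom car']) (auto simp: state_carrier_def)
qed

text \<open>Subtraction is spelled out through \<open>scaleC_state (- 1)\<close>, which is lifted to
  the quotient and so accessible to transfer, unlike the plainly defined
  \<open>minus_state\<close>.\<close>

lemma resolvent_equation_bound:
  assumes \<mu>: "\<mu>\<^sup>2 = \<i> * complex_of_real s" "40 \<le> Re \<mu>" and x: "in_domain x"
  shows "norm x \<le> 447 * cmod \<mu> * norm (scaleC_state (\<i> * complex_of_real s) x + scaleC_state (- 1) (op_A x))"
  using x
  by (transfer fixing: \<mu> s)
     (clarify, simp only: prod.case if_True, rule resolvent_equation_rep_bound[OF \<mu>])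

lemma resolvent_equation_solvable:
  assumes \<mu>: "\<mu>\<^sup>2 = \<i> * complex_of_real s" "40 \<le> Re \<mu>"
  shows "\<exists>x. in_domain x \<and> scaleC_state (\<i> * complex_of_real s) x + scaleC_state (- 1) (op_A x) = y"
proof (transfer fixing: \<mu> s, goal_cases)
  case (1 y)
  obtain f g h f2 g2 where y: "y = (f, g, h, f2, g2)" by (cases y)
  with 1 have "(f, g, h, f2, g2) \<in> state_carrier" by simp
  from resolvent_equation_rep_solvable[OF \<mu> this] obtain u v w u2 v2 where
    x: "domain_rep (u, v, w, u2, v2)" "(u, v, w, u2, v2) \<in> state_carrier"
      "state_rel (\<lambda>x. \<i> * s * u x + - 1 * v x, \<lambda>x. \<i> * s * v x + - 1 * weak_deriv 0 1 (weak_deriv 0 1 u) x,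
        \<lambda>x. \<i> * s * w x + - 1 * weak_deriv 1 2 (weak_deriv 1 2 w) x,
        \<lambda>x. \<i> * s * u2 x + - 1 * v2 x, \<lambda>x. \<i> * s * v2 x + - 1 * weak_deriv 2 3 (weak_deriv 2 3 u2) x)
      (f, g, h, f2, g2)" .
  have "state_rel (u, v, w, u2, v2) (u, v, w, u2, v2)" using x(2) by simp
  with x(1,3) show ?case
    by (intro bexI[of _ "(u, v, w, u2, v2)"]) (simp_all only: prod.case if_True y mem_Collect_eq simp_thms)
qed

section \<open>Linearity of the operator and inversion\<close>

lemma H2_lincomb:
  assumes u: "u \<in> H2 a b" and v: "v \<in> H2 a b" and ab: "a < b"
  shows "(\<lambda>x. u x + c * v x) \<in> H2 a b"
    and "ae_eq a b (weak_deriv a b (\<lambda>x. u x + c * v x)) (\<lambda>x. weak_deriv a b u x + c * weak_deriv a b v x)"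
    and "ae_eq a b (weak_deriv a b (weak_deriv a b (\<lambda>x. u x + c * v x)))
      (\<lambda>x. weak_deriv a b (weak_deriv a b u) x + c * weak_deriv a b (weak_deriv a b v) x)"
proof -
  have H: "u \<in> H1 a b" "weak_deriv a b u \<in> H1 a b" "v \<in> H1 a b" "weak_deriv a b v \<in> H1 a b"
    using u v by (auto simp: H2_def)
  have 1: "(\<lambda>x. u x + c * v x) \<in> H1 a b" "(\<lambda>x. weak_deriv a b u x + c * weak_deriv a b v x) \<in> H1 a b"
    by (intro H1_add H1_scale H ab)+
  show e: "ae_eq a b (weak_deriv a b (\<lambda>x. u x + c * v x)) (\<lambda>x. weak_deriv a b u x + c * weak_deriv a b v x)"
    by (intro weak_deriv_ae_eq has_weak_deriv_add has_weak_deriv_scale weak_deriv_works H ab)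
  show "(\<lambda>x. u x + c * v x) \<in> H2 a b"
    using H1_cong[OF 1(2) weak_deriv_L2[OF 1(1)] ae_eq_sym[OF e] ab] 1(1) by (simp add: H2_def)
  \<comment> \<open>The first derivative is linear only almost everywhere;
    \<open>weak_deriv_cong\<close> turns this into an equality once the second derivative is
    applied.\<close>
  have "weak_deriv a b (weak_deriv a b (\<lambda>x. u x + c * v x)) =
      weak_deriv a b (\<lambda>x. weak_deriv a b u x + c * weak_deriv a b v x)"
    by (rule weak_deriv_cong[OF weak_deriv_L2[OF 1(1)] H1_L2[OF 1(2)] e ab])
  moreover have "ae_eq a b (weak_deriv a b (\<lambda>x. weak_deriv a b u x + c * weak_deriv a b v x))
      (\<lambda>x. weak_deriv a b (weak_deriv a b u) x + c * weak_deriv a b (weak_deriv a b v) x)"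
    by (intro weak_deriv_ae_eq has_weak_deriv_add has_weak_deriv_scale weak_deriv_works H ab)
  ultimately show "ae_eq a b (weak_deriv a b (weak_deriv a b (\<lambda>x. u x + c * v x)))
      (\<lambda>x. weak_deriv a b (weak_deriv a b u) x + c * weak_deriv a b (weak_deriv a b v) x)"
    by (simp only:)
qed

lemma has_value_lincomb:
  "has_value a b f p k \<Longrightarrow> has_value a b g p l \<Longrightarrow> has_value a b (\<lambda>x. f x + c * g x) p (k + c * l)"
  by (intro has_value_add has_value_scale)

lemma has_value_lincomb_zero:
  "has_value a b f p 0 \<Longrightarrow> has_value a b g p 0 \<Longrightarrow> has_value a b (\<lambda>x. f x + c * g x) p 0"
  using has_value_lincomb[of a b f p 0 g 0 c] by simp

text \<open>The trace conditions are linear: common boundary values such as \<open>c1\<close> and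
  \<open>d1\<close> combine to \<open>c1 + c * d1\<close>.\<close>

lemma domain_rep_lincomb:
  assumes "domain_rep (u, v, w, p, q)" "domain_rep (u', v', w', p', q')"
  shows "domain_rep (\<lambda>x. u x + c * u' x, \<lambda>x. v x + c * v' x, \<lambda>x. w x + c * w' x,
    \<lambda>x. p x + c * p' x, \<lambda>x. q x + c * q' x)"
proof -
  have d: "u \<in> H2 0 1" "v \<in> H1 0 1" "w \<in> H2 1 2" "p \<in> H2 2 3" "q \<in> H1 2 3"
    "u' \<in> H2 0 1" "v' \<in> H1 0 1" "w' \<in> H2 1 2" "p' \<in> H2 2 3" "q' \<in> H1 2 3"
    and v0: "has_value 0 1 v 0 0" "has_value 2 3 q 3 0" "has_value 0 1 v' 0 0" "has_value 2 3 q' 3 0"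
    using assms by (auto simp: domain_rep_def)
  obtain c1 c2 c3 c4 where bc: "has_value 0 1 (weak_deriv 0 1 u) 1 c1" "has_value 1 2 (weak_deriv 1 2 w) 1 c1"
    "has_value 0 1 v 1 c2" "has_value 1 2 w 1 c2"
    "has_value 2 3 (weak_deriv 2 3 p) 2 c3" "has_value 1 2 (weak_deriv 1 2 w) 2 c3"
    "has_value 2 3 q 2 c4" "has_value 1 2 w 2 c4"
    using assms(1) by (auto simp: domain_rep_def)
  obtain d1 d2 d3 d4 where bd: "has_value 0 1 (weak_deriv 0 1 u') 1 d1" "has_value 1 2 (weak_deriv 1 2 w') 1 d1"
    "has_value 0 1 v' 1 d2" "has_value 1 2 w' 1 d2"
    "has_value 2 3 (weak_deriv 2 3 p') 2 d3" "has_value 1 2 (weak_deriv 1 2 w') 2 d3"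
    "has_value 2 3 q' 2 d4" "has_value 1 2 w' 2 d4"
    using assms(2) by (auto simp: domain_rep_def)
  note e = H2_lincomb(2)[OF d(1,6), of c, simplified] H2_lincomb(2)[OF d(3,8), of c, simplified]
    H2_lincomb(2)[OF d(4,9), of c, simplified]
  note val = has_value_cong[OF has_value_lincomb ae_eq_sym[OF e(1)]]
    has_value_cong[OF has_value_lincomb ae_eq_sym[OF e(2)]]
    has_value_cong[OF has_value_lincomb ae_eq_sym[OF e(3)]]
  have "has_value 0 1 (weak_deriv 0 1 (\<lambda>x. u x + c * u' x)) 1 (c1 + c * d1)"
    "has_value 1 2 (weak_deriv 1 2 (\<lambda>x. w x + c * w' x)) 1 (c1 + c * d1)"
    "has_value 0 1 (\<lambda>x. v x + c * v' x) 1 (c2 + c * d2)" "has_value 1 2 (\<lambda>x. w x + c * w' x) 1 (c2 + c * d2)"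
    "has_value 2 3 (weak_deriv 2 3 (\<lambda>x. p x + c * p' x)) 2 (c3 + c * d3)"
    "has_value 1 2 (weak_deriv 1 2 (\<lambda>x. w x + c * w' x)) 2 (c3 + c * d3)"
    "has_value 2 3 (\<lambda>x. q x + c * q' x) 2 (c4 + c * d4)" "has_value 1 2 (\<lambda>x. w x + c * w' x) 2 (c4 + c * d4)"
    by (intro val has_value_lincomb bc bd)+
  moreover have "(\<lambda>x. u x + c * u' x) \<in> H2 0 1" "(\<lambda>x. v x + c * v' x) \<in> H1 0 1"
    "(\<lambda>x. w x + c * w' x) \<in> H2 1 2" "(\<lambda>x. p x + c * p' x) \<in> H2 2 3" "(\<lambda>x. q x + c * q' x) \<in> H1 2 3"
    by (intro H2_lincomb(1) H1_add H1_scale d; simp)+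
  ultimately show ?thesis
    using has_value_lincomb_zero[OF v0(1,3)] has_value_lincomb_zero[OF v0(2,4)]
    unfolding domain_rep_def prod.case by blast
qed

lemma op_A_lincomb:
  assumes "in_domain x" "in_domain y"
  shows "in_domain (x + scaleC_state c y)" "op_A (x + scaleC_state c y) = op_A x + scaleC_state c (op_A y)"
proof -
  show "in_domain (x + scaleC_state c y)"
    using assms by transfer (clarsimp simp: domain_rep_lincomb)
  show "op_A (x + scaleC_state c y) = op_A x + scaleC_state c (op_A y)"
    using assms
  proof (transfer, clarsimp simp: domain_rep_lincomb, goal_cases)
    case (1 u v w p q u' v' w' p' q' c)
    have d: "u \<in> H2 0 1" "v \<in> H1 0 1" "w \<in> H2 1 2" "p \<in> H2 2 3" "q \<in> H1 2 3"
      "u' \<in> H2 0 1" "v' \<in> H1 0 1" "w' \<in> H2 1 2" "p' \<in> H2 2 3" "q' \<in> H1 2 3"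
      and v0: "has_value 0 1 v 0 0" "has_value 2 3 q 3 0" "has_value 0 1 v' 0 0" "has_value 2 3 q' 3 0"
      using 1 by (auto simp: domain_rep_def)
    have "(\<lambda>x. v x + c * v' x) \<in> H1 0 1" "(\<lambda>x. q x + c * q' x) \<in> H1 2 3"
      "(\<lambda>x. u x + c * u' x) \<in> H2 0 1" "(\<lambda>x. w x + c * w' x) \<in> H2 1 2" "(\<lambda>x. p x + c * p' x) \<in> H2 2 3"
      by (intro H2_lincomb(1) H1_add H1_scale d; simp)+
    then show ?case
      using has_value_lincomb_zero[OF v0(1,3)] has_value_lincomb_zero[OF v0(2,4)]
        H2_lincomb(3)[OF d(1,6)] H2_lincomb(3)[OF d(3,8)] H2_lincomb(3)[OF d(4,9)] d
      by (auto simp: state_carrier_def intro!: L2_add L2_scale H2_weak_deriv_L2)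
  qed
qed

text \<open>The type is only an instance of real vector spaces, so the additivity of complex scaling
  is established separately.\<close>

lemma scaleC_state_lincomb:
  "scaleC_state z (x + r *\<^sub>R y) = scaleC_state z x + r *\<^sub>R scaleC_state z y"
  unfolding scaleR_state_def
proof (transfer, clarsimp, goal_cases)
  case (1 z u v w p q r u' v' w' p' q')
  have e: "(\<lambda>x. z * (f x + complex_of_real r * f' x)) = (\<lambda>x. z * f x + complex_of_real r * (z * f' x))"
    for f f' :: "real \<Rightarrow> complex" by (simp add: fun_eq_iff algebra_simps)
  have c: "u \<in> H1 0 1" "v \<in> L2 0 1" "w \<in> L2 1 2" "p \<in> H1 2 3" "q \<in> L2 2 3"
    "u' \<in> H1 0 1" "v' \<in> L2 0 1" "w' \<in> L2 1 2" "p' \<in> H1 2 3" "q' \<in> L2 2 3"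
    and v0: "has_value 0 1 u 0 0" "has_value 2 3 p 3 0" "has_value 0 1 u' 0 0" "has_value 2 3 p' 3 0"
    using 1 by (auto simp: state_carrier_def)
  have "has_value 0 1 (\<lambda>x. z * (u x + complex_of_real r * u' x)) 0 (z * 0)"
    "has_value 2 3 (\<lambda>x. z * (p x + complex_of_real r * p' x)) 3 (z * 0)"
    by (intro has_value_scale has_value_lincomb_zero v0)+
  moreover have "(\<lambda>x. z * (u x + complex_of_real r * u' x)) \<in> H1 0 1"
    "(\<lambda>x. z * (v x + complex_of_real r * v' x)) \<in> L2 0 1" "(\<lambda>x. z * (w x + complex_of_real r * w' x)) \<in> L2 1 2"
    "(\<lambda>x. z * (p x + complex_of_real r * p' x)) \<in> H1 2 3" "(\<lambda>x. z * (q x + complex_of_real r * q' x)) \<in> L2 2 3"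
    by (intro H1_add H1_scale L2_add L2_scale c; simp)+
  ultimately show ?case
    by (simp add: e state_carrier_def)
qed

text \<open>The lower bound gives injectivity and, evaluated at preimages, the bound on the inverse;
  surjectivity makes the inverse defined everywhere.\<close>

lemma inverse_of_bounded_below:
  fixes D :: "state set" and B :: "state \<Rightarrow> state"
  assumes lin: "\<And>x y r. x \<in> D \<Longrightarrow> y \<in> D \<Longrightarrow> x + r *\<^sub>R y \<in> D \<and> B (x + r *\<^sub>R y) = B x + r *\<^sub>R B y"
    and below: "\<And>x. x \<in> D \<Longrightarrow> norm x \<le> K * norm (B x)" and K: "0 \<le> K"
    and surj: "\<And>y. \<exists>x\<in>D. B x = y"
  shows "bij_betw B D UNIV" "bounded_linear (inv_into D B)" "onorm (inv_into D B) \<le> K"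
proof -
  let ?R = "inv_into D B"
  have inj: "inj_on B D"
  proof (rule inj_onI)
    fix x y assume xy: "x \<in> D" "y \<in> D" "B x = B y"
    have "norm (x + (-1) *\<^sub>R y) \<le> K * norm (B (x + (-1) *\<^sub>R y))" using lin[OF xy(1,2)] below by blast
    then show "x = y" using lin[OF xy(1,2), of "-1"] xy(3) by simp
  qed
  moreover have im: "B ` D = UNIV" using surj by (metis UNIV_eq_I image_eqI)
  ultimately show "bij_betw B D UNIV" by (simp add: bij_betw_def)
  have R: "?R y \<in> D" "B (?R y) = y" for y
    using inv_into_into[of y B D] f_inv_into_f[of y B D] im by auto
  have eq: "?R y = x" if "x \<in> D" "B x = y" for x y using inv_into_f_f[OF inj that(1)] that(2) by simp
  have le: "norm (?R y) \<le> K * norm y" for y using below[OF R(1)[of y]] R(2) by simp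
  have add: "?R (x + r *\<^sub>R y) = ?R x + r *\<^sub>R ?R y" for x y r
    using lin[OF R(1)[of x] R(1)[of y]] R(2) by (intro eq) auto
  have zero: "?R 0 = 0" using le[of 0] by simp
  show "bounded_linear ?R"
  proof (rule bounded_linear_intro)
    show "?R (x + y) = ?R x + ?R y" for x y using add[of x 1 y] by simp
    show "?R (r *\<^sub>R y) = r *\<^sub>R ?R y" for r y using add[of 0 r y] zero by simp
    show "norm (?R x) \<le> norm x * K" for x using le[of x] by (simp add: mult.commute)
  qed
  show "onorm ?R \<le> K" by (rule onorm_bound[OF K le])
qed

theorem theorem3p1:
  shows "\<exists>C>0. \<exists>N>0. \<forall>s::real. \<bar>s\<bar> \<ge> N \<longrightarrow>
           \<i> * complex_of_real s \<in> resolvent_set dom_A op_A \<and>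
           onorm (resolvent dom_A op_A (\<i> * complex_of_real s)) \<le> C * \<bar>s\<bar> powr (1/2)"
\<comment> \<open>Since \<open>|s| = |\<mu>|^2 = 2 (Re \<mu>)^2\<close>, the threshold
  \<open>3200 = 2 * 40^2\<close> ensures \<open>Re \<mu> \<ge> 40\<close>.\<close>
proof (rule exI[of _ 447], rule conjI[OF _ exI[of _ 3200]], simp, intro conjI allI impI)
  fix s :: real assume s: "3200 \<le> \<bar>s\<bar>"
  let ?z = "\<i> * complex_of_real s" and ?B = "\<lambda>x. scaleC_state (\<i> * complex_of_real s) x - op_A x"
  \<comment> \<open>The principal root has nonnegative real part.\<close>
  define \<mu> where "\<mu> = csqrt ?z"
  have \<mu>: "\<mu>\<^sup>2 = ?z" unfolding \<mu>_def by (rule power2_csqrt)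
  have n: "(cmod \<mu>)\<^sup>2 = \<bar>s\<bar>"
    using arg_cong[OF \<mu>, of cmod] by (simp add: norm_power norm_mult)
  have "(Re \<mu>)\<^sup>2 = (Im \<mu>)\<^sup>2" using arg_cong[OF \<mu>, of Re] by (simp add: power2_eq_square)
  then have "40\<^sup>2 \<le> (Re \<mu>)\<^sup>2" using n s by (simp add: cmod_power2)
  moreover have "0 \<le> Re \<mu>" unfolding \<mu>_def using csqrt_principal[of ?z] by auto
  ultimately have k: "40 \<le> Re \<mu>" by (rule power2_le_imp_le)
  have nm: "cmod \<mu> = \<bar>s\<bar> powr (1/2)"
    unfolding powr_half_sqrt[OF abs_ge_zero] n[symmetric] by simp
  have B: "?B x = scaleC_state ?z x + scaleC_state (- 1) (op_A x)" for x
    by (simp only: minus_state_def uminus_state_def)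
  have lin: "x + r *\<^sub>R y \<in> dom_A \<and> ?B (x + r *\<^sub>R y) = ?B x + r *\<^sub>R ?B y"
    if "x \<in> dom_A" "y \<in> dom_A" for x y r
    using op_A_lincomb[of x y "complex_of_real r"] that scaleC_state_lincomb
    by (simp add: dom_A_def scaleR_state_def[symmetric] algebra_simps)
  have below: "norm x \<le> 447 * cmod \<mu> * norm (?B x)" if "x \<in> dom_A" for x
    unfolding B using resolvent_equation_bound[OF \<mu> k] that by (simp add: dom_A_def)
  have surj: "\<exists>x\<in>dom_A. ?B x = y" for y
    unfolding B using resolvent_equation_solvable[OF \<mu> k] by (auto simp: dom_A_def)
  note R = inverse_of_bounded_below[of dom_A ?B, OF lin below _ surj]
  show "?z \<in> resolvent_set dom_A op_A"
    using R by (simp add: resolvent_set_def resolvent_def)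
  show "onorm (resolvent dom_A op_A ?z) \<le> 447 * \<bar>s\<bar> powr (1/2)"
    using R(3) unfolding resolvent_def nm by simp
qed simp

end
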